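(* Consider the PM-CuSum stopping time $T_b$ with threshold $b=\log\gamma$, window set $\mathcal W=\{2^r: r=1,2,\dots,\lceil\log_2 b\rceil\}$, and Fixed Share weights with parameter $\alpha=1/b$. Suppose: (i) (KL-loss) there exist constants $0<\beta\le 1$ and $C_1<\infty$ such that for every window length $w$, every $n>w$ and every $P\in\mathcal P$ (with density $p$), $$\mathbb E_1^P\left(\log\frac{p(X_n)}{\hat p_n^{(w)}(X_n)}\right)\le\frac{C_1}{w^\beta};$$ (ii) (overshoot) there exists a constant $C_2$ (not depending on $n$, $\nu$, $b$) such that for all $n$ $$\sup_{t\ge 0}\mathbb E_\nu^P\left(\hat\ell_n-t\;\middle|\;\hat\ell_n\ge t,\ \mathcal F_{n-1}\right)\le C_2\quad\text{almost surely.}$$ Then, for all $P\in\mathcal P$, as $\gamma\to\infty$ the detection delay of PM-CuSum is given by $$\mathcal D_P(T_b)=\frac{\log\gamma}{D(p\,\|\,q)}+O\big((\log\log\gamma)^2\big)\quad\text{if }\beta=1,$$ $$\mathcal D_P(T_b)=\frac{\log\gamma}{D(p\,\|\,q)}+O\big((\log\gamma)^{1-\beta}\big)\quad\text{if }0<\beta<1.$$ Therefore, the procedure is first-order asymptotically optimal as $\gamma\to\infty$ when $\beta>0$: for all $P\in\mathcal P$, $\mathcal D_P(T_b)=(1+o(1))\inf_{T\in\mathcal C_\gamma}\mathcal D_P(T)$.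
   Context: Model: $X_1,X_2,\dots$ are independent; for an unknown deterministic change-point $\nu\ge 1$, $X_n\sim Q$ for $n\le\nu-1$ and $X_n\sim P$ for $n\ge\nu$. $Q$ is known, $P$ belongs to a known family $\mathcal P$, and $Q,P$ have densities $q,p$ with respect to a common dominating measure $\mu$. $\mathcal F_n=\sigma(X_1,\dots,X_n)$. $\mathbb E_\nu^P$ is expectation when the change occurs at $\nu$ with post-change distribution $P$ (so under $\mathbb E_1^P$ all $X_n$ are i.i.d. from $P$); $\mathbb E_\infty$ is expectation when there is no change (all $X_n\sim Q$). $D(p\|q)=\int\log\frac{p(x)}{q(x)}\,p(x)\,d\mu(x)$ is the Kullback–Leibler divergence (quotients by it are understood for $0<D(p\|q)<\infty$). Criteria: $\mathcal C_\gamma=\{T:\mathbb E_\infty(T)\ge\gamma\}$, where $T$ ranges over stopping times with respect to $\{\mathcal F_n\}$; Lorden's worst-case delay is $$\mathcal D_P(T)=\sup_{\nu\ge1}\ \operatorname{ess\,sup}\ \mathbb E_\nu^P\big((T-\nu+1)^+\mid\mathcal F_{\nu-1}\big).$$ Predictors: for each window length $w$, $\hat p_n^{(w)}(x)=\hat p(x\mid X_{n-1},\dots,X_{\max\{1,n-w\}})$ is a probability density in $x$ (with respect to $\mu$) constructed from the past $w$ observations (the window being capped at $n-1$ when $n\le w$). PM-CuSum with Fixed Share weights: set $\pi_1^{(w)}=1/|\mathcal W|$ for $w\in\mathcal W$, $S_0=0$, and for $n\ge1$ $$\hat p_n(x)=\sum_{w\in\mathcal W}\pi_n^{(w)}\hat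 p_n^{(w)}(x),\quad \hat\ell_n=\log\frac{\hat p_n(X_n)}{q(X_n)},\quad S_n=\max\{S_{n-1},0\}+\hat\ell_n,$$ $$\tilde\pi_{n+1}^{(w)}=\frac{\pi_n^{(w)}\hat p_n^{(w)}(X_n)}{\sum_{v\in\mathcal W}\pi_n^{(v)}\hat p_n^{(v)}(X_n)},\qquad \pi_{n+1}^{(w)}=(1-\alpha)\tilde\pi_{n+1}^{(w)}+\frac{\alpha}{|\mathcal W|}.$$ The stopping time is $T_b=\inf\{n\ge1:S_n>b\}$. *)

theory Defs
  imports "HOL-Probability.Probability" "HOL-Library.Landau_Symbols"
begin

section \<open>Densities, log-ratios, Kullback--Leibler divergence\<close>

definition is_prob_density :: "'a measure \<Rightarrow> ('a \<Rightarrow> real) \<Rightarrow> bool" where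
  "is_prob_density \<mu> f \<longleftrightarrow>
     f \<in> borel_measurable \<mu> \<and> (\<forall>x\<in>space \<mu>. 0 \<le> f x) \<and> (\<integral>\<^sup>+x. ennreal (f x) \<partial>\<mu>) = 1"

text \<open>
  \<open>log (u / v)\<close> for nonnegative \<open>u\<close>, \<open>v\<close>, with the infinite values kept
  (on reals, \<open>ln 0 = 0\<close> and \<open>u / 0 = 0\<close> would be wrong).  The value at \<open>u = v = 0\<close>
  is a convention.
\<close>
definition log_ratio :: "real \<Rightarrow> real \<Rightarrow> ereal" where
  "log_ratio u v = (if u = 0 then -\<infinity> else if v = 0 then \<infinity> else ereal (ln (u / v)))"

text \<open>
  Expectation as (integral of positive part) minus (integral of negative part).  The
  Bochner integral would be \<open>0\<close> on non-integrable functions and so make upper bounds on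
  expectations hold spuriously.
\<close>
definition ext_expectation :: "'b measure \<Rightarrow> ('b \<Rightarrow> ereal) \<Rightarrow> ereal" where
  "ext_expectation M f =
     enn2ereal (\<integral>\<^sup>+x. e2ennreal (f x) \<partial>M) - enn2ereal (\<integral>\<^sup>+x. e2ennreal (- f x) \<partial>M)"

definition KL_div :: "'a measure \<Rightarrow> ('a \<Rightarrow> real) \<Rightarrow> ('a \<Rightarrow> real) \<Rightarrow> ereal" where
  "KL_div \<mu> p q = ext_expectation (density \<mu> p) (\<lambda>x. log_ratio (p x) (q x))"


section \<open>The change-point model\<close>

text \<open>
  The observations \<open>X\<^sub>1, X\<^sub>2, \<dots>\<close> are the coordinates \<open>\<omega> 1, \<omega> 2, \<dots>\<close> of a point \<open>\<omega>\<close>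
  of the product space over \<open>{1..}\<close>; \<open>q\<close> and \<open>p\<close> are the pre- and post-change densities.
\<close>
definition law :: "'a measure \<Rightarrow> ('a \<Rightarrow> real) \<Rightarrow> ('a \<Rightarrow> real) \<Rightarrow> nat \<Rightarrow> (nat \<Rightarrow> 'a) measure" where
  "law \<mu> q p \<nu> = PiM {1..} (\<lambda>n. if n < \<nu> then density \<mu> q else density \<mu> p)"

definition law_no_change :: "'a measure \<Rightarrow> ('a \<Rightarrow> real) \<Rightarrow> (nat \<Rightarrow> 'a) measure" where
  "law_no_change \<mu> q = PiM {1..} (\<lambda>n. density \<mu> q)"

text \<open>
  \<open>obs_filtration \<mu> n\<close> is the \<open>\<sigma>\<close>-algebra generated by \<open>X\<^sub>1, \<dots>, X\<^sub>n\<close>.  It is indexed by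
  \<open>enat\<close> so that \<open>stopping_time\<close> applies to stopping times with values in
  \<open>{0, 1, \<dots>, \<infinity>}\<close>; the condition at index \<open>\<infinity>\<close> is void.
\<close>
definition obs_filtration :: "'a measure \<Rightarrow> enat \<Rightarrow> (nat \<Rightarrow> 'a) measure" where
  "obs_filtration \<mu> n = sigma (space (PiM {1::nat..} (\<lambda>_. \<mu>)))
     {(\<lambda>\<omega>. \<omega> i) -` A \<inter> space (PiM {1::nat..} (\<lambda>_. \<mu>)) | i A. 1 \<le> i \<and> enat i \<le> n \<and> A \<in> sets \<mu>}"

definition stopping_class ::
  "'a measure \<Rightarrow> ('a \<Rightarrow> real) \<Rightarrow> real \<Rightarrow> ((nat \<Rightarrow> 'a) \<Rightarrow> enat) set" where
  "stopping_class \<mu> q \<gamma> = {T. stopping_time (obs_filtration \<mu>) T \<and>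
     ennreal \<gamma> \<le> (\<integral>\<^sup>+\<omega>. ennreal_of_enat (T \<omega>) \<partial>law_no_change \<mu> q)}"

text \<open>Subtraction on \<open>enat\<close> is truncated, so \<open>T \<omega> + 1 - \<nu>\<close> is the positive part \<open>(T - \<nu> + 1)\<^sup>+\<close>.\<close>
definition lorden_delay ::
  "'a measure \<Rightarrow> ('a \<Rightarrow> real) \<Rightarrow> ('a \<Rightarrow> real) \<Rightarrow> ((nat \<Rightarrow> 'a) \<Rightarrow> enat) \<Rightarrow> ennreal" where
  "lorden_delay \<mu> q p T = (SUP \<nu>\<in>{1::nat..}. esssup (law \<mu> q p \<nu>)
     (nn_cond_exp (law \<mu> q p \<nu>) (obs_filtration \<mu> (enat (\<nu> - 1)))
        (\<lambda>\<omega>. ennreal_of_enat (T \<omega> + 1 - enat \<nu>))))"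

text \<open>
  \<open>E(f | A, F)\<close> for an event \<open>A\<close>, a \<open>\<sigma>\<close>-algebra \<open>F\<close> and \<open>f \<ge> 0\<close>, defined as
  \<open>E(f 1\<^sub>A | F) / P(A | F)\<close>.  Where \<open>P(A | F) = 0\<close> the numerator vanishes almost surely as
  well, and the \<open>ennreal\<close> quotient \<open>0 / 0\<close> is \<open>0\<close>.
\<close>
definition nn_cond_exp_event ::
  "'b measure \<Rightarrow> 'b measure \<Rightarrow> 'b set \<Rightarrow> ('b \<Rightarrow> ennreal) \<Rightarrow> 'b \<Rightarrow> ennreal" where
  "nn_cond_exp_event M F A f \<omega> =
     nn_cond_exp M F (\<lambda>\<omega>. f \<omega> * indicator A \<omega>) \<omega> / nn_cond_exp M F (indicator A) \<omega>"


section \<open>Predictors and the PM-CuSum procedure\<close>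

text \<open>
  \<open>phat w xs\<close> is the predictive density of window length \<open>w\<close> built from the list \<open>xs\<close> of
  past observations, most recent first; \<open>xs\<close> is shorter than \<open>w\<close> when the window is capped.
  The first condition is joint measurability in the past and the new observation.
\<close>
definition is_predictor :: "'a measure \<Rightarrow> (nat \<Rightarrow> 'a list \<Rightarrow> 'a \<Rightarrow> real) \<Rightarrow> bool" where
  "is_predictor \<mu> phat \<longleftrightarrow> (\<forall>w\<ge>1.
     (\<forall>k\<le>w. (\<lambda>(y, x). phat w (map y [0..<k]) x)
               \<in> borel_measurable (PiM {..<k} (\<lambda>_. \<mu>) \<Otimes>\<^sub>M \<mu>)) \<and>
     (\<forall>xs\<in>lists (space \<mu>). length xs \<le> w \<longrightarrow> is_prob_density \<mu> (phat w xs)))"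

text \<open>The list below is \<open>X\<^bsub>n-1\<^esub>, \<dots>, X\<^bsub>max {1, n-w}\<^esub>\<close>.\<close>
definition window_pred ::
  "(nat \<Rightarrow> 'a list \<Rightarrow> 'a \<Rightarrow> real) \<Rightarrow> nat \<Rightarrow> nat \<Rightarrow> (nat \<Rightarrow> 'a) \<Rightarrow> 'a \<Rightarrow> real" where
  "window_pred phat w n \<omega> x = phat w (map \<omega> (rev [max 1 (n - w)..<n])) x"

text \<open>
  The weights \<open>\<pi>\<^sub>n\<close> for \<open>n \<ge> 1\<close>; index \<open>0\<close> is a dummy.  If all predictive densities vanish at the
  new observation, the posterior is \<open>0 / 0\<close> in the usual formula; it is then taken to be the
  previous weights, so that the weights always sum to one.
\<close>
primrec fixed_share ::
  "nat set \<Rightarrow> real \<Rightarrow> (nat \<Rightarrow> 'a list \<Rightarrow> 'a \<Rightarrow> real) \<Rightarrow> (nat \<Rightarrow> 'a) \<Rightarrow> nat \<Rightarrow> nat \<Rightarrow> real" where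
  "fixed_share W \<alpha> phat \<omega> 0 = (\<lambda>w. 1 / card W)"
| "fixed_share W \<alpha> phat \<omega> (Suc n) = (\<lambda>w.
     if n = 0 then 1 / card W
     else let wt = fixed_share W \<alpha> phat \<omega> n;
              Z = (\<Sum>v\<in>W. wt v * window_pred phat v n \<omega> (\<omega> n));
              post = (if Z = 0 then wt w else wt w * window_pred phat w n \<omega> (\<omega> n) / Z)
          in (1 - \<alpha>) * post + \<alpha> / card W)"

definition mixture_pred ::
  "nat set \<Rightarrow> real \<Rightarrow> (nat \<Rightarrow> 'a list \<Rightarrow> 'a \<Rightarrow> real) \<Rightarrow> nat \<Rightarrow> (nat \<Rightarrow> 'a) \<Rightarrow> 'a \<Rightarrow> real" where
  "mixture_pred W \<alpha> phat n \<omega> x =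
     (\<Sum>w\<in>W. fixed_share W \<alpha> phat \<omega> n w * window_pred phat w n \<omega> x)"

definition log_lik ::
  "('a \<Rightarrow> real) \<Rightarrow> nat set \<Rightarrow> real \<Rightarrow> (nat \<Rightarrow> 'a list \<Rightarrow> 'a \<Rightarrow> real) \<Rightarrow> nat \<Rightarrow> (nat \<Rightarrow> 'a) \<Rightarrow> ereal" where
  "log_lik q W \<alpha> phat n \<omega> = log_ratio (mixture_pred W \<alpha> phat n \<omega> (\<omega> n)) (q (\<omega> n))"

primrec pm_cusum_stat ::
  "('a \<Rightarrow> real) \<Rightarrow> nat set \<Rightarrow> real \<Rightarrow> (nat \<Rightarrow> 'a list \<Rightarrow> 'a \<Rightarrow> real) \<Rightarrow> nat \<Rightarrow> (nat \<Rightarrow> 'a) \<Rightarrow> ereal" where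
  "pm_cusum_stat q W \<alpha> phat 0 = (\<lambda>\<omega>. 0)"
| "pm_cusum_stat q W \<alpha> phat (Suc n) =
     (\<lambda>\<omega>. max (pm_cusum_stat q W \<alpha> phat n \<omega>) 0 + log_lik q W \<alpha> phat (Suc n) \<omega>)"

definition pm_cusum_time ::
  "('a \<Rightarrow> real) \<Rightarrow> nat set \<Rightarrow> real \<Rightarrow> (nat \<Rightarrow> 'a list \<Rightarrow> 'a \<Rightarrow> real) \<Rightarrow> real \<Rightarrow> (nat \<Rightarrow> 'a) \<Rightarrow> enat" where
  "pm_cusum_time q W \<alpha> phat b \<omega> =
     Inf {enat n | n. 1 \<le> n \<and> ereal b < pm_cusum_stat q W \<alpha> phat n \<omega>}"

text \<open>Nonempty exactly when \<open>b > 1\<close>.\<close>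
definition dyadic_windows :: "real \<Rightarrow> nat set" where
  "dyadic_windows b = (\<lambda>r. 2 ^ r) ` {1..nat \<lceil>log 2 b\<rceil>}"

end

theory Submission
  imports Defs "HOL-Library.Discrete_Functions" "HOL-Real_Asymp.Real_Asymp"
begin

text \<open>
  Write \<open>b = ln \<gamma>\<close> and let \<open>D\<close> be the divergence of the post-change density from \<open>q\<close>.  The delay of
  PM-CuSum and the optimal delay are both \<open>b / D\<close> up to a lower-order term.  The lower bound holds for
  every procedure with mean time to false alarm at least \<open>\<gamma>\<close>, and the upper bound for PM-CuSum, which
  is one of them; together they give the expansion of its delay as well as its optimality.
  
  Lower bound (\<open>lorden_delay_lower_bound\<close>).  If \<open>T\<close> has mean at least \<open>\<gamma>\<close> without a change, some
  window of length \<open>m\<close> exists in which \<open>T\<close> stops with conditional probability at most \<open>2 m / \<gamma>\<close>.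
  Let the change happen at its start.  To stop soon after the change, \<open>T\<close> must then be quick with
  large probability under one law and with tiny probability under the other, which costs
  \<open>ln (\<gamma> / (2 m))\<close> units of log-likelihood ratio; these arrive at mean rate \<open>D\<close>.  Taking \<open>m\<close> of order
  \<open>b\<^sup>2\<close> loses only \<open>O(ln b)\<close>.
  
  False alarms (\<open>stop_in_stopping_class\<close>).  The exponential of the CuSum statistic is dominated by
  the Shiryaev--Roberts statistic \<open>R\<^sub>n\<close>, and \<open>R\<^sub>n - n\<close> is a supermartingale without a change because
  each mixture density integrates to one.  At the time of alarm \<open>R\<close> has reached \<open>\<gamma>\<close>, so by optional
  stopping the mean of this time is at least \<open>\<gamma>\<close>.
  
  Upper bound (\<open>lorden_delay_upper_bound\<close>).  Restarting the CuSum sum after the change only decreases it,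
  so up to the stopping time the log-likelihood of the mixture exceeds that of \<open>q\<close> by at most \<open>b\<close> and
  an overshoot.  The mixture is compared to the true density through a sequence of windows, whose
  length doubles as post-change observations accumulate, so that they never reach back before the
  change.  Four costs arise.  The regret of fixed share (\<open>fixed_share_regret\<close>) is \<open>O(ln b)\<close> for each of
  the \<open>O(ln b)\<close> changes of window.  The loss of the windows (\<open>expected_loss_le\<close>,
  \<open>sum_window_loss_le\<close>) adds up to \<open>O(b powr (1 - \<beta>))\<close> or, for \<open>\<beta> = 1\<close>, to \<open>O(ln b)\<close> while they grow,
  and afterwards it is a small fraction of the delay itself.  So is the cost \<open>- ln (1 - \<alpha>)\<close> per step of
  keeping a window.  The overshoot (\<open>overshoot_tail\<close>) has exponential tails and costs \<open>O(ln b)\<close>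
  and, once more, a small fraction of the delay.
  The small fractions are moved to the other side, where they reduce \<open>D\<close> by \<open>O(b powr (- \<beta>))\<close>.
  
  The conditioning in Lorden's criterion is handled throughout by integrals over events \<open>A\<close> of the
  time before the change.
\<close>

text \<open>The sequences of observations are indexed by \<open>{1..}\<close>, which is not to become \<open>{Suc 0..}\<close>.\<close>
declare One_nat_def [simp del]

section \<open>Independent observations\<close>

abbreviation obs_space :: "'a measure \<Rightarrow> (nat \<Rightarrow> 'a) set" where
  "obs_space \<mu> \<equiv> space (PiM {1::nat..} (\<lambda>_. \<mu>))"

abbreviation past :: "'a measure \<Rightarrow> nat \<Rightarrow> (nat \<Rightarrow> 'a) measure" where
  "past \<mu> n \<equiv> obs_filtration \<mu> (enat n)"

lemma space_past [simp]: "space (obs_filtration \<mu> n) = obs_space \<mu>"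
  unfolding obs_filtration_def by (rule space_measure_of) auto

lemma sets_past:
  "sets (obs_filtration \<mu> n) = sigma_sets (obs_space \<mu>)
     {(\<lambda>\<omega>. \<omega> i) -` A \<inter> obs_space \<mu> | i A. 1 \<le> i \<and> enat i \<le> n \<and> A \<in> sets \<mu>}"
  unfolding obs_filtration_def by (rule sets_measure_of) auto

lemma sets_past_mono: "m \<le> n \<Longrightarrow> sets (obs_filtration \<mu> m) \<subseteq> sets (obs_filtration \<mu> n)"
  unfolding sets_past by (rule sigma_sets_mono') (auto intro: order_trans)

lemma measurable_past_mono:
  "f \<in> measurable (obs_filtration \<mu> m) N \<Longrightarrow> m \<le> n \<Longrightarrow> f \<in> measurable (obs_filtration \<mu> n) N"
  using sets_past_mono[of m n \<mu>] by (auto simp: measurable_def)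

lemma coordinate_in_space: "\<omega> \<in> obs_space \<mu> \<Longrightarrow> 1 \<le> i \<Longrightarrow> \<omega> i \<in> space \<mu>"
  by (auto simp: space_PiM PiE_def Pi_def)

lemma measurable_coordinate_past:
  assumes "1 \<le> i" "i \<le> n"
  shows "(\<lambda>\<omega>. \<omega> i) \<in> measurable (past \<mu> n) \<mu>"
proof (rule measurableI)
  show "\<omega> i \<in> space \<mu>" if "\<omega> \<in> space (past \<mu> n)" for \<omega>
    using that assms coordinate_in_space by fastforce
  show "(\<lambda>\<omega>. \<omega> i) -` A \<inter> space (past \<mu> n) \<in> sets (past \<mu> n)" if "A \<in> sets \<mu>" for A
    unfolding sets_past space_past using assms that by (intro sigma_sets.Basic) auto
qed

lemma sets_past_subset: "sets (obs_filtration \<mu> n) \<subseteq> sets (PiM {1::nat..} (\<lambda>_. \<mu>))"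
  unfolding sets_past by (rule sets.sigma_sets_subset) auto

lemma past_depends_only:
  assumes "A \<in> sets (past \<mu> n)" and "\<omega> \<in> obs_space \<mu>" "\<omega>' \<in> obs_space \<mu>"
    and "\<And>i. 1 \<le> i \<Longrightarrow> i \<le> n \<Longrightarrow> \<omega> i = \<omega>' i"
  shows "\<omega> \<in> A \<longleftrightarrow> \<omega>' \<in> A"
  using assms(1) unfolding sets_past
proof (induction rule: sigma_sets.induct)
  case (Basic a)
  then show ?case using assms(2-) by auto
qed (use assms(2-) in auto)

text \<open>
  The events that depend measurably on the first \<open>n\<close> coordinates form a \<open>\<sigma>\<close>-algebra containing the
  generators.  In this form events of the past can be compared between two laws and separated from
  the future.
\<close>
lemma past_as_restriction:
  assumes "A \<in> sets (past \<mu> n)"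
  obtains A' where "A' \<in> sets (PiM {1..n} (\<lambda>_. \<mu>))"
    "\<And>\<omega>. \<omega> \<in> obs_space \<mu> \<Longrightarrow> \<omega> \<in> A \<longleftrightarrow> restrict \<omega> {1..n} \<in> A'"
proof -
  let ?V = "vimage_algebra (obs_space \<mu>) (\<lambda>\<omega>. restrict \<omega> {1..n}) (PiM {1..n} (\<lambda>_. \<mu>))"
  have res: "(\<lambda>\<omega>. restrict \<omega> {1..n}) \<in> obs_space \<mu> \<rightarrow> space (PiM {1..n} (\<lambda>_. \<mu>))"
    by (auto simp: space_PiM PiE_def Pi_def)
  have "sets (past \<mu> n) \<subseteq> sets ?V"
  proof -
    have "(\<lambda>\<omega>. \<omega> i) -` B \<inter> obs_space \<mu> \<in> sets ?V" if "1 \<le> i" "i \<le> n" "B \<in> sets \<mu>" for i B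
    proof -
      have "(\<lambda>\<omega>. \<omega> i) -` B \<inter> space (PiM {1..n} (\<lambda>_. \<mu>)) \<in> sets (PiM {1..n} (\<lambda>_. \<mu>))"
        using that by (intro measurable_sets[OF measurable_component_singleton]) auto
      then have "(\<lambda>\<omega>. restrict \<omega> {1..n}) -` ((\<lambda>\<omega>. \<omega> i) -` B \<inter> space (PiM {1..n} (\<lambda>_. \<mu>))) \<inter> obs_space \<mu> \<in> sets ?V"
        unfolding sets_vimage_algebra2[OF res] by blast
      also have "(\<lambda>\<omega>. restrict \<omega> {1..n}) -` ((\<lambda>\<omega>. \<omega> i) -` B \<inter> space (PiM {1..n} (\<lambda>_. \<mu>))) \<inter> obs_space \<mu>
          = (\<lambda>\<omega>. \<omega> i) -` B \<inter> obs_space \<mu>"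
        using res that by auto
      finally show ?thesis .
    qed
    then have "{(\<lambda>\<omega>. \<omega> i) -` B \<inter> obs_space \<mu> | i B. 1 \<le> i \<and> enat i \<le> enat n \<and> B \<in> sets \<mu>} \<subseteq> sets ?V"
      by auto
    then show ?thesis
      unfolding sets_past using sets.sigma_sets_subset[of _ ?V] by (metis (no_types, lifting) space_vimage_algebra)
  qed
  with assms obtain A' where A': "A' \<in> sets (PiM {1..n} (\<lambda>_. \<mu>))"
      and eq: "A = (\<lambda>\<omega>. restrict \<omega> {1..n}) -` A' \<inter> obs_space \<mu>"
    unfolding sets_vimage_algebra2[OF res] by blast
  show ?thesis by (rule that[OF A']) (auto simp: eq)
qed

lemma past_function_depends_only:
  fixes f :: "(nat \<Rightarrow> 'a) \<Rightarrow> 'b::t1_space"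
  assumes f: "f \<in> borel_measurable (past \<mu> n)" and "\<omega> \<in> obs_space \<mu>" "\<omega>' \<in> obs_space \<mu>"
    and "\<And>i. 1 \<le> i \<Longrightarrow> i \<le> n \<Longrightarrow> \<omega> i = \<omega>' i"
  shows "f \<omega> = f \<omega>'"
proof -
  have "f -` {f \<omega>} \<inter> obs_space \<mu> \<in> sets (past \<mu> n)"
    using measurable_sets[OF f, of "{f \<omega>}"] by simp
  from past_depends_only[OF this assms(2,3,4)] assms(2,3) show ?thesis by simp
qed

text \<open>
  Identities for nonnegative integrals hold for the positive and the negative part; this carries
  them over to integrable functions.
\<close>
lemma integral_scaled:
  assumes f: "integrable N f" and g: "g \<in> borel_measurable M" and c: "c < \<infinity>"
    and pos: "(\<integral>\<^sup>+x. ennreal (g x) \<partial>M) = c * (\<integral>\<^sup>+x. ennreal (f x) \<partial>N)"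
    and neg: "(\<integral>\<^sup>+x. ennreal (- g x) \<partial>M) = c * (\<integral>\<^sup>+x. ennreal (- f x) \<partial>N)"
  shows "integrable M g" "(\<integral>x. g x \<partial>M) = enn2real c * (\<integral>x. f x \<partial>N)"
proof -
  have fin: "(\<integral>\<^sup>+x. ennreal (f x) \<partial>N) \<noteq> \<infinity>" "(\<integral>\<^sup>+x. ennreal (- f x) \<partial>N) \<noteq> \<infinity>"
    using f unfolding real_integrable_def by blast+
  show i: "integrable M g"
    unfolding real_integrable_def pos neg using fin c g by (simp add: ennreal_mult_eq_top_iff)
  show "(\<integral>x. g x \<partial>M) = enn2real c * (\<integral>x. f x \<partial>N)"
    unfolding real_lebesgue_integral_def[OF i] real_lebesgue_integral_def[OF f] pos neg
    by (simp only: enn2real_mult right_diff_distrib)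
qed

lemma integral_le_of_nn_integral_le:
  assumes f: "f \<in> borel_measurable M" "\<And>x. x \<in> space M \<Longrightarrow> 0 \<le> f x"
    and le: "(\<integral>\<^sup>+x. ennreal (f x) \<partial>M) \<le> ennreal c" and c: "0 \<le> c"
  shows "integrable M f" "(\<integral>x. f x \<partial>M) \<le> c"
proof -
  show i: "integrable M f"
    using f le by (intro integrableI_nonneg) (auto intro: le_less_trans)
  have "ennreal (\<integral>x. f x \<partial>M) \<le> ennreal c"
    using le f(2) by (subst nn_integral_eq_integral[OF i, symmetric]) auto
  then show "(\<integral>x. f x \<partial>M) \<le> c" using c by (simp add: ennreal_le_iff)
qed

locale independent_observations =
  fixes \<mu> :: "'a measure" and K :: "nat \<Rightarrow> 'a measure"
  assumes prob_K: "\<And>i. prob_space (K i)"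
    and sets_K: "\<And>i. sets (K i) = sets \<mu>"
begin

abbreviation "L \<equiv> PiM {1..} K"

lemma space_K: "space (K i) = space \<mu>"
  using sets_K by (rule sets_eq_imp_space_eq)

lemma sets_PiM_K: "sets (PiM J K) = sets (PiM J (\<lambda>_. \<mu>))"
  by (rule sets_PiM_cong) (auto simp: sets_K)

lemma sets_L: "sets L = sets (PiM {1..} (\<lambda>_. \<mu>))"
  by (rule sets_PiM_K)

lemma space_L [simp]: "space L = obs_space \<mu>"
  using sets_PiM_K by (rule sets_eq_imp_space_eq)

lemma measurable_L: "measurable L N = measurable (PiM {1..} (\<lambda>_. \<mu>)) N"
  by (rule measurable_cong_sets) (auto simp: sets_PiM_K)

lemma prob_L: "prob_space L"
  by (intro prob_space_PiM prob_K)

lemma past_sets_L: "A \<in> sets (obs_filtration \<mu> n) \<Longrightarrow> A \<in> sets L"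
  using sets_past_subset sets_PiM_K by blast

lemma past_measurable_L: "f \<in> measurable (obs_filtration \<mu> n) N \<Longrightarrow> f \<in> measurable L N"
  using sets_past_subset[of \<mu> n] by (auto simp: measurable_def sets_PiM_K)

lemma subalgebra_past: "subalgebra L (obs_filtration \<mu> n)"
  unfolding subalgebra_def using past_sets_L by auto

lemma update_measurable:
  assumes "1 \<le> i"
  shows "(\<lambda>(\<omega>, x). \<omega> (i := x)) \<in> measurable (L \<Otimes>\<^sub>M K i) L"
proof -
  have "{1..} = insert i {1::nat..}" using assms by auto
  then have "(\<lambda>z. (fst z)(i := snd z)) \<in> measurable (L \<Otimes>\<^sub>M K i) (PiM (insert i {1..}) K)"
    by (intro measurable_fun_upd[of _ "{1..}"]) auto
  then show ?thesis
    using \<open>{1..} = insert i {1::nat..}\<close> by (simp add: case_prod_unfold)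
qed

lemma nn_integral_split_coordinate:
  assumes i: "1 \<le> i" and [measurable]: "f \<in> borel_measurable L"
  shows "(\<integral>\<^sup>+\<omega>. f \<omega> \<partial>L) = (\<integral>\<^sup>+\<omega>. (\<integral>\<^sup>+x. f (\<omega> (i := x)) \<partial>K i) \<partial>PiM ({1..} - {i}) K)"
proof -
  let ?I = "{1..} - {i}"
  interpret Ki: prob_space "K i" by (rule prob_K)
  interpret PI: prob_space "PiM ?I K" by (intro prob_space_PiM prob_K)
  interpret pair_sigma_finite "K i" "PiM ?I K" by unfold_locales
  have ins: "insert i ?I = {1..}" using i by auto
  have upd: "(\<lambda>(x, X). X(i := x)) \<in> measurable (K i \<Otimes>\<^sub>M PiM ?I K) L"
  proof -
    have "(\<lambda>z. (snd z)(i := fst z)) \<in> measurable (K i \<Otimes>\<^sub>M PiM ?I K) (PiM (insert i ?I) K)"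
      by (intro measurable_fun_upd[of _ ?I]) auto
    then show ?thesis using ins by (simp add: case_prod_unfold)
  qed
  have "distr (K i \<Otimes>\<^sub>M PiM ?I K) L (\<lambda>(x, X). X(i := x)) = L"
    using distr_pair_PiM_eq_PiM[of ?I K i] prob_K unfolding ins by blast
  then have "(\<integral>\<^sup>+\<omega>. f \<omega> \<partial>L) = (\<integral>\<^sup>+\<omega>. f \<omega> \<partial>distr (K i \<Otimes>\<^sub>M PiM ?I K) L (\<lambda>(x, X). X(i := x)))"
    by simp
  also have "\<dots> = (\<integral>\<^sup>+z. f (case z of (x, X) \<Rightarrow> X(i := x)) \<partial>(K i \<Otimes>\<^sub>M PiM ?I K))"
    using upd by (intro nn_integral_distr) auto
  also have "\<dots> = (\<integral>\<^sup>+\<omega>. (\<integral>\<^sup>+x. f (\<omega> (i := x)) \<partial>K i) \<partial>PiM ?I K)"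
    using measurable_compose[OF upd assms(2)]
    by (subst nn_integral_snd[symmetric]) (auto simp: case_prod_unfold)
  finally show ?thesis .
qed

lemma nn_integral_coordinate_measurable:
  assumes "1 \<le> i" and "f \<in> borel_measurable L"
  shows "(\<lambda>\<omega>. \<integral>\<^sup>+x. f (\<omega> (i := x)) \<partial>K i) \<in> borel_measurable L"
proof -
  interpret Ki: prob_space "K i" by (rule prob_K)
  show ?thesis
    using measurable_compose[OF update_measurable assms(2)] assms(1)
    by (intro Ki.borel_measurable_nn_integral) (auto simp: case_prod_unfold)
qed

text \<open>
  Drawing one observation afresh does not change the law.  The identity replaces conditioning on
  all other observations: the inner integral is the conditional expectation.
\<close>
lemma nn_integral_resample:
  assumes i: "1 \<le> i" and f: "f \<in> borel_measurable L"
  shows "(\<integral>\<^sup>+\<omega>. f \<omega> \<partial>L) = (\<integral>\<^sup>+\<omega>. (\<integral>\<^sup>+x. f (\<omega> (i := x)) \<partial>K i) \<partial>L)"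
proof -
  interpret Ki: prob_space "K i" by (rule prob_K)
  show ?thesis
    unfolding nn_integral_split_coordinate[OF i f]
      nn_integral_split_coordinate[OF i nn_integral_coordinate_measurable[OF i f]]
    by (simp add: Ki.emeasure_space_1)
qed

lemma update_in_space: "\<omega> \<in> obs_space \<mu> \<Longrightarrow> x \<in> space \<mu> \<Longrightarrow> 1 \<le> i \<Longrightarrow> \<omega> (i := x) \<in> obs_space \<mu>"
  by (auto simp: space_PiM PiE_def Pi_def extensional_def)

text \<open>
  Resampling observation \<open>n\<close> leaves \<open>f\<close> alone and turns \<open>g\<close> into its conditional mean.  In the
  applications \<open>g\<close> is the ratio of a predictive density to the density of observation \<open>n\<close>.
\<close>
lemma nn_integral_past_times_le:
  assumes n: "1 \<le> n" and f: "f \<in> borel_measurable (past \<mu> (n - 1))" and g: "g \<in> borel_measurable L"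
    and le: "\<And>\<omega>. \<omega> \<in> obs_space \<mu> \<Longrightarrow> (\<integral>\<^sup>+x. g (\<omega> (n := x)) \<partial>K n) \<le> 1"
  shows "(\<integral>\<^sup>+\<omega>. f \<omega> * g \<omega> \<partial>L) \<le> (\<integral>\<^sup>+\<omega>. f \<omega> \<partial>L)"
proof -
  have fL: "f \<in> borel_measurable L" using f by (rule past_measurable_L)
  note [measurable] = fL g
  have gx: "(\<lambda>x. g (\<omega> (n := x))) \<in> borel_measurable (K n)" if "\<omega> \<in> space L" for \<omega>
    using measurable_compose[OF measurable_Pair1'[OF that] measurable_compose[OF update_measurable[OF n] g]]
    by simp
  have "(\<integral>\<^sup>+\<omega>. f \<omega> * g \<omega> \<partial>L) = (\<integral>\<^sup>+\<omega>. (\<integral>\<^sup>+x. f (\<omega> (n := x)) * g (\<omega> (n := x)) \<partial>K n) \<partial>L)"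
    by (rule nn_integral_resample[OF n]) measurable
  also have "\<dots> = (\<integral>\<^sup>+\<omega>. f \<omega> * (\<integral>\<^sup>+x. g (\<omega> (n := x)) \<partial>K n) \<partial>L)"
  proof (intro nn_integral_cong)
    fix \<omega> assume w: "\<omega> \<in> space L"
    have "(\<integral>\<^sup>+x. f (\<omega> (n := x)) * g (\<omega> (n := x)) \<partial>K n) = (\<integral>\<^sup>+x. f \<omega> * g (\<omega> (n := x)) \<partial>K n)"
    proof (intro nn_integral_cong)
      fix x assume "x \<in> space (K n)"
      then have "f (\<omega> (n := x)) = f \<omega>"
        using w n by (intro past_function_depends_only[OF f] update_in_space) (auto simp: space_K)
      then show "f (\<omega> (n := x)) * g (\<omega> (n := x)) = f \<omega> * g (\<omega> (n := x))" by simp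
    qed
    then show "(\<integral>\<^sup>+x. f (\<omega> (n := x)) * g (\<omega> (n := x)) \<partial>K n) = f \<omega> * (\<integral>\<^sup>+x. g (\<omega> (n := x)) \<partial>K n)"
      by (simp add: nn_integral_cmult gx[OF w])
  qed
  also have "\<dots> \<le> (\<integral>\<^sup>+\<omega>. f \<omega> \<partial>L)"
  proof (intro nn_integral_mono)
    fix \<omega> assume "\<omega> \<in> space L"
    then show "f \<omega> * (\<integral>\<^sup>+x. g (\<omega> (n := x)) \<partial>K n) \<le> f \<omega>"
      using mult_left_mono[OF le, of \<omega> "f \<omega>"] by simp
  qed
  finally show ?thesis .
qed

lemma AE_coordinate:
  assumes "1 \<le> n" "AE x in K n. Q x"
  shows "AE \<omega> in L. Q (\<omega> n)"
  using assms prob_K by (intro AE_PiM_component) auto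

lemma distr_restrict:
  assumes "J \<subseteq> {1..}"
  shows "distr L (PiM J K) (\<lambda>\<omega>. restrict \<omega> J) = PiM J K"
  using distr_PiM_reindex[of "{1..}" K "\<lambda>i. i" J] assms prob_K by (auto simp: restrict_def)

lemma restrict_measurable:
  "J \<subseteq> {1..} \<Longrightarrow> (\<lambda>\<omega>. restrict \<omega> J) \<in> measurable L (PiM J K)"
  by (rule measurable_restrict_subset)

lemma emeasure_past_restriction:
  assumes "A \<in> sets (past \<mu> n)" "A' \<in> sets (PiM {1..n} (\<lambda>_. \<mu>))"
    and "\<And>\<omega>. \<omega> \<in> obs_space \<mu> \<Longrightarrow> \<omega> \<in> A \<longleftrightarrow> restrict \<omega> {1..n} \<in> A'"
  shows "emeasure L A = emeasure (PiM {1..n} K) A'"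
proof -
  have A': "A' \<in> sets (PiM {1..n} K)" using assms(2) by (simp add: sets_PiM_K)
  have "emeasure (PiM {1..n} K) A' = emeasure (distr L (PiM {1..n} K) (\<lambda>\<omega>. restrict \<omega> {1..n})) A'"
    by (subst distr_restrict) auto
  also have "\<dots> = emeasure L ((\<lambda>\<omega>. restrict \<omega> {1..n}) -` A' \<inter> space L)"
    by (rule emeasure_distr) (auto intro!: restrict_measurable A')
  also have "(\<lambda>\<omega>. restrict \<omega> {1..n}) -` A' \<inter> space L = A"
    using assms(3) sets.sets_into_space[OF past_sets_L[OF assms(1)]] by auto
  finally show ?thesis by simp
qed

text \<open>
  The first \<open>n\<close> observations and the later ones are independent blocks, so their joint law is a
  product and the integral factorizes.
\<close>
lemma nn_integral_past_event_future:
  assumes A: "A \<in> sets (past \<mu> n)" and f: "f \<in> borel_measurable (PiM {n<..} K)"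
  shows "(\<integral>\<^sup>+\<omega>. indicator A \<omega> * f (restrict \<omega> {n<..}) \<partial>L)
    = emeasure L A * (\<integral>\<^sup>+y. f y \<partial>PiM {n<..} K)"
proof -
  let ?J = "{1..n}" and ?F = "{n<..}"
  obtain A' where A': "A' \<in> sets (PiM ?J (\<lambda>_. \<mu>))"
    "\<And>\<omega>. \<omega> \<in> obs_space \<mu> \<Longrightarrow> \<omega> \<in> A \<longleftrightarrow> restrict \<omega> ?J \<in> A'"
    using past_as_restriction[OF A] by blast
  have A'K: "A' \<in> sets (PiM ?J K)" using A'(1) by (simp add: sets_PiM_K)
  interpret L: prob_space L by (rule prob_L)
  interpret F: prob_space "PiM ?F K" by (intro prob_space_PiM prob_K)
  have rJ: "(\<lambda>\<omega>. restrict \<omega> ?J) \<in> measurable L (PiM ?J K)"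
   and rF: "(\<lambda>\<omega>. restrict \<omega> ?F) \<in> measurable L (PiM ?F K)"
    by (auto intro!: restrict_measurable)
  have comp: "distr L (K i) (\<lambda>\<omega>. \<omega> i) = K i" if "1 \<le> i" for i
    using that prob_K by (intro distr_PiM_component) auto
  have "L.indep_vars K (\<lambda>i \<omega>. \<omega> i) {1..}"
  proof (subst L.indep_vars_iff_distr_eq_PiM')
    have "PiM {1..} (\<lambda>i. distr L (K i) (\<lambda>\<omega>. \<omega> i)) = L"
      by (intro PiM_cong) (auto simp: comp)
    then show "distr L L (\<lambda>x. \<lambda>i\<in>{1..}. x i) = PiM {1..} (\<lambda>i. distr L (K i) (\<lambda>\<omega>. \<omega> i))"
      using distr_restrict[of "{1..}"] by simp
  qed auto
  then have "L.indep_var (PiM ?J K) (\<lambda>\<omega>. restrict \<omega> ?J) (PiM ?F K) (\<lambda>\<omega>. restrict \<omega> ?F)"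
    using L.indep_var_restrict[of K "\<lambda>i \<omega>. \<omega> i" "{1..}" ?J ?F] by force
  then have joint: "PiM ?J K \<Otimes>\<^sub>M PiM ?F K
      = distr L (PiM ?J K \<Otimes>\<^sub>M PiM ?F K) (\<lambda>\<omega>. (restrict \<omega> ?J, restrict \<omega> ?F))"
    using distr_restrict[of ?J] distr_restrict[of ?F] by (force simp: L.indep_var_distribution_eq)
  note [measurable] = A'K f rJ rF
  have "(\<integral>\<^sup>+\<omega>. indicator A \<omega> * f (restrict \<omega> ?F) \<partial>L)
      = (\<integral>\<^sup>+\<omega>. indicator A' (restrict \<omega> ?J) * f (restrict \<omega> ?F) \<partial>L)"
    using A'(2) by (intro nn_integral_cong) (auto simp: indicator_def)
  also have "\<dots> = (\<integral>\<^sup>+z. indicator A' (fst z) * f (snd z) \<partial>distr L (PiM ?J K \<Otimes>\<^sub>M PiM ?F K)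
      (\<lambda>\<omega>. (restrict \<omega> ?J, restrict \<omega> ?F)))"
    by (subst nn_integral_distr) auto
  also have "\<dots> = (\<integral>\<^sup>+x. (\<integral>\<^sup>+y. indicator A' x * f y \<partial>PiM ?F K) \<partial>PiM ?J K)"
    unfolding joint[symmetric] by (subst F.nn_integral_fst[symmetric]) auto
  also have "\<dots> = emeasure (PiM ?J K) A' * (\<integral>\<^sup>+y. f y \<partial>PiM ?F K)"
    by (simp add: nn_integral_cmult nn_integral_multc)
  also have "emeasure (PiM ?J K) A' = emeasure L A"
    using emeasure_past_restriction[OF A A'] by simp
  finally show ?thesis .
qed

lemma integral_past_event_future:
  assumes A: "A \<in> sets (past \<mu> n)" and f: "integrable (PiM {n<..} K) f"
  shows "integrable L (\<lambda>\<omega>. indicator A \<omega> * f (restrict \<omega> {n<..}))"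
    "(\<integral>\<omega>. indicator A \<omega> * f (restrict \<omega> {n<..}) \<partial>L) = measure L A * (\<integral>y. f y \<partial>PiM {n<..} K)"
proof -
  interpret L: prob_space L by (rule prob_L)
  have [measurable]: "f \<in> borel_measurable (PiM {n<..} K)" using f by auto
  have [measurable]: "A \<in> sets L" using A by (rule past_sets_L)
  have [measurable]: "(\<lambda>\<omega>. restrict \<omega> {n<..}) \<in> measurable L (PiM {n<..} K)"
    by (rule restrict_measurable) auto
  have split: "ennreal (indicator A \<omega> * y) = indicator A \<omega> * ennreal y" for \<omega> and y :: real
    by (simp add: indicator_def)
  have pos: "(\<integral>\<^sup>+\<omega>. ennreal (indicator A \<omega> * f (restrict \<omega> {n<..})) \<partial>L)
      = emeasure L A * (\<integral>\<^sup>+y. ennreal (f y) \<partial>PiM {n<..} K)"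
    unfolding split by (rule nn_integral_past_event_future[OF A]) measurable
  have neg: "(\<integral>\<^sup>+\<omega>. ennreal (- (indicator A \<omega> * f (restrict \<omega> {n<..}))) \<partial>L)
      = emeasure L A * (\<integral>\<^sup>+y. ennreal (- f y) \<partial>PiM {n<..} K)"
    unfolding mult_minus_right[symmetric] split by (rule nn_integral_past_event_future[OF A]) measurable
  have g: "(\<lambda>\<omega>. indicator A \<omega> * f (restrict \<omega> {n<..})) \<in> borel_measurable L" by measurable
  have fin: "emeasure L A < \<infinity>" using L.emeasure_finite by (simp add: less_top[symmetric])
  show "integrable L (\<lambda>\<omega>. indicator A \<omega> * f (restrict \<omega> {n<..}))"
    "(\<integral>\<omega>. indicator A \<omega> * f (restrict \<omega> {n<..}) \<partial>L) = measure L A * (\<integral>y. f y \<partial>PiM {n<..} K)"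
    using integral_scaled[OF f g fin pos neg] by (simp_all add: Sigma_Algebra.measure_def)
qed

lemma integral_past_event_coordinate:
  assumes n: "1 \<le> n" and A: "A \<in> sets (past \<mu> (n - 1))" and f: "integrable (K n) f"
  shows "integrable L (\<lambda>\<omega>. indicator A \<omega> * f (\<omega> n))"
    "(\<integral>\<omega>. indicator A \<omega> * f (\<omega> n) \<partial>L) = measure L A * (\<integral>x. f x \<partial>K n)"
proof -
  let ?F = "PiM {n - 1<..} K"
  have n_in: "n \<in> {n - 1<..}" using n by simp
  have coord: "(\<lambda>y. y n) \<in> measurable ?F (K n)" by (rule measurable_component_singleton[OF n_in])
  have dist: "distr ?F (K n) (\<lambda>y. y n) = K n" using prob_K n_in by (intro distr_PiM_component) auto
  have "integrable ?F (\<lambda>y. f (y n))"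
    using f by (intro integrable_distr[OF coord]) (simp add: dist)
  moreover have "(\<integral>y. f (y n) \<partial>?F) = (\<integral>x. f x \<partial>K n)"
    using integral_distr[OF coord, of f] f by (simp add: dist)
  ultimately show "integrable L (\<lambda>\<omega>. indicator A \<omega> * f (\<omega> n))"
    "(\<integral>\<omega>. indicator A \<omega> * f (\<omega> n) \<partial>L) = measure L A * (\<integral>x. f x \<partial>K n)"
    using integral_past_event_future[OF A, of "\<lambda>y. f (y n)"] n_in by (simp_all del: diff_Suc_1)
qed

lemma AE_restrict:
  assumes "J \<subseteq> {1..}" "Measurable.pred (PiM J K) Q"
  shows "(AE \<omega> in L. Q (restrict \<omega> J)) \<longleftrightarrow> (AE y in PiM J K. Q y)"
proof -
  have "(AE y in distr L (PiM J K) (\<lambda>\<omega>. restrict \<omega> J). Q y) \<longleftrightarrow> (AE \<omega> in L. Q (restrict \<omega> J))"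
    using assms(2) by (intro AE_distr_iff restrict_measurable assms(1)) (simp add: pred_def)
  then show ?thesis unfolding distr_restrict[OF assms(1)] by simp
qed

lemma finite_subalgebra: "finite_measure_subalgebra L (obs_filtration \<mu> n)"
  using prob_L subalgebra_past
  by (auto simp: finite_measure_subalgebra_def finite_measure_subalgebra_axioms_def prob_space_def)

lemma nn_cond_exp_past_event:
  assumes "A \<in> sets (obs_filtration \<mu> n)" "f \<in> borel_measurable L"
  shows "(\<integral>\<^sup>+\<omega>. indicator A \<omega> * nn_cond_exp L (obs_filtration \<mu> n) f \<omega> \<partial>L)
    = (\<integral>\<^sup>+\<omega>. indicator A \<omega> * f \<omega> \<partial>L)"
proof -
  interpret finite_measure_subalgebra L "obs_filtration \<mu> n" by (rule finite_subalgebra)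
  show ?thesis using assms by (intro nn_cond_exp_intg) auto
qed

text \<open>
  The event that the conditional expectation exceeds \<open>c\<close> belongs to the \<open>\<sigma>\<close>-algebra; the bound,
  applied to this event, makes it a null set.  With the converse below, Lorden's criterion becomes
  a family of inequalities between integrals over events of the past.
\<close>
lemma esssup_nn_cond_exp_le:
  assumes f: "f \<in> borel_measurable L"
    and bound: "\<And>A. A \<in> sets (obs_filtration \<mu> n) \<Longrightarrow>
      (\<integral>\<^sup>+\<omega>. indicator A \<omega> * f \<omega> \<partial>L) \<le> ennreal c * emeasure L A"
  shows "esssup L (nn_cond_exp L (obs_filtration \<mu> n) f) \<le> ennreal c"
proof (rule esssup_I)
  interpret L: prob_space L by (rule prob_L)
  let ?g = "nn_cond_exp L (obs_filtration \<mu> n) f"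
  show "?g \<in> borel_measurable L" by measurable
  define A where "A = {\<omega> \<in> obs_space \<mu>. ennreal c < ?g \<omega>}"
  have A: "A \<in> sets (obs_filtration \<mu> n)"
  proof -
    have "{\<omega> \<in> space (obs_filtration \<mu> n). ennreal c < ?g \<omega>} \<in> sets (obs_filtration \<mu> n)"
      by measurable
    then show ?thesis by (simp add: A_def)
  qed
  note [measurable] = past_sets_L[OF A]
  have "(\<integral>\<^sup>+\<omega>. indicator A \<omega> * ?g \<omega> \<partial>L) \<le> (\<integral>\<^sup>+\<omega>. ennreal c * indicator A \<omega> \<partial>L)"
    using bound[OF A] nn_cond_exp_past_event[OF A f]
    by (subst nn_integral_cmult_indicator) (auto simp: past_sets_L[OF A])
  moreover have "(\<integral>\<^sup>+\<omega>. ennreal c * indicator A \<omega> \<partial>L) \<noteq> \<infinity>"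
    using L.emeasure_finite by (simp add: nn_integral_cmult_indicator ennreal_mult_eq_top_iff)
  moreover have "(\<integral>\<^sup>+\<omega>. indicator A \<omega> * ?g \<omega> - ennreal c * indicator A \<omega> \<partial>L)
      = (\<integral>\<^sup>+\<omega>. indicator A \<omega> * ?g \<omega> \<partial>L) - (\<integral>\<^sup>+\<omega>. ennreal c * indicator A \<omega> \<partial>L)"
    using calculation(2)
  proof (intro nn_integral_diff)
    show "AE \<omega> in L. ennreal c * indicator A \<omega> \<le> indicator A \<omega> * ?g \<omega>"
      by (auto simp: A_def indicator_def less_imp_le)
  qed auto
  ultimately have "(\<integral>\<^sup>+\<omega>. indicator A \<omega> * ?g \<omega> - ennreal c * indicator A \<omega> \<partial>L) = 0"
    by (simp add: diff_eq_0_iff_ennreal less_top)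
  then have "AE \<omega> in L. indicator A \<omega> * ?g \<omega> - ennreal c * indicator A \<omega> = 0"
    by (subst (asm) nn_integral_0_iff_AE) auto
  then show "AE \<omega> in L. ?g \<omega> \<le> ennreal c"
    by (rule AE_mp) (auto simp: A_def indicator_def not_less diff_eq_0_iff_ennreal split: if_splits)
qed

lemma nn_integral_le_esssup_nn_cond_exp:
  assumes f: "f \<in> borel_measurable L" and A: "A \<in> sets (obs_filtration \<mu> n)"
  shows "(\<integral>\<^sup>+\<omega>. indicator A \<omega> * f \<omega> \<partial>L)
    \<le> esssup L (nn_cond_exp L (obs_filtration \<mu> n) f) * emeasure L A"
proof -
  let ?g = "nn_cond_exp L (obs_filtration \<mu> n) f"
  have "(\<integral>\<^sup>+\<omega>. indicator A \<omega> * f \<omega> \<partial>L) = (\<integral>\<^sup>+\<omega>. indicator A \<omega> * ?g \<omega> \<partial>L)"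
    using nn_cond_exp_past_event[OF A f] by simp
  also have "\<dots> \<le> (\<integral>\<^sup>+\<omega>. esssup L ?g * indicator A \<omega> \<partial>L)"
    using esssup_AE[of ?g L] by (intro nn_integral_mono_AE) (auto simp: indicator_def)
  also have "\<dots> = esssup L ?g * emeasure L A"
    using past_sets_L[OF A] by (simp add: nn_integral_cmult_indicator)
  finally show ?thesis .
qed

end

text \<open>
  After conditioning on all coordinates but \<open>i\<close>, which have the same law on both sides, only the
  integrals over coordinate \<open>i\<close> have to be compared.
\<close>
lemma nn_integral_change_coordinate:
  assumes "independent_observations \<mu> K" "independent_observations \<mu> K'"
    and i: "1 \<le> i" and same: "\<And>j. j \<noteq> i \<Longrightarrow> K j = K' j"
    and f: "f \<in> borel_measurable (PiM {1..} (\<lambda>_. \<mu>))"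
    and le: "\<And>\<omega>. \<omega> \<in> obs_space \<mu> \<Longrightarrow>
      (\<integral>\<^sup>+x. f (\<omega> (i := x)) \<partial>K i) \<le> (\<integral>\<^sup>+x. g (\<omega> (i := x)) \<partial>K' i)"
    and g: "g \<in> borel_measurable (PiM {1..} (\<lambda>_. \<mu>))"
  shows "(\<integral>\<^sup>+\<omega>. f \<omega> \<partial>PiM {1..} K) \<le> (\<integral>\<^sup>+\<omega>. g \<omega> \<partial>PiM {1..} K')"
proof -
  interpret K: independent_observations \<mu> K by fact
  interpret K': independent_observations \<mu> K' by fact
  have fK: "f \<in> borel_measurable (PiM {1..} K)" and gK: "g \<in> borel_measurable (PiM {1..} K')"
    using f g unfolding K.measurable_L K'.measurable_L by auto
  have eq: "PiM ({1..} - {i}) K = PiM ({1..} - {i}) K'"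
    using same by (intro PiM_cong) auto
  obtain x0 where x0: "x0 \<in> space \<mu>"
    using prob_space.not_empty[OF K.prob_K, of 1] K.space_K[of 1] by auto
  have "(\<integral>\<^sup>+x. f (\<omega> (i := x)) \<partial>K i) \<le> (\<integral>\<^sup>+x. g (\<omega> (i := x)) \<partial>K' i)"
    if "\<omega> \<in> space (PiM ({1..} - {i}) K')" for \<omega>
  proof -
    have "\<omega> (i := x0) \<in> obs_space \<mu>"
      using that x0 i by (auto simp: space_PiM PiE_def Pi_def extensional_def K'.space_K)
    from le[OF this] show ?thesis by simp
  qed
  then show ?thesis
    unfolding K.nn_integral_split_coordinate[OF i fK] K'.nn_integral_split_coordinate[OF i gK] eq
    by (intro nn_integral_mono) auto
qed

lemma emeasure_past_cong:
  assumes "independent_observations \<mu> K" "independent_observations \<mu> K'"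
    and same: "\<And>i. 1 \<le> i \<Longrightarrow> i \<le> n \<Longrightarrow> K i = K' i" and A: "A \<in> sets (past \<mu> n)"
  shows "emeasure (PiM {1..} K) A = emeasure (PiM {1..} K') A"
proof -
  obtain A' where A': "A' \<in> sets (PiM {1..n} (\<lambda>_. \<mu>))"
    "\<And>\<omega>. \<omega> \<in> obs_space \<mu> \<Longrightarrow> \<omega> \<in> A \<longleftrightarrow> restrict \<omega> {1..n} \<in> A'"
    using past_as_restriction[OF A] by blast
  have "PiM {1..n} K = PiM {1..n} K'" using same by (intro PiM_cong) auto
  then show ?thesis
    using independent_observations.emeasure_past_restriction[OF assms(1) A A']
      independent_observations.emeasure_past_restriction[OF assms(2) A A'] by simp
qed

section \<open>Log-likelihood ratios\<close>

lemma log_ratio_measurable [measurable (raw)]: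
  assumes [measurable]: "u \<in> borel_measurable M" "v \<in> borel_measurable M"
  shows "(\<lambda>x. log_ratio (u x) (v x)) \<in> borel_measurable M"
  unfolding log_ratio_def by measurable

lemma enn2ereal_eq_enn2real: "x < \<infinity> \<Longrightarrow> enn2ereal x = ereal (enn2real x)"
  by (cases x) (auto simp: enn2ereal_ennreal)

lemma log_ratio_pos: "0 < u \<Longrightarrow> 0 < v \<Longrightarrow> log_ratio u v = ereal (ln (u / v))"
  by (simp add: log_ratio_def)

text \<open>
  \<open>ln t \<le> t\<close> bounds the negative part of \<open>ln (u / v)\<close> by \<open>v / u\<close>.  Hence a log-ratio whose
  inverse ratio has mean at most one is integrable as soon as its mean is not \<open>\<infinity>\<close>.
\<close>
lemma ext_expectation_log_ratio:
  assumes [measurable]: "u \<in> borel_measurable M" "v \<in> borel_measurable M"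
    and u: "AE x in M. 0 < u x" and v: "\<And>x. x \<in> space M \<Longrightarrow> 0 \<le> v x"
    and inverse: "(\<integral>\<^sup>+x. ennreal (v x / u x) \<partial>M) \<le> 1"
    and fin: "ext_expectation M (\<lambda>x. log_ratio (u x) (v x)) < \<infinity>"
  shows "AE x in M. 0 < v x" "integrable M (\<lambda>x. ln (u x / v x))"
    "ext_expectation M (\<lambda>x. log_ratio (u x) (v x)) = ereal (\<integral>x. ln (u x / v x) \<partial>M)"
proof -
  let ?f = "\<lambda>x. log_ratio (u x) (v x)"
  let ?P = "\<integral>\<^sup>+x. e2ennreal (?f x) \<partial>M" and ?N = "\<integral>\<^sup>+x. e2ennreal (- ?f x) \<partial>M"
  have "e2ennreal (- ?f x) \<le> ennreal (v x / u x)" if "x \<in> space M" "0 < u x" for x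
  proof (cases "v x = 0")
    case False
    then have "0 < v x" using v[OF that(1)] by simp
    moreover have "- ln (u x / v x) \<le> v x / u x"
      using ln_le_minus_one[of "v x / u x"] that(2) \<open>0 < v x\<close> by (simp add: ln_div)
    ultimately show ?thesis
      using that(2) by (simp add: log_ratio_pos e2ennreal_ereal ennreal_leI)
  qed (use that in \<open>simp add: log_ratio_def e2ennreal_neg\<close>)
  then have "AE x in M. e2ennreal (- ?f x) \<le> ennreal (v x / u x)"
    using u AE_space[of M] by auto
  then have "?N \<le> (\<integral>\<^sup>+x. ennreal (v x / u x) \<partial>M)"
    by (rule nn_integral_mono_AE)
  with inverse have N: "?N < \<infinity>"
    by (metis ennreal_one_less_top infinity_ennreal_def le_less_trans order_trans)
  (* the difference of an infinite and a finite part would be infinite *)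
  have P: "?P < \<infinity>"
  proof (rule ccontr)
    assume "\<not> ?P < \<infinity>"
    then have "?P = \<infinity>" by (metis infinity_ennreal_def less_top)
    with fin show False unfolding ext_expectation_def enn2ereal_eq_enn2real[OF N] by simp
  qed
  have "AE x in M. e2ennreal (?f x) \<noteq> \<infinity>"
    using P by (intro nn_integral_PInf_AE) auto
  with u AE_space[of M] show vpos: "AE x in M. 0 < v x"
  proof eventually_elim
    case (elim x)
    then show ?case
      using v[of x] by (cases "v x = 0") (auto simp: log_ratio_def)
  qed
  from u vpos have e: "AE x in M. ?f x = ereal (ln (u x / v x))"
    by eventually_elim (rule log_ratio_pos)
  then have P': "?P = (\<integral>\<^sup>+x. ennreal (ln (u x / v x)) \<partial>M)"
    by (intro nn_integral_cong_AE) (auto simp: e2ennreal_ereal)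
  from e have N': "?N = (\<integral>\<^sup>+x. ennreal (- ln (u x / v x)) \<partial>M)"
    by (intro nn_integral_cong_AE) (auto simp: e2ennreal_ereal)
  show "integrable M (\<lambda>x. ln (u x / v x))"
    using P N unfolding P' N' real_integrable_def by auto
  then have "(\<integral>x. ln (u x / v x) \<partial>M) = enn2real ?P - enn2real ?N"
    unfolding P' N' by (rule real_lebesgue_integral_def)
  then show "ext_expectation M ?f = ereal (\<integral>x. ln (u x / v x) \<partial>M)"
    using P N unfolding ext_expectation_def
    unfolding enn2ereal_eq_enn2real[OF P] enn2ereal_eq_enn2real[OF N] by simp
qed


section \<open>The change-point model\<close>

lemma prob_space_density: "is_prob_density \<mu> f \<Longrightarrow> prob_space (density \<mu> f)"
  by (intro prob_spaceI)
     (auto simp: is_prob_density_def emeasure_density cong: nn_integral_cong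
        intro!: trans[OF nn_integral_cong])

locale change_point =
  fixes \<mu> :: "'a measure" and q p :: "'a \<Rightarrow> real"
  assumes q: "is_prob_density \<mu> q" and p: "is_prob_density \<mu> p"
begin

sublocale post: independent_observations \<mu> "\<lambda>n. if n < \<nu> then density \<mu> q else density \<mu> p"
  rewrites "PiM {1..} (\<lambda>n. if n < \<nu> then density \<mu> q else density \<mu> p) = law \<mu> q p \<nu>"
  for \<nu>
proof -
  show "independent_observations \<mu> (\<lambda>n. if n < \<nu> then density \<mu> q else density \<mu> p)"
    by (rule independent_observations.intro) (simp_all add: prob_space_density q p)
qed (simp add: law_def)

sublocale pre: independent_observations \<mu> "\<lambda>_. density \<mu> q"
  rewrites "PiM {1..} (\<lambda>_. density \<mu> q) = law_no_change \<mu> q"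
proof -
  show "independent_observations \<mu> (\<lambda>_. density \<mu> q)"
    by (rule independent_observations.intro) (simp_all add: prob_space_density q)
qed (simp add: law_no_change_def)

lemma measurable_densities [measurable]: "p \<in> borel_measurable \<mu>" "q \<in> borel_measurable \<mu>"
  using p q by (auto simp: is_prob_density_def)

lemma density_nonneg: "x \<in> space \<mu> \<Longrightarrow> 0 \<le> p x" "x \<in> space \<mu> \<Longrightarrow> 0 \<le> q x"
  using p q by (auto simp: is_prob_density_def)

lemma AE_density_pos: "AE x in density \<mu> p. 0 < p x" "AE x in density \<mu> q. 0 < q x"
  by (auto simp: AE_density)

lemma law_past_eq:
  assumes "A \<in> sets (past \<mu> n)" "n < \<nu>"
  shows "emeasure (law \<mu> q p \<nu>) A = emeasure (law_no_change \<mu> q) A"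
  unfolding law_def law_no_change_def
  by (rule emeasure_past_cong[OF post.independent_observations_axioms pre.independent_observations_axioms _ assms(1)])
     (use assms(2) in auto)

lemma nn_integral_density_ratio_le_one:
  assumes [measurable]: "f \<in> borel_measurable \<mu>" and f: "(\<integral>\<^sup>+x. ennreal (f x) \<partial>\<mu>) \<le> 1"
    and g: "is_prob_density \<mu> g"
  shows "(\<integral>\<^sup>+x. ennreal (f x / g x) \<partial>density \<mu> g) \<le> 1"
proof -
  have [measurable]: "g \<in> borel_measurable \<mu>" using g by (simp add: is_prob_density_def)
  have "(\<integral>\<^sup>+x. ennreal (f x / g x) \<partial>density \<mu> g) = (\<integral>\<^sup>+x. ennreal (g x) * ennreal (f x / g x) \<partial>\<mu>)"
    by (simp add: nn_integral_density)
  also have "\<dots> \<le> (\<integral>\<^sup>+x. ennreal (f x) \<partial>\<mu>)"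
    using g by (intro nn_integral_mono) (auto simp: is_prob_density_def simp flip: ennreal_mult')
  finally show ?thesis using f by simp
qed

text \<open>
  Moving the change from \<open>j\<close> to \<open>j + 1\<close> replaces one factor \<open>p\<close> of the likelihood by \<open>q\<close>.
  Only an inequality holds, because \<open>q\<close> may charge points where \<open>p\<close> vanishes.
\<close>
lemma change_of_measure:
  assumes "1 \<le> \<nu>" "\<nu> \<le> k" and "f \<in> borel_measurable (PiM {1..} (\<lambda>_. \<mu>))"
  shows "(\<integral>\<^sup>+\<omega>. f \<omega> * (\<Prod>i\<in>{\<nu>..<k}. ennreal (q (\<omega> i) / p (\<omega> i))) \<partial>law \<mu> q p \<nu>)
    \<le> (\<integral>\<^sup>+\<omega>. f \<omega> \<partial>law \<mu> q p k)"
  using assms(2,3)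
proof (induction k arbitrary: f rule: dec_induct)
  case base
  then show ?case by simp
next
  case (step k)
  note [measurable] = step.prems
  have k: "1 \<le> k" using step(1) assms(1) by simp
  then have [measurable]: "(\<lambda>\<omega>. \<omega> k) \<in> measurable (PiM {1..} (\<lambda>_. \<mu>)) \<mu>"
    by simp
  have "(\<integral>\<^sup>+\<omega>. f \<omega> * (\<Prod>i\<in>{\<nu>..<Suc k}. ennreal (q (\<omega> i) / p (\<omega> i))) \<partial>law \<mu> q p \<nu>)
      = (\<integral>\<^sup>+\<omega>. (f \<omega> * ennreal (q (\<omega> k) / p (\<omega> k))) * (\<Prod>i\<in>{\<nu>..<k}. ennreal (q (\<omega> i) / p (\<omega> i))) \<partial>law \<mu> q p \<nu>)"
    using step(1) by (simp add: prod.atLeastLessThan_Suc mult_ac)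
  also have "\<dots> \<le> (\<integral>\<^sup>+\<omega>. f \<omega> * ennreal (q (\<omega> k) / p (\<omega> k)) \<partial>law \<mu> q p k)"
    by (rule step.IH) measurable
  also have "\<dots> \<le> (\<integral>\<^sup>+\<omega>. f \<omega> \<partial>law \<mu> q p (Suc k))"
    unfolding law_def
  proof (rule nn_integral_change_coordinate[OF post.independent_observations_axioms
        post.independent_observations_axioms k])
    fix \<omega> assume w: "\<omega> \<in> obs_space \<mu>"
    have [measurable]: "(\<lambda>x. f (\<omega> (k := x))) \<in> borel_measurable \<mu>"
    proof -
      have "insert k {1..} = {1::nat..}" using k by auto
      then have "(\<lambda>x. \<omega> (k := x)) \<in> measurable \<mu> (PiM {1..} (\<lambda>_. \<mu>))"
        using measurable_fun_upd[of "{1..}" "{1..}" k "\<lambda>_. \<omega>" \<mu> "\<lambda>_. \<mu>" "\<lambda>x. x"] w by auto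
      then show ?thesis by measurable
    qed
    have "(\<integral>\<^sup>+x. f (\<omega> (k := x)) * ennreal (q ((\<omega> (k := x)) k) / p ((\<omega> (k := x)) k)) \<partial>density \<mu> p)
        = (\<integral>\<^sup>+x. ennreal (p x) * (f (\<omega> (k := x)) * ennreal (q x / p x)) \<partial>\<mu>)"
      by (simp add: nn_integral_density)
    also have "\<dots> \<le> (\<integral>\<^sup>+x. ennreal (q x) * f (\<omega> (k := x)) \<partial>\<mu>)"
    proof (intro nn_integral_mono)
      fix x assume x: "x \<in> space \<mu>"
      have "ennreal (p x) * ennreal (q x / p x) \<le> ennreal (q x)"
        using density_nonneg[OF x] by (auto simp flip: ennreal_mult')
      from mult_left_mono[OF this, of "f (\<omega> (k := x))"]
      show "ennreal (p x) * (f (\<omega> (k := x)) * ennreal (q x / p x)) \<le> ennreal (q x) * f (\<omega> (k := x))"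
        by (simp add: mult_ac)
    qed
    also have "\<dots> = (\<integral>\<^sup>+x. f (\<omega> (k := x)) \<partial>density \<mu> q)"
      by (simp add: nn_integral_density)
    finally show "(\<integral>\<^sup>+x. f (\<omega> (k := x)) * ennreal (q ((\<omega> (k := x)) k) / p ((\<omega> (k := x)) k))
        \<partial>(if k < k then density \<mu> q else density \<mu> p))
      \<le> (\<integral>\<^sup>+x. f (\<omega> (k := x)) \<partial>(if k < Suc k then density \<mu> q else density \<mu> p))"
      by simp
  qed (auto simp: less_Suc_eq)
  finally show ?case .
qed

end

lemma stopping_time_events:
  assumes "stopping_time (obs_filtration \<mu>) T"
  shows "{\<omega> \<in> obs_space \<mu>. T \<omega> \<le> enat n} \<in> sets (past \<mu> n)"
    "{\<omega> \<in> obs_space \<mu>. enat n < T \<omega>} \<in> sets (past \<mu> n)"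
    "1 \<le> n \<Longrightarrow> {\<omega> \<in> obs_space \<mu>. enat n \<le> T \<omega>} \<in> sets (past \<mu> (n - 1))"
    "{\<omega> \<in> obs_space \<mu>. T \<omega> = enat n} \<in> sets (past \<mu> n)"
proof -
  show le: "{\<omega> \<in> obs_space \<mu>. T \<omega> \<le> enat n} \<in> sets (past \<mu> n)" for n
    using stopping_timeD[OF assms, of "enat n"] by (simp add: pred_def)
  show gt: "{\<omega> \<in> obs_space \<mu>. enat n < T \<omega>} \<in> sets (past \<mu> n)" for n
    using stopping_timeD2[OF assms, of "enat n"] by (simp add: pred_def)
  show ge: "{\<omega> \<in> obs_space \<mu>. enat n \<le> T \<omega>} \<in> sets (past \<mu> (n - 1))" if "1 \<le> n" for n
  proof -
    have "enat n \<le> t \<longleftrightarrow> enat (n - 1) < t" for t using that by (cases t) auto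
    then show ?thesis using gt[of "n - 1"] by simp
  qed
  show "{\<omega> \<in> obs_space \<mu>. T \<omega> = enat n} \<in> sets (past \<mu> n)"
  proof (cases "n = 0")
    case True
    then have "{\<omega> \<in> obs_space \<mu>. T \<omega> = enat n} = {\<omega> \<in> obs_space \<mu>. T \<omega> \<le> enat n}"
      by (auto simp: zero_enat_def[symmetric])
    then show ?thesis using le[of n] by simp
  next
    case False
    then have "{\<omega> \<in> obs_space \<mu>. enat n \<le> T \<omega>} \<in> sets (past \<mu> n)"
      using ge[of n] sets_past_mono[of "enat (n - 1)" "enat n" \<mu>] by auto
    moreover have "{\<omega> \<in> obs_space \<mu>. T \<omega> = enat n}
        = {\<omega> \<in> obs_space \<mu>. enat n \<le> T \<omega>} \<inter> {\<omega> \<in> obs_space \<mu>. T \<omega> \<le> enat n}"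
      by (auto intro: antisym)
    ultimately show ?thesis using le[of n] by auto
  qed
qed

section \<open>The universal lower bound on the delay\<close>

locale change_point_KL = change_point +
  assumes KL_pos: "0 < KL_div \<mu> p q" and KL_finite: "KL_div \<mu> p q < \<infinity>"
begin

definition "D = real_of_ereal (KL_div \<mu> p q)"

definition "llr x = ln (p x / q x)"

lemma
  shows AE_q_pos: "AE x in density \<mu> p. 0 < q x"
    and integrable_llr: "integrable (density \<mu> p) llr"
    and integral_llr: "(\<integral>x. llr x \<partial>density \<mu> p) = D"
    and D_pos: "0 < D"
proof -
  have "(\<integral>\<^sup>+x. ennreal (q x / p x) \<partial>density \<mu> p) \<le> 1"
    using q by (intro nn_integral_density_ratio_le_one p) (auto simp: is_prob_density_def)
  note * = ext_expectation_log_ratio[OF _ _ AE_density_pos(1) _ this]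
  have KL: "ext_expectation (density \<mu> p) (\<lambda>x. log_ratio (p x) (q x)) < \<infinity>"
    using KL_finite by (simp add: KL_div_def)
  show "AE x in density \<mu> p. 0 < q x"
    using KL by (intro *(1)) (auto intro: density_nonneg)
  show "integrable (density \<mu> p) llr"
    unfolding llr_def using KL by (intro *(2)) (auto intro: density_nonneg)
  have "KL_div \<mu> p q = ereal (\<integral>x. llr x \<partial>density \<mu> p)"
    unfolding llr_def KL_div_def using KL by (intro *(3)) (auto intro: density_nonneg)
  then show "(\<integral>x. llr x \<partial>density \<mu> p) = D" "0 < D"
    using KL_pos by (auto simp: D_def)
qed

lemma AE_law_pos:
  assumes "1 \<le> \<nu>"
  shows "AE \<omega> in law \<mu> q p \<nu>. \<forall>i\<ge>\<nu>. 0 < p (\<omega> i) \<and> 0 < q (\<omega> i)"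
proof -
  have "AE x in density \<mu> p. 0 < p x \<and> 0 < q x"
    using AE_density_pos(1) AE_q_pos by eventually_elim auto
  then have "AE \<omega> in law \<mu> q p \<nu>. \<nu> \<le> i \<longrightarrow> 0 < p (\<omega> i) \<and> 0 < q (\<omega> i)" for i
    using post.AE_coordinate[where n = i and \<nu> = \<nu> and Q = "\<lambda>x. 0 < p x \<and> 0 < q x"] assms by (cases "\<nu> \<le> i") auto
  then show ?thesis
    by (simp add: AE_all_countable)
qed

lemma integral_llr_past_event:
  assumes "1 \<le> i" "\<nu> \<le> i" and "A \<in> sets (past \<mu> (i - 1))"
  shows "integrable (law \<mu> q p \<nu>) (\<lambda>\<omega>. indicator A \<omega> * llr (\<omega> i))"
    "(\<integral>\<omega>. indicator A \<omega> * llr (\<omega> i) \<partial>law \<mu> q p \<nu>) = measure (law \<mu> q p \<nu>) A * D"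
  using post.integral_past_event_coordinate[OF assms(1,3), where f = llr and \<nu> = \<nu>] assms(2)
    integrable_llr integral_llr by auto

end

lemma measurable_stopping_time_count_space:
  assumes "stopping_time (obs_filtration \<mu>) T" and M: "sets M = sets (PiM {1..} (\<lambda>_. \<mu>))"
  shows "T \<in> measurable M (count_space UNIV)"
proof -
  have sp: "space M = obs_space \<mu>" using M by (rule sets_eq_imp_space_eq)
  have fin: "{\<omega> \<in> obs_space \<mu>. T \<omega> = enat n} \<in> sets M" for n
    using stopping_time_events(4)[OF assms(1), of n] sets_past_subset M by blast
  have "T -` {t} \<inter> space M \<in> sets M" for t
  proof (cases t)
    case (enat n)
    then show ?thesis using fin[of n] by (simp add: sp vimage_def Int_def conj_commute)
  next
    case infinity
    have "T -` {t} \<inter> space M = space M - (\<Union>n. {\<omega> \<in> obs_space \<mu>. T \<omega> = enat n})"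
      using infinity by (auto simp: sp)
    then show ?thesis using fin by auto
  qed
  then show ?thesis by (simp add: measurable_count_space_eq2_countable)
qed

text \<open>
  A window of length \<open>m\<close> starting at \<open>t\<close> contains a given value of \<open>T\<close> for at most \<open>m\<close>
  choices of \<open>t\<close>, whereas the probabilities \<open>P(T > t)\<close> add up to the mean of \<open>T\<close>.  So
  stopping in the window cannot have conditional probability above \<open>m / E T\<close> for every \<open>t\<close>.
\<close>
lemma (in change_point) exists_quiet_window:
  assumes T: "T \<in> stopping_class \<mu> q \<gamma>" and "0 < \<gamma>" "1 \<le> m"
  obtains \<nu> where "1 \<le> \<nu>"
    "0 < measure (law_no_change \<mu> q) {\<omega> \<in> obs_space \<mu>. enat \<nu> \<le> T \<omega>}"
    "measure (law_no_change \<mu> q) {\<omega> \<in> obs_space \<mu>. enat \<nu> \<le> T \<omega> \<and> T \<omega> < enat (\<nu> + m)}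
       \<le> 2 * real m / \<gamma> * measure (law_no_change \<mu> q) {\<omega> \<in> obs_space \<mu>. enat \<nu> \<le> T \<omega>}"
proof (rule ccontr)
  assume none: "\<not> thesis"
  interpret Q: prob_space "law_no_change \<mu> q" by (rule pre.prob_L)
  define W where "W t = {\<omega> \<in> obs_space \<mu>. enat t < T \<omega> \<and> T \<omega> \<le> enat (t + m)}" for t
  define G where "G t = {\<omega> \<in> obs_space \<mu>. enat t < T \<omega>}" for t
  have st: "stopping_time (obs_filtration \<mu>) T"
    and mean: "ennreal \<gamma> \<le> (\<integral>\<^sup>+\<omega>. ennreal_of_enat (T \<omega>) \<partial>law_no_change \<mu> q)"
    using T by (auto simp: stopping_class_def)
  have Tm: "T \<in> measurable (law_no_change \<mu> q) (count_space UNIV)"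
    using st pre.sets_L by (rule measurable_stopping_time_count_space)
  have G_sets [measurable]: "G t \<in> sets (law_no_change \<mu> q)" for t
    using stopping_time_events(2)[OF st, of t] unfolding G_def by (rule pre.past_sets_L)
  have W_sets [measurable]: "W t \<in> sets (law_no_change \<mu> q)" for t
  proof -
    have "W t = G t - G (t + m)" by (auto simp: W_def G_def not_less)
    then show ?thesis by simp
  qed
  have W_eq: "W t = {\<omega> \<in> obs_space \<mu>. enat (Suc t) \<le> T \<omega> \<and> T \<omega> < enat (Suc t + m)}"
   and G_eq: "G t = {\<omega> \<in> obs_space \<mu>. enat (Suc t) \<le> T \<omega>}" for t
  proof -
    have "enat t < x \<longleftrightarrow> enat (Suc t) \<le> x" "x \<le> enat (t + m) \<longleftrightarrow> x < enat (Suc t + m)" for x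
      by (cases x; auto)+
    then show "W t = {\<omega> \<in> obs_space \<mu>. enat (Suc t) \<le> T \<omega> \<and> T \<omega> < enat (Suc t + m)}"
      "G t = {\<omega> \<in> obs_space \<mu>. enat (Suc t) \<le> T \<omega>}"
      by (simp_all only: W_def G_def)
  qed
  have le: "2 * real m / \<gamma> * Q.prob (G t) \<le> Q.prob (W t)" for t
  proof (rule ccontr)
    assume neg: "\<not> 2 * real m / \<gamma> * Q.prob (G t) \<le> Q.prob (W t)"
    have "0 < Q.prob (G t)"
    proof (rule ccontr)
      assume "\<not> 0 < Q.prob (G t)"
      then have "Q.prob (G t) = 0" by (simp add: zero_less_measure_iff)
      with neg show False by simp
    qed
    with neg show False
      using none that[of "Suc t"] unfolding W_eq G_eq by auto
  qed
  have "ennreal (2 * real m) = ennreal (2 * real m / \<gamma>) * ennreal \<gamma>"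
    using \<open>0 < \<gamma>\<close> by (simp flip: ennreal_mult)
  also have "\<dots> \<le> ennreal (2 * real m / \<gamma>) * (\<integral>\<^sup>+\<omega>. ennreal_of_enat (T \<omega>) \<partial>law_no_change \<mu> q)"
    using mean by (intro mult_left_mono) auto
  also have "(\<integral>\<^sup>+\<omega>. ennreal_of_enat (T \<omega>) \<partial>law_no_change \<mu> q) = (\<Sum>t. emeasure (law_no_change \<mu> q) (G t))"
    using nn_integral_enat_function[OF Tm] by (simp add: G_def)
  also have "ennreal (2 * real m / \<gamma>) * \<dots> = (\<Sum>t. ennreal (2 * real m / \<gamma>) * emeasure (law_no_change \<mu> q) (G t))"
    by simp
  also have "\<dots> \<le> (\<Sum>t. emeasure (law_no_change \<mu> q) (W t))"
    using le \<open>0 < \<gamma>\<close> by (intro suminf_le) (auto simp: Q.emeasure_eq_measure simp flip: ennreal_mult)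
  also have "\<dots> = (\<Sum>t. \<integral>\<^sup>+\<omega>. indicator (W t) \<omega> \<partial>law_no_change \<mu> q)"
    by simp
  also have "\<dots> = (\<integral>\<^sup>+\<omega>. (\<Sum>t. indicator (W t) \<omega>) \<partial>law_no_change \<mu> q)"
    by (rule nn_integral_suminf[symmetric]) simp
  also have "\<dots> \<le> (\<integral>\<^sup>+\<omega>. ennreal (real m) \<partial>law_no_change \<mu> q)"
  proof (intro nn_integral_mono)
    fix \<omega>
    have "(\<Sum>t<N. indicator (W t) \<omega> :: ennreal) \<le> ennreal (real m)" for N
    proof -
      have "(\<Sum>t<N. indicator (W t) \<omega> :: ennreal) = of_nat (card {t\<in>{..<N}. \<omega> \<in> W t})"
        by (simp add: indicator_def sum.If_cases Int_def)
      also have "card {t\<in>{..<N}. \<omega> \<in> W t} \<le> m"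
      proof (cases "T \<omega>")
        case (enat k)
        then have "{t\<in>{..<N}. \<omega> \<in> W t} \<subseteq> {k - m..<k}" by (auto simp: W_def)
        then have "card {t\<in>{..<N}. \<omega> \<in> W t} \<le> card {k - m..<k}" by (intro card_mono) auto
        then show ?thesis by simp
      qed (simp add: W_def)
      finally show ?thesis by (simp add: ennreal_of_nat_eq_real_of_nat)
    qed
    then show "(\<Sum>t. indicator (W t) \<omega> :: ennreal) \<le> ennreal (real m)"
      unfolding suminf_eq_SUP by (intro SUP_least) auto
  qed
  also have "\<dots> = ennreal (real m)" by (simp add: Q.emeasure_space_1[unfolded pre.space_L])
  finally show False using \<open>1 \<le> m\<close> by (simp add: ennreal_le_iff)
qed

context change_point_KL
begin

text \<open>
  The delay is at least the number of steps \<open>i\<close> in the window for which \<open>T \<ge> i\<close>.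
\<close>
lemma sum_running_prob_le:
  assumes st: "stopping_time (obs_filtration \<mu>) T" and \<nu>: "1 \<le> \<nu>" and d: "0 \<le> d"
    and delay: "esssup (law \<mu> q p \<nu>) (nn_cond_exp (law \<mu> q p \<nu>) (past \<mu> (\<nu> - 1))
        (\<lambda>\<omega>. ennreal_of_enat (T \<omega> + 1 - enat \<nu>))) \<le> ennreal d"
  shows "(\<Sum>i\<in>{\<nu>..<\<nu> + m}. measure (law \<mu> q p \<nu>) {\<omega> \<in> obs_space \<mu>. enat i \<le> T \<omega>})
    \<le> d * measure (law \<mu> q p \<nu>) {\<omega> \<in> obs_space \<mu>. enat \<nu> \<le> T \<omega>}"
proof -
  let ?M = "law \<mu> q p \<nu>" and ?I = "{\<nu>..<\<nu> + m}"
  interpret M: prob_space ?M by (rule post.prob_L)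
  define S where "S i = {\<omega> \<in> obs_space \<mu>. enat i \<le> T \<omega>}" for i
  have S_past: "S i \<in> sets (past \<mu> (i - 1))" if "1 \<le> i" for i
    using stopping_time_events(3)[OF st that] unfolding S_def .
  have meas: "S i \<in> sets ?M" if "i \<in> ?I" for i
    using that \<nu> by (intro post.past_sets_L[OF S_past]) auto
  have [measurable]: "T \<in> measurable ?M (count_space UNIV)"
    using st post.sets_L by (rule measurable_stopping_time_count_space)
  have "ennreal (\<Sum>i\<in>?I. M.prob (S i)) = (\<Sum>i\<in>?I. emeasure ?M (S i))"
    by (simp add: M.emeasure_eq_measure sum_ennreal)
  also have "\<dots> = (\<integral>\<^sup>+\<omega>. (\<Sum>i\<in>?I. indicator (S i) \<omega>) \<partial>?M)"
    using meas by (subst nn_integral_sum) auto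
  also have "\<dots> \<le> (\<integral>\<^sup>+\<omega>. indicator (S \<nu>) \<omega> * ennreal_of_enat (T \<omega> + 1 - enat \<nu>) \<partial>?M)"
  proof (intro nn_integral_mono)
    fix \<omega> assume "\<omega> \<in> space ?M"
    then have w: "\<omega> \<in> obs_space \<mu>" by simp
    show "(\<Sum>i\<in>?I. indicator (S i) \<omega> :: ennreal) \<le> indicator (S \<nu>) \<omega> * ennreal_of_enat (T \<omega> + 1 - enat \<nu>)"
    proof (cases "T \<omega>")
      case (enat k)
      have "(\<Sum>i\<in>?I. indicator (S i) \<omega> :: ennreal) = of_nat (card {i\<in>?I. \<omega> \<in> S i})"
        by (simp add: indicator_def sum.If_cases Int_def)
      also have "card {i\<in>?I. \<omega> \<in> S i} \<le> card {\<nu>..<k + 1}"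
        using w enat by (intro card_mono) (auto simp: S_def)
      also have "of_nat (card {\<nu>..<k + 1}) = ennreal_of_enat (T \<omega> + 1 - enat \<nu>)"
        by (simp add: enat one_enat_def)
      finally show ?thesis
        using w enat by (cases "\<nu> \<le> k") (auto simp: S_def indicator_def)
    qed (use w in \<open>auto simp: S_def indicator_def\<close>)
  qed
  also have "\<dots> \<le> ennreal d * emeasure ?M (S \<nu>)"
    by (rule order_trans[OF post.nn_integral_le_esssup_nn_cond_exp[OF _ S_past[OF \<nu>]]])
       (auto intro!: mult_right_mono delay)
  also have "\<dots> = ennreal (d * M.prob (S \<nu>))"
    using d by (simp add: M.emeasure_eq_measure ennreal_mult')
  finally show ?thesis using d unfolding S_def by (simp add: ennreal_le_iff)
qed

text \<open>
  The event is decided before \<open>n\<close>, so a change at \<open>n\<close> is the same to it as no change at all.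
\<close>
lemma nn_integral_inverse_likelihood_le:
  assumes E: "E \<in> sets (past \<mu> (n - 1))" and \<nu>: "1 \<le> \<nu>" "\<nu> \<le> n"
  shows "(\<integral>\<^sup>+\<omega>. indicator E \<omega> * ennreal (\<Prod>i\<in>{\<nu>..<n}. q (\<omega> i) / p (\<omega> i)) \<partial>law \<mu> q p \<nu>)
    \<le> emeasure (law_no_change \<mu> q) E"
proof -
  have EP: "E \<in> sets (PiM {1..} (\<lambda>_. \<mu>))" using E sets_past_subset by blast
  have "(\<integral>\<^sup>+\<omega>. indicator E \<omega> * ennreal (\<Prod>i\<in>{\<nu>..<n}. q (\<omega> i) / p (\<omega> i)) \<partial>law \<mu> q p \<nu>)
      = (\<integral>\<^sup>+\<omega>. indicator E \<omega> * (\<Prod>i\<in>{\<nu>..<n}. ennreal (q (\<omega> i) / p (\<omega> i))) \<partial>law \<mu> q p \<nu>)"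
  proof (intro nn_integral_cong)
    fix \<omega> assume "\<omega> \<in> space (law \<mu> q p \<nu>)"
    then have w: "\<omega> \<in> obs_space \<mu>" by simp
    have "0 \<le> q (\<omega> i) / p (\<omega> i)" if "i \<in> {\<nu>..<n}" for i
      using \<nu> that by (intro divide_nonneg_nonneg density_nonneg coordinate_in_space[OF w]) auto
    then show "indicator E \<omega> * ennreal (\<Prod>i\<in>{\<nu>..<n}. q (\<omega> i) / p (\<omega> i))
        = indicator E \<omega> * (\<Prod>i\<in>{\<nu>..<n}. ennreal (q (\<omega> i) / p (\<omega> i)))"
      by (subst prod_ennreal) auto
  qed
  also have "\<dots> \<le> (\<integral>\<^sup>+\<omega>. indicator E \<omega> \<partial>law \<mu> q p n)"
    using \<nu> EP by (intro change_of_measure) auto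
  also have "\<dots> = emeasure (law \<mu> q p n) E"
    using post.past_sets_L[OF E] by simp
  also have "\<dots> = emeasure (law_no_change \<mu> q) E"
    using E \<nu> by (intro law_past_eq) auto
  finally show ?thesis .
qed

text \<open>
  Let \<open>R\<close> be the log-likelihood ratio collected from \<open>\<nu>\<close> until \<open>T\<close>, at most over \<open>m\<close>
  steps.  Its mean is \<open>D\<close> times the mean number of steps (Wald), and
  \<open>R \<ge> 1 + ln (1 / \<epsilon>) - exp (- R) / \<epsilon>\<close> on the event that \<open>T\<close> falls into the window.  The
  exponential integrates to at most the probability of that event without a change, which is
  \<open>\<epsilon>\<close>-small, so \<open>R\<close> has to be about \<open>ln (1 / \<epsilon>)\<close>.
\<close>
lemma delay_ge_at_quiet_window:
  assumes st: "stopping_time (obs_filtration \<mu>) T" and \<nu>: "1 \<le> \<nu>" and m: "1 \<le> m"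
    and \<epsilon>: "0 < \<epsilon>" "\<epsilon> \<le> 1" and d: "0 \<le> d"
    and delay: "esssup (law \<mu> q p \<nu>) (nn_cond_exp (law \<mu> q p \<nu>) (past \<mu> (\<nu> - 1))
        (\<lambda>\<omega>. ennreal_of_enat (T \<omega> + 1 - enat \<nu>))) \<le> ennreal d"
    and pos: "0 < measure (law_no_change \<mu> q) {\<omega> \<in> obs_space \<mu>. enat \<nu> \<le> T \<omega>}"
    and quiet: "measure (law_no_change \<mu> q) {\<omega> \<in> obs_space \<mu>. enat \<nu> \<le> T \<omega> \<and> T \<omega> < enat (\<nu> + m)}
       \<le> \<epsilon> * measure (law_no_change \<mu> q) {\<omega> \<in> obs_space \<mu>. enat \<nu> \<le> T \<omega>}"
  shows "(1 - d / m) * ln (1 / \<epsilon>) - 1 \<le> D * d"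
proof -
  let ?M = "law \<mu> q p \<nu>" and ?Q = "law_no_change \<mu> q"
  let ?I = "{\<nu>..<\<nu> + m}"
  interpret M: prob_space ?M by (rule post.prob_L)
  interpret Q: prob_space ?Q by (rule pre.prob_L)
  define S where "S i = {\<omega> \<in> obs_space \<mu>. enat i \<le> T \<omega>}" for i
  define A where "A k = {\<omega> \<in> obs_space \<mu>. T \<omega> = enat k}" for k
  let ?G = "S \<nu>" and ?B = "S (\<nu> + m)"
  have S_past: "S i \<in> sets (past \<mu> (i - 1))" if "1 \<le> i" for i
    using stopping_time_events(3)[OF st that] unfolding S_def .
  have A_past: "A k \<in> sets (past \<mu> k)" for k
    using stopping_time_events(4)[OF st] unfolding A_def .
  have meas: "S i \<in> sets ?M" "S i \<in> sets ?Q" if "1 \<le> i" for i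
    using S_past[OF that] post.past_sets_L pre.past_sets_L by blast+
  have measA: "A k \<in> sets ?M" "A k \<in> sets ?Q" "A k \<in> sets (PiM {1..} (\<lambda>_. \<mu>))" for k
    using A_past post.past_sets_L pre.past_sets_L sets_past_subset by blast+
  define \<pi> where "\<pi> = Q.prob ?G"
  have "0 < \<pi>" using pos by (simp add: \<pi>_def S_def)
  have G_eq: "M.prob ?G = \<pi>"
    using law_past_eq[OF S_past[OF \<nu>], of \<nu>] \<nu> by (simp add: \<pi>_def measure_def)
  \<comment> \<open>Wald's identity: whether step \<open>i\<close> is reached is decided before observation \<open>i\<close> is made.\<close>
  define R where "R \<omega> = (\<Sum>i\<in>?I. indicator (S i) \<omega> * llr (\<omega> i))" for \<omega>
  have i_ge: "1 \<le> i" "\<nu> \<le> i" if "i \<in> ?I" for i using that \<nu> by auto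
  have R_int: "integrable ?M R" unfolding R_def
    by (intro Bochner_Integration.integrable_sum integral_llr_past_event i_ge S_past)
  have R_mean: "(\<integral>\<omega>. R \<omega> \<partial>?M) = D * (\<Sum>i\<in>?I. M.prob (S i))"
  proof -
    have "(\<integral>\<omega>. R \<omega> \<partial>?M) = (\<Sum>i\<in>?I. \<integral>\<omega>. indicator (S i) \<omega> * llr (\<omega> i) \<partial>?M)"
      unfolding R_def
      by (intro Bochner_Integration.integral_sum integral_llr_past_event i_ge S_past)
    also have "\<dots> = (\<Sum>i\<in>?I. M.prob (S i) * D)"
      by (intro sum.cong refl integral_llr_past_event i_ge S_past)
    finally show ?thesis by (simp add: sum_distrib_left mult.commute)
  qed
  have sumS: "(\<Sum>i\<in>?I. M.prob (S i)) \<le> d * \<pi>"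
    using sum_running_prob_le[OF st \<nu> d delay, of m] unfolding S_def[symmetric] G_eq .
  have B_le: "M.prob ?B \<le> d * \<pi> / m"
  proof -
    have "real m * M.prob ?B = (\<Sum>i\<in>?I. M.prob ?B)" by simp
    also have "\<dots> \<le> (\<Sum>i\<in>?I. M.prob (S i))"
    proof (intro sum_mono M.finite_measure_mono meas i_ge)
      show "?B \<subseteq> S i" if "i \<in> ?I" for i
      proof -
        have "enat i \<le> enat (\<nu> + m)" using that by simp
        then show ?thesis unfolding S_def by (blast intro: order_trans)
      qed
    qed
    also note sumS
    finally show ?thesis using m by (simp add: field_simps)
  qed
  \<comment> \<open>the inverse likelihood ratio \<open>exp (- R)\<close>, weighted by \<open>1 / \<epsilon>\<close> if \<open>T\<close> falls into the window\<close>
  define H where "H \<omega> = (\<Sum>k\<in>?I. indicator (A k) \<omega> / \<epsilon> * (\<Prod>i\<in>{\<nu>..<Suc k}. q (\<omega> i) / p (\<omega> i)))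
      + indicator ?B \<omega> * (\<Prod>i\<in>?I. q (\<omega> i) / p (\<omega> i))" for \<omega>
  have coord [measurable]: "(\<lambda>\<omega>. \<omega> i) \<in> measurable ?M \<mu>" if "i \<in> {\<nu>..<n}" for i n
    using that \<nu> unfolding post.measurable_L by (intro measurable_component_singleton) auto
  have prod_meas: "(\<lambda>\<omega>. \<Prod>i\<in>{\<nu>..<n}. q (\<omega> i) / p (\<omega> i)) \<in> borel_measurable ?M" for n
    by (intro borel_measurable_prod borel_measurable_divide measurable_compose[OF coord]) auto
  have ratio_nonneg: "0 \<le> (\<Prod>i\<in>{\<nu>..<n}. q (\<omega> i) / p (\<omega> i))" if "\<omega> \<in> obs_space \<mu>" for \<omega> n
    using \<nu> by (intro prod_nonneg divide_nonneg_nonneg ballI density_nonneg coordinate_in_space[OF that]) auto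
  have H_meas: "H \<in> borel_measurable ?M"
    unfolding H_def using prod_meas measA meas \<nu> by (intro borel_measurable_add borel_measurable_sum borel_measurable_times) auto
  have H_nonneg: "0 \<le> H \<omega>" if "\<omega> \<in> obs_space \<mu>" for \<omega>
    unfolding H_def using \<epsilon> ratio_nonneg[OF that] by (intro add_nonneg_nonneg sum_nonneg mult_nonneg_nonneg) (auto simp del: prod.op_ivl_Suc)
  have H_le: "(\<integral>\<^sup>+\<omega>. ennreal (H \<omega>) \<partial>?M) \<le> ennreal (2 * \<pi>)"
  proof -
    have "(\<integral>\<^sup>+\<omega>. ennreal (H \<omega>) \<partial>?M)
        = (\<integral>\<^sup>+\<omega>. (\<Sum>k\<in>?I. ennreal (1 / \<epsilon>) * (indicator (A k) \<omega> * ennreal (\<Prod>i\<in>{\<nu>..<Suc k}. q (\<omega> i) / p (\<omega> i))))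
          + indicator ?B \<omega> * ennreal (\<Prod>i\<in>?I. q (\<omega> i) / p (\<omega> i)) \<partial>?M)"
    proof (intro nn_integral_cong)
      fix \<omega> assume "\<omega> \<in> space ?M"
      then have w: "\<omega> \<in> obs_space \<mu>" by simp
      have ind: "ennreal (indicator E \<omega> * y) = indicator E \<omega> * ennreal y" for E and y :: real
        by (simp add: indicator_def)
      have "ennreal (indicator (A k) \<omega> / \<epsilon> * y) = ennreal (1 / \<epsilon>) * (indicator (A k) \<omega> * ennreal y)"
        if "0 \<le> y" for k y
        using \<epsilon> that by (simp add: indicator_def flip: ennreal_mult)
      then show "ennreal (H \<omega>) = (\<Sum>k\<in>?I. ennreal (1 / \<epsilon>) * (indicator (A k) \<omega> * ennreal (\<Prod>i\<in>{\<nu>..<Suc k}. q (\<omega> i) / p (\<omega> i))))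
          + indicator ?B \<omega> * ennreal (\<Prod>i\<in>?I. q (\<omega> i) / p (\<omega> i))"
        unfolding H_def using ratio_nonneg[OF w] \<epsilon>
        by (subst ennreal_plus) (auto intro!: sum_nonneg mult_nonneg_nonneg simp: ind sum_ennreal[symmetric] simp del: prod.op_ivl_Suc)
    qed
    also have "\<dots> = (\<Sum>k\<in>?I. ennreal (1 / \<epsilon>) * (\<integral>\<^sup>+\<omega>. indicator (A k) \<omega> * ennreal (\<Prod>i\<in>{\<nu>..<Suc k}. q (\<omega> i) / p (\<omega> i)) \<partial>?M))
        + (\<integral>\<^sup>+\<omega>. indicator ?B \<omega> * ennreal (\<Prod>i\<in>?I. q (\<omega> i) / p (\<omega> i)) \<partial>?M)"
      using prod_meas measA meas \<nu> by (subst nn_integral_add) (auto simp: nn_integral_sum nn_integral_cmult simp del: prod.op_ivl_Suc)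
    also have "\<dots> \<le> (\<Sum>k\<in>?I. ennreal (1 / \<epsilon>) * emeasure ?Q (A k)) + emeasure ?Q ?B"
      using A_past S_past[of "\<nu> + m"] \<nu> by (intro add_mono sum_mono mult_left_mono nn_integral_inverse_likelihood_le) auto
    also have "(\<Sum>k\<in>?I. ennreal (1 / \<epsilon>) * emeasure ?Q (A k)) = ennreal (1 / \<epsilon>) * emeasure ?Q (\<Union>k\<in>?I. A k)"
      using measA by (subst sum_emeasure[symmetric]) (auto simp: disjoint_family_on_def A_def sum_distrib_left)
    also have "(\<Union>k\<in>?I. A k) = {\<omega> \<in> obs_space \<mu>. enat \<nu> \<le> T \<omega> \<and> T \<omega> < enat (\<nu> + m)}" (is "_ = ?W")
    proof safe
      fix \<omega> assume w: "\<omega> \<in> obs_space \<mu>" "enat \<nu> \<le> T \<omega>" "T \<omega> < enat (\<nu> + m)"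
      then obtain k where "T \<omega> = enat k" by (cases "T \<omega>") auto
      with w show "\<omega> \<in> (\<Union>k\<in>?I. A k)" by (auto simp: A_def)
    qed (auto simp: A_def)
    also have "ennreal (1 / \<epsilon>) * emeasure ?Q ?W + emeasure ?Q ?B \<le> ennreal (1 / \<epsilon> * (\<epsilon> * \<pi>)) + ennreal \<pi>"
    proof (intro add_mono)
      have "Q.prob ?W \<le> \<epsilon> * \<pi>" using quiet by (simp add: \<pi>_def S_def)
      then show "ennreal (1 / \<epsilon>) * emeasure ?Q ?W \<le> ennreal (1 / \<epsilon> * (\<epsilon> * \<pi>))"
        using \<epsilon> by (subst Q.emeasure_eq_measure, subst ennreal_mult[symmetric])
          (auto intro!: ennreal_leI simp: field_simps)
      have "?B \<subseteq> ?G"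
      proof -
        have "enat \<nu> \<le> enat (\<nu> + m)" by simp
        then show ?thesis unfolding S_def by (blast intro: order_trans)
      qed
      then show "emeasure ?Q ?B \<le> ennreal \<pi>"
        unfolding \<pi>_def Q.emeasure_eq_measure using \<nu> by (intro ennreal_leI Q.finite_measure_mono meas) auto
    qed
    also have "\<dots> = ennreal (2 * \<pi>)" using \<epsilon> \<open>0 < \<pi>\<close> by (simp flip: ennreal_plus)
    finally show ?thesis .
  qed
  have H_int: "integrable ?M H" and H_mean: "(\<integral>\<omega>. H \<omega> \<partial>?M) \<le> 2 * \<pi>"
    using \<open>0 < \<pi>\<close> H_nonneg by (intro integral_le_of_nn_integral_le[OF H_meas _ H_le]; simp)+
  \<comment> \<open>\<open>1 + x \<le> exp x\<close> at \<open>x = ln (1 / \<epsilon>) - R\<close> inside the window and at \<open>x = - R\<close> beyond it\<close>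
  let ?l = "ln (1 / \<epsilon>)"
  have l: "0 \<le> ?l" using \<epsilon> by simp
  have "AE \<omega> in ?M. indicator ?G \<omega> * (?l + 1) - indicator ?B \<omega> * ?l \<le> R \<omega> + H \<omega>"
    using AE_law_pos[OF \<nu>] AE_space[of ?M]
  proof eventually_elim
    case (elim \<omega>)
    then have w: "\<omega> \<in> obs_space \<mu>" by simp
    have ratio: "(\<Prod>i\<in>{\<nu>..<n}. q (\<omega> i) / p (\<omega> i)) = exp (- (\<Sum>i\<in>{\<nu>..<n}. llr (\<omega> i)))" for n
    proof -
      have "exp (- (\<Sum>i\<in>{\<nu>..<n}. llr (\<omega> i))) = (\<Prod>i\<in>{\<nu>..<n}. exp (- llr (\<omega> i)))"
        by (simp add: exp_sum sum_negf[symmetric])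
      also have "\<dots> = (\<Prod>i\<in>{\<nu>..<n}. q (\<omega> i) / p (\<omega> i))"
        using elim(1) by (intro prod.cong refl) (simp add: llr_def exp_minus)
      finally show ?thesis by simp
    qed
    consider "T \<omega> < enat \<nu>" | k where "T \<omega> = enat k" "k \<in> ?I" | "enat (\<nu> + m) \<le> T \<omega>"
      by (cases "T \<omega>") force+
    then show ?case
    proof cases
      case 1
      have "R \<omega> = 0"
        unfolding R_def using 1 by (intro sum.neutral) (force simp: S_def indicator_def dest: le_less_trans)
      moreover have "\<omega> \<notin> ?G" "\<omega> \<notin> ?B"
        using 1 by (auto simp: S_def not_le intro: less_le_trans)
      ultimately show ?thesis using H_nonneg[OF w] by simp
    next
      case 2
      then have G: "\<omega> \<in> ?G" "\<omega> \<notin> ?B" using w by (auto simp: S_def)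
      have "R \<omega> = (\<Sum>i\<in>?I. if i \<in> {\<nu>..<Suc k} then llr (\<omega> i) else 0)"
        unfolding R_def using 2 w by (intro sum.cong) (auto simp: S_def indicator_def)
      also have "\<dots> = (\<Sum>i\<in>{\<nu>..<Suc k}. llr (\<omega> i))"
        using 2 by (subst sum.inter_restrict[symmetric]) (auto intro!: sum.cong)
      finally have R: "R \<omega> = (\<Sum>i\<in>{\<nu>..<Suc k}. llr (\<omega> i))" .
      have "indicator (A j) \<omega> / \<epsilon> * exp (- (\<Sum>i\<in>{\<nu>..<Suc j}. llr (\<omega> i)))
          = (if j = k then exp (- R \<omega>) / \<epsilon> else 0)" for j
        using 2 w unfolding R by (auto simp: A_def)
      then have "H \<omega> = (\<Sum>j\<in>?I. if j = k then exp (- R \<omega>) / \<epsilon> else 0)"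
        unfolding H_def ratio using G by (simp only: indicator_simps mult_zero_left add_0_right not_False_eq_True)
      also have "\<dots> = exp (- R \<omega>) / \<epsilon>" using 2 by simp
      also have "\<dots> = exp (- R \<omega> + ?l)" unfolding exp_add using \<epsilon> by simp
      also have "\<dots> \<ge> 1 + (- R \<omega> + ?l)" by (rule exp_ge_add_one_self)
      finally show ?thesis using G by simp
    next
      case 3
      have "enat i \<le> T \<omega>" if "i < \<nu> + m" for i
        by (rule order_trans[OF _ 3]) (use that in simp)
      then have R: "R \<omega> = (\<Sum>i\<in>?I. llr (\<omega> i))"
        unfolding R_def using w by (intro sum.cong) (auto simp: S_def)
      have GB: "\<omega> \<in> ?G" "\<omega> \<in> ?B"
        using 3 w m \<open>\<And>i. i < \<nu> + m \<Longrightarrow> enat i \<le> T \<omega>\<close>[of \<nu>] by (auto simp: S_def)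
      have "\<omega> \<notin> A k" if "k \<in> ?I" for k using 3 that by (auto simp: A_def)
      then have "H \<omega> = exp (- R \<omega>)"
        unfolding H_def ratio R using GB by simp
      then show ?thesis using GB exp_ge_add_one_self[of "- R \<omega>"] by simp
    qed
  qed
  moreover have S_space: "S i \<inter> obs_space \<mu> = S i" for i
    by (auto simp: S_def)
  moreover have S_int: "integrable ?M (indicat_real (S i))" if "1 \<le> i" for i
    using meas(1)[OF that] M.emeasure_finite by (intro integrable_real_indicator) (auto simp: less_top[symmetric])
  ultimately have "(\<integral>\<omega>. indicator ?G \<omega> * (?l + 1) - indicator ?B \<omega> * ?l \<partial>?M) \<le> (\<integral>\<omega>. R \<omega> + H \<omega> \<partial>?M)"
    using R_int H_int \<nu> S_int[of \<nu>] S_int[of "\<nu> + m"]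
    by (intro integral_mono_AE Bochner_Integration.integrable_diff Bochner_Integration.integrable_add integrable_mult_left) auto
  then have "\<pi> * (?l + 1) - M.prob ?B * ?l \<le> D * (\<Sum>i\<in>?I. M.prob (S i)) + (\<integral>\<omega>. H \<omega> \<partial>?M)"
    using R_int H_int meas(1) \<nu> S_int[of \<nu>] S_int[of "\<nu> + m"]
    by (subst (asm) Bochner_Integration.integral_diff) (auto simp: G_eq R_mean S_space)
  also have "\<dots> \<le> D * (d * \<pi>) + 2 * \<pi>"
    using D_pos sumS H_mean by (intro add_mono mult_left_mono) auto
  also have "\<pi> * (?l + 1) - d * \<pi> / m * ?l \<le> \<pi> * (?l + 1) - M.prob ?B * ?l"
    using mult_right_mono[OF B_le l] by simp
  finally (order_trans[rotated]) have "\<pi> * (?l + 1) - d * \<pi> / m * ?l \<le> D * (d * \<pi>) + 2 * \<pi>" .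
  then have "\<pi> * ((1 - d / m) * ?l - 1) \<le> \<pi> * (D * d)"
    by (simp add: algebra_simps)
  then show ?thesis using \<open>0 < \<pi>\<close> by simp
qed

theorem lorden_delay_lower_bound:
  assumes T: "T \<in> stopping_class \<mu> q \<gamma>" and m: "1 \<le> m" "2 * real m \<le> \<gamma>"
    and d: "0 \<le> d" "lorden_delay \<mu> q p T \<le> ennreal d"
  shows "(1 - d / m) * ln (\<gamma> / (2 * real m)) - 1 \<le> D * d"
proof -
  have "0 < \<gamma>" using m by simp
  from exists_quiet_window[OF T this m(1)] obtain \<nu> where \<nu>: "1 \<le> \<nu>"
    and pos: "0 < measure (law_no_change \<mu> q) {\<omega> \<in> obs_space \<mu>. enat \<nu> \<le> T \<omega>}"
    and quiet: "measure (law_no_change \<mu> q) {\<omega> \<in> obs_space \<mu>. enat \<nu> \<le> T \<omega> \<and> T \<omega> < enat (\<nu> + m)}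
       \<le> 2 * real m / \<gamma> * measure (law_no_change \<mu> q) {\<omega> \<in> obs_space \<mu>. enat \<nu> \<le> T \<omega>}"
    by blast
  have "esssup (law \<mu> q p \<nu>) (nn_cond_exp (law \<mu> q p \<nu>) (past \<mu> (\<nu> - 1))
        (\<lambda>\<omega>. ennreal_of_enat (T \<omega> + 1 - enat \<nu>))) \<le> ennreal d"
    using \<nu> by (intro order_trans[OF _ d(2)]) (auto simp: lorden_delay_def intro!: SUP_upper)
  from delay_ge_at_quiet_window[OF _ \<nu> m(1) _ _ d(1) this pos quiet] show ?thesis
    using T m \<open>0 < \<gamma>\<close> by (simp add: stopping_class_def)
qed

end

section \<open>The PM-CuSum procedure\<close>

lemma window_pred_cong:
  assumes "\<And>i. max 1 (n - w) \<le> i \<Longrightarrow> i < n \<Longrightarrow> \<omega> i = \<omega>' i"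
  shows "window_pred phat w n \<omega> x = window_pred phat w n \<omega>' x"
  unfolding window_pred_def using assms by (intro arg_cong2[where f = "phat w"] map_cong) auto

lemma window_pred_measurable:
  assumes phat: "is_predictor \<mu> phat" and w: "1 \<le> w" and n: "1 \<le> n"
    and coord: "\<And>i. max 1 (n - w) \<le> i \<Longrightarrow> i < n \<Longrightarrow> (\<lambda>\<omega>. \<omega> i) \<in> measurable N \<mu>"
    and X: "X \<in> measurable N \<mu>"
  shows "(\<lambda>\<omega>. window_pred phat w n \<omega> (X \<omega>)) \<in> borel_measurable N"
proof -
  define k where "k = n - max 1 (n - w)"
  have "k \<le> w" "k \<le> n" by (auto simp: k_def)
  have list: "rev [max 1 (n - w)..<n] = map (\<lambda>j. n - 1 - j) [0..<k]"
    using n by (intro nth_equalityI) (auto simp: k_def rev_nth)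
  have "(\<lambda>\<omega>. (\<lambda>j\<in>{..<k}. \<omega> (n - 1 - j), X \<omega>)) \<in> measurable N (PiM {..<k} (\<lambda>_. \<mu>) \<Otimes>\<^sub>M \<mu>)"
    using n by (intro measurable_Pair measurable_restrict coord X) (auto simp: k_def)
  moreover have "(\<lambda>(y, x). phat w (map y [0..<k]) x) \<in> borel_measurable (PiM {..<k} (\<lambda>_. \<mu>) \<Otimes>\<^sub>M \<mu>)"
    using phat w \<open>k \<le> w\<close> by (auto simp: is_predictor_def)
  ultimately have "(\<lambda>\<omega>. phat w (map (\<lambda>j\<in>{..<k}. \<omega> (n - 1 - j)) [0..<k]) (X \<omega>)) \<in> borel_measurable N"
    by (auto dest: measurable_compose)
  moreover have "map (\<lambda>j\<in>{..<k}. \<omega> (n - 1 - j)) [0..<k] = map \<omega> (rev [max 1 (n - w)..<n])" for \<omega> :: "nat \<Rightarrow> 'a"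
    unfolding list by simp
  ultimately show ?thesis unfolding window_pred_def by (simp only:)
qed

lemma window_pred_density:
  assumes phat: "is_predictor \<mu> phat" and w: "1 \<le> w" and \<omega>: "\<omega> \<in> obs_space \<mu>"
  shows "is_prob_density \<mu> (window_pred phat w n \<omega>)"
proof -
  have "map \<omega> (rev [max 1 (n - w)..<n]) \<in> lists (space \<mu>)"
    using coordinate_in_space[OF \<omega>] by auto
  moreover have "length (map \<omega> (rev [max 1 (n - w)..<n])) \<le> w" by auto
  ultimately have "is_prob_density \<mu> (phat w (map \<omega> (rev [max 1 (n - w)..<n])))"
    using phat w unfolding is_predictor_def by blast
  then show ?thesis by (simp add: window_pred_def[abs_def])
qed

locale pm_cusum = change_point +
  fixes phat :: "nat \<Rightarrow> 'a list \<Rightarrow> 'a \<Rightarrow> real" and W :: "nat set" and \<alpha> :: real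
  assumes phat: "is_predictor \<mu> phat"
    and W: "finite W" "W \<noteq> {}" "\<And>w. w \<in> W \<Longrightarrow> 1 \<le> w"
    and \<alpha>: "0 < \<alpha>" "\<alpha> < 1"
begin

abbreviation "weight \<equiv> fixed_share W \<alpha> phat"
abbreviation "mix \<equiv> mixture_pred W \<alpha> phat"
abbreviation "incr \<equiv> log_lik q W \<alpha> phat"
abbreviation "stat \<equiv> pm_cusum_stat q W \<alpha> phat"
abbreviation "stop \<equiv> pm_cusum_time q W \<alpha> phat"

lemma card_W: "0 < real (card W)"
  using W by (simp add: card_gt_0_iff)

lemma window_nonneg:
  "w \<in> W \<Longrightarrow> \<omega> \<in> obs_space \<mu> \<Longrightarrow> x \<in> space \<mu> \<Longrightarrow> 0 \<le> window_pred phat w n \<omega> x"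
  using window_pred_density[OF phat] W(3) by (auto simp: is_prob_density_def)

lemma weight_Suc:
  assumes "1 \<le> n"
  shows "weight \<omega> (Suc n) w = (1 - \<alpha>) * (if mix n \<omega> (\<omega> n) = 0 then weight \<omega> n w
    else weight \<omega> n w * window_pred phat w n \<omega> (\<omega> n) / mix n \<omega> (\<omega> n)) + \<alpha> / card W"
  using assms by (simp add: Let_def mixture_pred_def)

lemma weight_nonneg_sum:
  assumes \<omega>: "\<omega> \<in> obs_space \<mu>"
  shows "(\<forall>w\<in>W. 0 \<le> weight \<omega> n w) \<and> (\<Sum>w\<in>W. weight \<omega> n w) = 1"
proof (induction n)
  case 0
  then show ?case using card_W by simp
next
  case (Suc n)
  show ?case
  proof (cases "n = 0")
    case True
    then show ?thesis using card_W by simp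
  next
    case False
    then have n: "1 \<le> n" by simp
    define post where "post w = (if mix n \<omega> (\<omega> n) = 0 then weight \<omega> n w
      else weight \<omega> n w * window_pred phat w n \<omega> (\<omega> n) / mix n \<omega> (\<omega> n))" for w
    have mix_eq: "mix n \<omega> (\<omega> n) = (\<Sum>w\<in>W. weight \<omega> n w * window_pred phat w n \<omega> (\<omega> n))"
      by (simp add: mixture_pred_def)
    have wn: "0 \<le> weight \<omega> n w * window_pred phat w n \<omega> (\<omega> n)" if "w \<in> W" for w
      using that n Suc window_nonneg[OF that \<omega> coordinate_in_space[OF \<omega>]] by auto
    then have "0 \<le> mix n \<omega> (\<omega> n)" unfolding mix_eq by (intro sum_nonneg) auto
    then have "0 \<le> post w" if "w \<in> W" for w
      using wn[OF that] Suc that by (auto simp: post_def)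
    moreover have "(\<Sum>w\<in>W. post w) = 1"
    proof (cases "mix n \<omega> (\<omega> n) = 0")
      case False
      then show ?thesis
        using mix_eq by (simp add: post_def sum_divide_distrib[symmetric])
    qed (use Suc in \<open>simp add: post_def\<close>)
    moreover have "weight \<omega> (Suc n) w = (1 - \<alpha>) * post w + \<alpha> / card W" for w
      unfolding post_def by (rule weight_Suc[OF n])
    moreover have "(\<Sum>w\<in>W. (1 - \<alpha>) * post w + \<alpha> / card W) = (1 - \<alpha>) * (\<Sum>w\<in>W. post w) + \<alpha>"
      using card_W by (simp add: sum.distrib sum_distrib_left)
    ultimately show ?thesis
      using \<alpha> by (simp del: fixed_share.simps)
  qed
qed

lemma weight_nonneg: "\<omega> \<in> obs_space \<mu> \<Longrightarrow> w \<in> W \<Longrightarrow> 0 \<le> weight \<omega> n w"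
  using weight_nonneg_sum by blast

lemma weight_le_one: "\<omega> \<in> obs_space \<mu> \<Longrightarrow> w \<in> W \<Longrightarrow> weight \<omega> n w \<le> 1"
  using weight_nonneg_sum[of \<omega> n] member_le_sum[of w W "weight \<omega> n"] W(1) by auto

lemma mix_nonneg: "\<omega> \<in> obs_space \<mu> \<Longrightarrow> x \<in> space \<mu> \<Longrightarrow> 0 \<le> mix n \<omega> x"
  unfolding mixture_pred_def
  by (intro sum_nonneg mult_nonneg_nonneg weight_nonneg window_nonneg) auto

text \<open>
  The share \<open>\<alpha>\<close> that is redistributed in every step keeps all weights away from zero, so that a window
  can be taken up at any time at the price of \<open>ln (card W / \<alpha>)\<close>.
\<close>
lemma weight_ge:
  assumes \<omega>: "\<omega> \<in> obs_space \<mu>" and w: "w \<in> W"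
  shows "\<alpha> / card W \<le> weight \<omega> n w"
proof (cases n)
  case 0
  then show ?thesis using \<alpha> card_W by (simp add: divide_right_mono)
next
  case (Suc m)
  show ?thesis
  proof (cases "m = 0")
    case True
    then show ?thesis using \<alpha> card_W Suc by (simp add: divide_right_mono)
  next
    case False
    then have m: "1 \<le> m" by simp
    have "0 \<le> weight \<omega> m w * window_pred phat w m \<omega> (\<omega> m) / mix m \<omega> (\<omega> m)"
      by (intro divide_nonneg_nonneg mult_nonneg_nonneg weight_nonneg window_nonneg mix_nonneg
            coordinate_in_space[OF \<omega> m] \<omega> w)
    then show ?thesis
      unfolding Suc weight_Suc[OF m] using \<alpha> weight_nonneg[OF \<omega> w, of m] by auto
  qed
qed

lemma weight_pos: "\<omega> \<in> obs_space \<mu> \<Longrightarrow> w \<in> W \<Longrightarrow> 0 < weight \<omega> n w"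
  using weight_ge[of \<omega> w n] \<alpha> card_W by (smt (verit) divide_pos_pos)

lemma weight_Suc_ge:
  assumes \<omega>: "\<omega> \<in> obs_space \<mu>" and w: "w \<in> W" and n: "1 \<le> n" and pos: "0 < mix n \<omega> (\<omega> n)"
  shows "(1 - \<alpha>) * (weight \<omega> n w * window_pred phat w n \<omega> (\<omega> n) / mix n \<omega> (\<omega> n)) \<le> weight \<omega> (Suc n) w"
  unfolding weight_Suc[OF n] using pos \<alpha> card_W by simp

lemma mix_ge:
  assumes \<omega>: "\<omega> \<in> obs_space \<mu>" and w: "w \<in> W" and x: "x \<in> space \<mu>"
  shows "weight \<omega> n w * window_pred phat w n \<omega> x \<le> mix n \<omega> x"
  unfolding mixture_pred_def
  by (rule member_le_sum[OF w _ W(1)]) (auto intro!: mult_nonneg_nonneg weight_nonneg window_nonneg \<omega> x)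

lemma window_past_measurable:
  assumes "w \<in> W" "1 \<le> n"
  shows "(\<lambda>\<omega>. window_pred phat w n \<omega> (\<omega> n)) \<in> borel_measurable (past \<mu> n)"
  using assms W(3) by (intro window_pred_measurable[OF phat] measurable_coordinate_past) auto

lemma weight_measurable:
  assumes "w \<in> W"
  shows "(\<lambda>\<omega>. weight \<omega> n w) \<in> borel_measurable (past \<mu> (n - 1))"
  using assms
proof (induction n arbitrary: w)
  case 0
  then show ?case by simp
next
  case (Suc n)
  show ?case
  proof (cases "n = 0")
    case False
    then have n: "1 \<le> n" by simp
    have wm [measurable]: "(\<lambda>\<omega>. weight \<omega> n v) \<in> borel_measurable (past \<mu> n)" if "v \<in> W" for v
      using Suc.IH[OF that] by (rule measurable_past_mono) simp
    note [measurable] = window_past_measurable[OF _ n]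
    have [measurable]: "(\<lambda>\<omega>. mix n \<omega> (\<omega> n)) \<in> borel_measurable (past \<mu> n)"
      unfolding mixture_pred_def by (intro borel_measurable_sum borel_measurable_times wm window_past_measurable n)
    have "(\<lambda>\<omega>. (1 - \<alpha>) * (if mix n \<omega> (\<omega> n) = 0 then weight \<omega> n w
      else weight \<omega> n w * window_pred phat w n \<omega> (\<omega> n) / mix n \<omega> (\<omega> n)) + \<alpha> / card W)
      \<in> borel_measurable (past \<mu> n)"
      using Suc.prems by measurable
    then show ?thesis unfolding weight_Suc[OF n, symmetric] by simp
  qed simp
qed

lemma mix_measurable:
  assumes "1 \<le> n"
  shows "(\<lambda>\<omega>. mix n \<omega> (\<omega> n)) \<in> borel_measurable (past \<mu> n)"
  unfolding mixture_pred_def using assms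
  by (intro borel_measurable_sum borel_measurable_times window_past_measurable
        measurable_past_mono[OF weight_measurable]) auto

lemma incr_measurable:
  assumes "1 \<le> n"
  shows "incr n \<in> borel_measurable (past \<mu> n)"
proof -
  have "(\<lambda>\<omega>. q (\<omega> n)) \<in> borel_measurable (past \<mu> n)"
    using measurable_compose[OF measurable_coordinate_past[OF assms] measurable_densities(2)] by simp
  then show ?thesis
    unfolding log_lik_def[abs_def] by (intro log_ratio_measurable mix_measurable assms)
qed

lemma stat_measurable: "stat n \<in> borel_measurable (past \<mu> n)"
proof (induction n)
  case (Suc n)
  have [measurable]: "stat n \<in> borel_measurable (past \<mu> (Suc n))"
    using Suc by (rule measurable_past_mono) simp
  have [measurable]: "incr (Suc n) \<in> borel_measurable (past \<mu> (Suc n))"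
    by (rule incr_measurable) simp
  show ?case unfolding pm_cusum_stat.simps by measurable
qed simp

lemma stop_le_iff: "stop b \<omega> \<le> enat n \<longleftrightarrow> (\<exists>k. 1 \<le> k \<and> k \<le> n \<and> ereal b < stat k \<omega>)"
proof -
  let ?A = "{enat n | n. 1 \<le> n \<and> ereal b < stat n \<omega>}"
  show ?thesis
  proof
    assume le: "stop b \<omega> \<le> enat n"
    have "?A \<noteq> {}"
    proof
      assume "?A = {}"
      then have "stop b \<omega> = Inf {}" unfolding pm_cusum_time_def by (rule arg_cong)
      then show False using le by (simp add: Inf_enat_def)
    qed
    then have "Inf ?A \<in> ?A" by (metis (no_types, lifting) ex_in_conv wellorder_InfI)
    then show "\<exists>k. 1 \<le> k \<and> k \<le> n \<and> ereal b < stat k \<omega>"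
      using le unfolding pm_cusum_time_def by auto
  next
    assume "\<exists>k. 1 \<le> k \<and> k \<le> n \<and> ereal b < stat k \<omega>"
    then obtain k where k: "1 \<le> k" "k \<le> n" "ereal b < stat k \<omega>" by blast
    then have "stop b \<omega> \<le> enat k" unfolding pm_cusum_time_def by (intro Inf_lower) auto
    also have "enat k \<le> enat n" using k by simp
    finally show "stop b \<omega> \<le> enat n" .
  qed
qed

lemma stopping_time_stop: "stopping_time (obs_filtration \<mu>) (stop b)"
proof
  fix t :: enat
  show "Measurable.pred (obs_filtration \<mu> t) (\<lambda>\<omega>. stop b \<omega> \<le> t)"
  proof (cases t)
    case (enat n)
    have "Measurable.pred (past \<mu> n) (\<lambda>\<omega>. \<exists>k\<in>{1..n}. ereal b < stat k \<omega>)"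
    proof (intro pred_intros_finite)
      fix k assume "k \<in> {1..n}"
      then have [measurable]: "stat k \<in> borel_measurable (past \<mu> n)"
        by (intro measurable_past_mono[OF stat_measurable]) auto
      show "Measurable.pred (past \<mu> n) (\<lambda>\<omega>. ereal b < stat k \<omega>)" by measurable
    qed simp
    also have "(\<lambda>\<omega>. \<exists>k\<in>{1..n}. ereal b < stat k \<omega>) = (\<lambda>\<omega>. stop b \<omega> \<le> enat n)"
      unfolding stop_le_iff by (intro ext) auto
    finally show ?thesis using enat by simp
  qed simp
qed

lemma stop_eq_imp: "stop b \<omega> = enat n \<Longrightarrow> ereal b < stat n \<omega>"
  using stop_le_iff[of b \<omega> n] stop_le_iff[of b \<omega>]
  by (metis enat_ord_simps(1) le_antisym order_refl)

lemma stop_ge_imp: "enat n \<le> stop b \<omega> \<Longrightarrow> 1 \<le> k \<Longrightarrow> k < n \<Longrightarrow> stat k \<omega> \<le> ereal b"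
  using stop_le_iff[of b \<omega> k] by (metis enat_ord_simps(2) leD le_refl not_le_imp_less order_less_le_trans)

lemma one_le_stop: "1 \<le> stop b \<omega>"
  using stop_le_iff[of b \<omega> 0] by (metis One_nat_def ileI1 le_zero_eq not_le_imp_less not_one_le_zero one_eSuc zero_enat_def)


subsection \<open>False alarms\<close>

definition mix_ratio :: "nat \<Rightarrow> (nat \<Rightarrow> 'a) \<Rightarrow> ennreal" where
  "mix_ratio n \<omega> = ennreal (mix n \<omega> (\<omega> n) / q (\<omega> n))"

text \<open>
  The Shiryaev--Roberts statistic dominates \<open>exp\<close> of the CuSum statistic, and its excess over
  the time index is a supermartingale when there is no change.
\<close>
primrec shiryaev_roberts :: "nat \<Rightarrow> (nat \<Rightarrow> 'a) \<Rightarrow> ennreal" where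
  "shiryaev_roberts 0 = (\<lambda>\<omega>. 0)"
| "shiryaev_roberts (Suc n) = (\<lambda>\<omega>. (shiryaev_roberts n \<omega> + 1) * mix_ratio (Suc n) \<omega>)"

lemma mix_ratio_measurable:
  assumes "1 \<le> n"
  shows "mix_ratio n \<in> borel_measurable (past \<mu> n)"
proof -
  have "(\<lambda>\<omega>. q (\<omega> n)) \<in> borel_measurable (past \<mu> n)"
    using measurable_compose[OF measurable_coordinate_past[OF assms] measurable_densities(2)] by simp
  then show ?thesis
    unfolding mix_ratio_def[abs_def]
    by (intro measurable_compose[OF _ measurable_ennreal] borel_measurable_divide mix_measurable assms)
qed

lemma shiryaev_roberts_measurable: "shiryaev_roberts n \<in> borel_measurable (past \<mu> n)"
proof (induction n)
  case (Suc n)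
  have [measurable]: "shiryaev_roberts n \<in> borel_measurable (past \<mu> (Suc n))"
    using Suc by (rule measurable_past_mono) simp
  have [measurable]: "mix_ratio (Suc n) \<in> borel_measurable (past \<mu> (Suc n))"
    by (rule mix_ratio_measurable) simp
  show ?case unfolding shiryaev_roberts.simps by measurable
qed simp

lemma mix_integral:
  assumes \<omega>: "\<omega> \<in> obs_space \<mu>"
  shows "mix n \<omega> \<in> borel_measurable \<mu>" "(\<integral>\<^sup>+x. ennreal (mix n \<omega> x) \<partial>\<mu>) = 1"
proof -
  have d: "is_prob_density \<mu> (window_pred phat w n \<omega>)" if "w \<in> W" for w
    using window_pred_density[OF phat _ \<omega>] W(3)[OF that] by blast
  then have m: "window_pred phat w n \<omega> \<in> borel_measurable \<mu>" if "w \<in> W" for w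
    using that by (auto simp: is_prob_density_def)
  show "mix n \<omega> \<in> borel_measurable \<mu>"
    unfolding mixture_pred_def[abs_def] using m by (intro borel_measurable_sum borel_measurable_times) auto
  have "(\<integral>\<^sup>+x. ennreal (mix n \<omega> x) \<partial>\<mu>)
      = (\<integral>\<^sup>+x. (\<Sum>w\<in>W. ennreal (weight \<omega> n w) * ennreal (window_pred phat w n \<omega> x)) \<partial>\<mu>)"
    unfolding mixture_pred_def
    by (intro nn_integral_cong)
       (auto simp: weight_nonneg window_nonneg \<omega> sum_ennreal[symmetric] ennreal_mult intro!: mult_nonneg_nonneg)
  also have "\<dots> = (\<Sum>w\<in>W. ennreal (weight \<omega> n w) * (\<integral>\<^sup>+x. ennreal (window_pred phat w n \<omega> x) \<partial>\<mu>))"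
    using m by (simp add: nn_integral_sum nn_integral_cmult)
  also have "\<dots> = (\<Sum>w\<in>W. ennreal (weight \<omega> n w))"
    using d by (intro sum.cong) (auto simp: is_prob_density_def)
  also have "\<dots> = 1"
    using weight_nonneg_sum[OF \<omega>, of n] by (subst sum_ennreal) auto
  finally show "(\<integral>\<^sup>+x. ennreal (mix n \<omega> x) \<partial>\<mu>) = 1" .
qed

lemma weight_update: "\<omega> \<in> obs_space \<mu> \<Longrightarrow> x \<in> space \<mu> \<Longrightarrow> 1 \<le> n \<Longrightarrow> w \<in> W \<Longrightarrow>
    weight (\<omega> (n := x)) n w = weight \<omega> n w"
  by (rule past_function_depends_only[OF weight_measurable]) (auto intro: pre.update_in_space)

lemma mix_update:
  assumes "\<omega> \<in> obs_space \<mu>" "x \<in> space \<mu>" "1 \<le> n"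
  shows "mix n (\<omega> (n := x)) = mix n \<omega>"
  unfolding mixture_pred_def
  using assms by (intro ext sum.cong refl arg_cong2[where f = "(*)"] weight_update window_pred_cong) auto

lemma nn_integral_mix_ratio_le_one:
  assumes \<omega>: "\<omega> \<in> obs_space \<mu>" and n: "1 \<le> n"
  shows "(\<integral>\<^sup>+x. mix_ratio n (\<omega> (n := x)) \<partial>density \<mu> q) \<le> 1"
proof -
  have "(\<integral>\<^sup>+x. mix_ratio n (\<omega> (n := x)) \<partial>density \<mu> q) = (\<integral>\<^sup>+x. ennreal (mix n \<omega> x / q x) \<partial>density \<mu> q)"
    by (intro nn_integral_cong) (simp add: mix_ratio_def mix_update[OF \<omega> _ n])
  also have "\<dots> \<le> 1"
    using mix_integral[OF \<omega>, of n] by (intro nn_integral_density_ratio_le_one q) auto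
  finally show ?thesis .
qed

text \<open>
  Both statistics obey the same recursion, one with \<open>max s 0\<close> and the other with \<open>1 + r\<close>.  Finiteness
  is part of the induction because \<open>\<infinity> + - \<infinity> = \<infinity>\<close> in the extended reals, which would let the CuSum
  statistic stay infinite after an observation that the mixture excludes.
\<close>
lemma exp_stat_le_shiryaev_roberts:
  assumes \<omega>: "\<omega> \<in> obs_space \<mu>" and q_pos: "\<And>i. 1 \<le> i \<Longrightarrow> 0 < q (\<omega> i)"
  shows "stat n \<omega> < \<infinity> \<and> (\<forall>c. ereal c < max (stat n \<omega>) 0 \<longrightarrow> ennreal (exp c) \<le> shiryaev_roberts n \<omega> + 1)
    \<and> (1 \<le> n \<longrightarrow> (\<forall>c. ereal c < stat n \<omega> \<longrightarrow> ennreal (exp c) \<le> shiryaev_roberts n \<omega>))"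
proof (induction n)
  case 0
  have "ennreal (exp c) \<le> 1" if "c < 0" for c :: real
    using that by (metis ennreal_1 ennreal_leI exp_le_one_iff less_imp_le)
  then show ?case by auto
next
  case (Suc n)
  let ?m = "mix (Suc n) \<omega> (\<omega> (Suc n))" and ?q = "q (\<omega> (Suc n))"
  have m: "0 \<le> ?m" by (intro mix_nonneg \<omega> coordinate_in_space[OF \<omega>]) simp
  have qp: "0 < ?q" by (rule q_pos) simp
  have incr: "incr (Suc n) \<omega> = (if ?m = 0 then - \<infinity> else ereal (ln (?m / ?q)))"
    using m qp by (simp add: log_lik_def log_ratio_def)
  have fin: "stat (Suc n) \<omega> < \<infinity>"
    using Suc by (auto simp: incr max_def)
  have ge: "ennreal (exp c) \<le> shiryaev_roberts (Suc n) \<omega>" if c: "ereal c < stat (Suc n) \<omega>" for c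
  proof -
    have "?m \<noteq> 0"
    proof
      assume "?m = 0"
      moreover have "max (stat n \<omega>) 0 + - \<infinity> = (- \<infinity> :: ereal)"
        using Suc by (cases "max (stat n \<omega>) 0") (auto simp: max_def split: if_splits)
      ultimately have "stat (Suc n) \<omega> = - \<infinity>" by (simp only: pm_cusum_stat.simps incr if_True simp_thms)
      with c have "ereal c < - \<infinity>" by (rule ord_less_eq_trans)
      then show False by simp
    qed
    then have mp: "0 < ?m" using m by simp
    let ?r = "ln (?m / ?q)"
    have "ereal (c - ?r) < max (stat n \<omega>) 0"
      using c \<open>?m \<noteq> 0\<close> by (cases "max (stat n \<omega>) 0") (auto simp: incr)
    then have "ennreal (exp (c - ?r)) \<le> shiryaev_roberts n \<omega> + 1" using Suc by blast
    then have "ennreal (exp (c - ?r)) * mix_ratio (Suc n) \<omega> \<le> shiryaev_roberts (Suc n) \<omega>"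
      by (simp add: mult_right_mono)
    moreover have "ennreal (exp (c - ?r)) * mix_ratio (Suc n) \<omega> = ennreal (exp c)"
      using mp qp by (simp add: mix_ratio_def exp_diff flip: ennreal_mult)
    ultimately show ?thesis by simp
  qed
  have "ennreal (exp c) \<le> shiryaev_roberts (Suc n) \<omega> + 1" if c: "ereal c < max (stat (Suc n) \<omega>) 0" for c
  proof (cases "c < 0")
    case True
    then have "ennreal (exp c) \<le> 1"
      by (metis ennreal_1 ennreal_leI exp_le_one_iff less_imp_le)
    then show ?thesis by (metis add.commute add_increasing2 zero_le)
  next
    case False
    then have "ereal c < stat (Suc n) \<omega>" using c by (auto simp: max_def split: if_splits)
    then show ?thesis using ge[of c] by (metis add_increasing2 zero_le)
  qed
  with fin ge show ?case by blast
qed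

text \<open>
  Optional stopping at time \<open>n\<close>, written as a sum over the values of the stopping time; the
  inequality is the supermartingale property.
\<close>
lemma shiryaev_roberts_stopped:
  assumes st: "stopping_time (obs_filtration \<mu>) T"
  shows "(\<integral>\<^sup>+\<omega>. indicator {\<omega> \<in> obs_space \<mu>. enat n < T \<omega>} \<omega> * shiryaev_roberts n \<omega> \<partial>law_no_change \<mu> q)
      + (\<Sum>k<n. \<integral>\<^sup>+\<omega>. indicator {\<omega> \<in> obs_space \<mu>. T \<omega> = enat (Suc k)} \<omega> * shiryaev_roberts (Suc k) \<omega> \<partial>law_no_change \<mu> q)
    \<le> (\<Sum>k<n. emeasure (law_no_change \<mu> q) {\<omega> \<in> obs_space \<mu>. enat k < T \<omega>})"
proof (induction n)
  case 0
  then show ?case by simp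
next
  case (Suc n)
  let ?Q = "law_no_change \<mu> q"
  define G where "G k = {\<omega> \<in> obs_space \<mu>. enat k < T \<omega>}" for k
  define E where "E k = {\<omega> \<in> obs_space \<mu>. T \<omega> = enat k}" for k
  let ?R = "shiryaev_roberts"
  have G_past: "G k \<in> sets (past \<mu> k)" and E_past: "E k \<in> sets (past \<mu> k)" for k
    using stopping_time_events[OF st, of k] by (auto simp: G_def E_def)
  have [measurable]: "G k \<in> sets ?Q" "E k \<in> sets ?Q" for k
    using G_past E_past pre.past_sets_L by blast+
  have [measurable]: "?R k \<in> borel_measurable ?Q" for k
    by (rule pre.past_measurable_L[OF shiryaev_roberts_measurable])
  have "(\<integral>\<^sup>+\<omega>. indicator (G (Suc n)) \<omega> * ?R (Suc n) \<omega> \<partial>?Q) + (\<integral>\<^sup>+\<omega>. indicator (E (Suc n)) \<omega> * ?R (Suc n) \<omega> \<partial>?Q)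
      = (\<integral>\<^sup>+\<omega>. indicator (G (Suc n)) \<omega> * ?R (Suc n) \<omega> + indicator (E (Suc n)) \<omega> * ?R (Suc n) \<omega> \<partial>?Q)"
    by (rule nn_integral_add[symmetric]) measurable
  also have "\<dots> = (\<integral>\<^sup>+\<omega>. (indicator (G n) \<omega> * (?R n \<omega> + 1)) * mix_ratio (Suc n) \<omega> \<partial>?Q)"
  proof (intro nn_integral_cong)
    fix \<omega>
    have "enat n < T \<omega> \<longleftrightarrow> enat (Suc n) < T \<omega> \<or> T \<omega> = enat (Suc n)"
      by (cases "T \<omega>") auto
    then have "indicator (G n) \<omega> = (indicator (G (Suc n)) \<omega> + indicator (E (Suc n)) \<omega> :: ennreal)"
      by (auto simp: G_def E_def indicator_def)
    then show "indicator (G (Suc n)) \<omega> * ?R (Suc n) \<omega> + indicator (E (Suc n)) \<omega> * ?R (Suc n) \<omega>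
        = (indicator (G n) \<omega> * (?R n \<omega> + 1)) * mix_ratio (Suc n) \<omega>"
      by (simp add: distrib_right mult.assoc)
  qed
  also have "\<dots> \<le> (\<integral>\<^sup>+\<omega>. indicator (G n) \<omega> * (?R n \<omega> + 1) \<partial>?Q)"
  proof (rule pre.nn_integral_past_times_le[where n = "Suc n"])
    have [measurable]: "G n \<in> sets (past \<mu> n)" "?R n \<in> borel_measurable (past \<mu> n)"
      by (rule G_past shiryaev_roberts_measurable)+
    show "(\<lambda>\<omega>. indicator (G n) \<omega> * (?R n \<omega> + 1)) \<in> borel_measurable (past \<mu> (Suc n - 1))"
      by simp
    show "mix_ratio (Suc n) \<in> borel_measurable ?Q"
      by (intro pre.past_measurable_L[OF mix_ratio_measurable]) simp
    show "(\<integral>\<^sup>+x. mix_ratio (Suc n) (\<omega> (Suc n := x)) \<partial>density \<mu> q) \<le> 1" if "\<omega> \<in> obs_space \<mu>" for \<omega>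
      using that by (intro nn_integral_mix_ratio_le_one) auto
  qed simp
  also have "\<dots> = (\<integral>\<^sup>+\<omega>. indicator (G n) \<omega> * ?R n \<omega> \<partial>?Q) + emeasure ?Q (G n)"
    by (simp add: distrib_left nn_integral_add)
  finally have step: "(\<integral>\<^sup>+\<omega>. indicator (G (Suc n)) \<omega> * ?R (Suc n) \<omega> \<partial>?Q)
      + (\<integral>\<^sup>+\<omega>. indicator (E (Suc n)) \<omega> * ?R (Suc n) \<omega> \<partial>?Q)
      \<le> (\<integral>\<^sup>+\<omega>. indicator (G n) \<omega> * ?R n \<omega> \<partial>?Q) + emeasure ?Q (G n)" .
  have combine: "a + (s + e) \<le> t + P" if "a + e \<le> g + P" "g + s \<le> t" for a e g s t P :: ennreal
  proof -
    have "a + (s + e) = (a + e) + s" by (simp add: ac_simps)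
    also have "\<dots> \<le> (g + P) + s" using that(1) by (rule add_right_mono)
    also have "\<dots> = (g + s) + P" by (simp add: ac_simps)
    also have "\<dots> \<le> t + P" using that(2) by (rule add_right_mono)
    finally show ?thesis .
  qed
  show ?case
    using combine[OF step Suc.IH[folded G_def E_def]]
    unfolding G_def[symmetric] E_def[symmetric] sum.lessThan_Suc .
qed

text \<open>
  When \<open>stop\<close> is almost surely finite, optional stopping bounds \<open>\<gamma> P(stop < \<infinity>)\<close> by its mean;
  otherwise its mean is infinite.
\<close>
theorem stop_in_stopping_class:
  assumes "0 < \<gamma>"
  shows "stop (ln \<gamma>) \<in> stopping_class \<mu> q \<gamma>"
proof -
  let ?Q = "law_no_change \<mu> q" and ?T = "stop (ln \<gamma>)"
  interpret Q: prob_space ?Q by (rule pre.prob_L)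
  have st: "stopping_time (obs_filtration \<mu>) ?T" by (rule stopping_time_stop)
  have Tm [measurable]: "?T \<in> measurable ?Q (count_space UNIV)"
    using st pre.sets_L by (rule measurable_stopping_time_count_space)
  define G where "G k = {\<omega> \<in> obs_space \<mu>. enat k < ?T \<omega>}" for k
  define E where "E k = {\<omega> \<in> obs_space \<mu>. ?T \<omega> = enat k}" for k
  have [measurable]: "G k \<in> sets ?Q" "E k \<in> sets ?Q" for k
    unfolding G_def E_def by (rule pre.past_sets_L, rule stopping_time_events[OF st])+
  have mean: "(\<integral>\<^sup>+\<omega>. ennreal_of_enat (?T \<omega>) \<partial>?Q) = (\<Sum>k. emeasure ?Q (G k))"
    using nn_integral_enat_function[OF Tm] by (simp add: G_def)
  have "AE \<omega> in ?Q. \<forall>i\<ge>1. 0 < q (\<omega> i)"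
    using pre.AE_coordinate[where Q = "\<lambda>x. 0 < q x"] AE_density_pos(2) by (simp add: AE_all_countable)
  then have dom: "AE \<omega> in ?Q. ennreal \<gamma> * indicator (E (Suc k)) \<omega> \<le> indicator (E (Suc k)) \<omega> * shiryaev_roberts (Suc k) \<omega>" for k
    using AE_space[of ?Q]
  proof eventually_elim
    case (elim \<omega>)
    show ?case
    proof (cases "\<omega> \<in> E (Suc k)")
      case True
      then have "ereal (ln \<gamma>) < stat (Suc k) \<omega>"
        by (intro stop_eq_imp) (simp add: E_def)
      then have "ennreal (exp (ln \<gamma>)) \<le> shiryaev_roberts (Suc k) \<omega>"
        using exp_stat_le_shiryaev_roberts[of \<omega> "Suc k"] elim by auto
      then show ?thesis using True assms by simp
    qed simp
  qed
  have partial: "(\<Sum>k<n. ennreal \<gamma> * emeasure ?Q (E (Suc k))) \<le> (\<Sum>k. emeasure ?Q (G k))" for n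
  proof -
    have "(\<Sum>k<n. ennreal \<gamma> * emeasure ?Q (E (Suc k)))
        = (\<Sum>k<n. \<integral>\<^sup>+\<omega>. ennreal \<gamma> * indicator (E (Suc k)) \<omega> \<partial>?Q)"
      by (simp add: nn_integral_cmult_indicator)
    also have "\<dots> \<le> (\<Sum>k<n. \<integral>\<^sup>+\<omega>. indicator (E (Suc k)) \<omega> * shiryaev_roberts (Suc k) \<omega> \<partial>?Q)"
      by (intro sum_mono nn_integral_mono_AE dom)
    also have "\<dots> \<le> (\<Sum>k<n. emeasure ?Q (G k))"
      using shiryaev_roberts_stopped[OF st, of n] unfolding G_def E_def
      by (rule order_trans[rotated]) simp
    also have "\<dots> \<le> (\<Sum>k. emeasure ?Q (G k))"
      by (rule sum_le_suminf) auto
    finally show ?thesis .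
  qed
  have "ennreal \<gamma> \<le> (\<integral>\<^sup>+\<omega>. ennreal_of_enat (?T \<omega>) \<partial>?Q)"
  proof (cases "AE \<omega> in ?Q. ?T \<omega> \<noteq> \<infinity>")
    case True
    have "1 = emeasure ?Q (\<Union>k. E (Suc k))"
    proof (subst Q.emeasure_eq_1_AE)
      show "AE \<omega> in ?Q. \<omega> \<in> (\<Union>k. E (Suc k))"
        using True AE_space[of ?Q]
      proof eventually_elim
        case (elim \<omega>)
        then obtain n where n: "?T \<omega> = enat n" by auto
        with one_le_stop[of "ln \<gamma>" \<omega>] have "1 \<le> n" by (simp add: one_enat_def)
        then show ?case using n elim by (auto simp: E_def intro!: exI[of _ "n - 1"])
      qed
    qed auto
    also have "\<dots> = (\<Sum>k. emeasure ?Q (E (Suc k)))"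
    proof (rule suminf_emeasure[symmetric])
      show "disjoint_family (\<lambda>k. E (Suc k))" by (auto simp: disjoint_family_on_def E_def)
    qed auto
    finally have "ennreal \<gamma> = (\<Sum>k. ennreal \<gamma> * emeasure ?Q (E (Suc k)))"
      by (simp add: ennreal_suminf_cmult[symmetric])
    also have "\<dots> \<le> (\<Sum>k. emeasure ?Q (G k))"
      unfolding suminf_eq_SUP[of "\<lambda>k. ennreal \<gamma> * emeasure ?Q (E (Suc k))"] by (intro SUP_least partial)
    finally show ?thesis using mean by simp
  next
    case False
    have "(\<integral>\<^sup>+\<omega>. ennreal_of_enat (?T \<omega>) \<partial>?Q) = \<infinity>"
    proof (rule ccontr)
      assume "(\<integral>\<^sup>+\<omega>. ennreal_of_enat (?T \<omega>) \<partial>?Q) \<noteq> \<infinity>"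
      then have "AE \<omega> in ?Q. ennreal_of_enat (?T \<omega>) \<noteq> \<infinity>"
        by (intro nn_integral_PInf_AE) auto
      then have "AE \<omega> in ?Q. ?T \<omega> \<noteq> \<infinity>" by eventually_elim (metis ennreal_of_enat_infty)
      with False show False by simp
    qed
    then show ?thesis by simp
  qed
  with st show ?thesis by (simp add: stopping_class_def)
qed

end

section \<open>The delay of PM-CuSum\<close>

definition mean_excess_le :: "'b measure \<Rightarrow> 'b measure \<Rightarrow> ('b \<Rightarrow> ereal) \<Rightarrow> real \<Rightarrow> bool" where
  "mean_excess_le M F X C \<longleftrightarrow> (\<forall>t\<ge>0. AE \<omega> in M. nn_cond_exp_event M F {\<omega> \<in> space M. ereal t \<le> X \<omega>}
     (\<lambda>\<omega>. e2ennreal (X \<omega> - ereal t)) \<omega> \<le> ennreal C)"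

lemma mean_excess_le_mono:
  assumes "mean_excess_le M F X C" "C \<le> C'"
  shows "mean_excess_le M F X C'"
  unfolding mean_excess_le_def
proof (intro allI impI)
  fix t :: real assume "0 \<le> t"
  with assms(1) have "AE \<omega> in M. nn_cond_exp_event M F {\<omega> \<in> space M. ereal t \<le> X \<omega>}
     (\<lambda>\<omega>. e2ennreal (X \<omega> - ereal t)) \<omega> \<le> ennreal C" by (simp add: mean_excess_le_def)
  then show "AE \<omega> in M. nn_cond_exp_event M F {\<omega> \<in> space M. ereal t \<le> X \<omega>}
     (\<lambda>\<omega>. e2ennreal (X \<omega> - ereal t)) \<omega> \<le> ennreal C'"
    by eventually_elim (use assms(2) in \<open>auto intro: order_trans ennreal_leI\<close>)
qed

locale pm_cusum_KL = pm_cusum + change_point_KL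
begin

subsection \<open>The loss of a window\<close>

definition loss :: "nat \<Rightarrow> nat \<Rightarrow> (nat \<Rightarrow> 'a) \<Rightarrow> real" where
  "loss w i \<omega> = ln (p (\<omega> i) / window_pred phat w i \<omega> (\<omega> i))"

lemma window_measurable_law:
  assumes "1 \<le> w" "1 \<le> i"
  shows "(\<lambda>\<omega>. window_pred phat w i \<omega> (\<omega> i)) \<in> borel_measurable (law \<mu> q p \<nu>)"
    "(\<lambda>\<omega>. p (\<omega> i)) \<in> borel_measurable (law \<mu> q p \<nu>)"
proof -
  have "(\<lambda>\<omega>. window_pred phat w i \<omega> (\<omega> i)) \<in> borel_measurable (past \<mu> i)"
    using assms by (intro window_pred_measurable[OF phat] measurable_coordinate_past) auto
  then show "(\<lambda>\<omega>. window_pred phat w i \<omega> (\<omega> i)) \<in> borel_measurable (law \<mu> q p \<nu>)"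
    by (rule post.past_measurable_L)
  have "(\<lambda>\<omega>. p (\<omega> i)) \<in> borel_measurable (past \<mu> i)"
    using measurable_compose[OF measurable_coordinate_past[OF assms(2) order_refl] measurable_densities(1)] .
  then show "(\<lambda>\<omega>. p (\<omega> i)) \<in> borel_measurable (law \<mu> q p \<nu>)"
    by (rule post.past_measurable_L)
qed

lemma nn_integral_inverse_ratio_le:
  assumes w: "1 \<le> w" and i: "1 \<le> i" "\<nu> \<le> i" and E: "E \<in> sets (past \<mu> (i - 1))"
  shows "(\<integral>\<^sup>+\<omega>. indicator E \<omega> * ennreal (window_pred phat w i \<omega> (\<omega> i) / p (\<omega> i)) \<partial>law \<mu> q p \<nu>)
    \<le> emeasure (law \<mu> q p \<nu>) E"
proof -
  have [measurable]: "E \<in> sets (past \<mu> (i - 1))" by fact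
  have "(\<integral>\<^sup>+\<omega>. indicator E \<omega> * ennreal (window_pred phat w i \<omega> (\<omega> i) / p (\<omega> i)) \<partial>law \<mu> q p \<nu>)
      \<le> (\<integral>\<^sup>+\<omega>. indicator E \<omega> \<partial>law \<mu> q p \<nu>)"
  proof (rule post.nn_integral_past_times_le[OF i(1)])
    show "(\<lambda>\<omega>. ennreal (window_pred phat w i \<omega> (\<omega> i) / p (\<omega> i))) \<in> borel_measurable (law \<mu> q p \<nu>)"
      using window_measurable_law[OF w i(1), of \<nu>] by measurable
    fix \<omega> assume \<omega>: "\<omega> \<in> obs_space \<mu>"
    have "window_pred phat w i (\<omega> (i := x)) = window_pred phat w i \<omega>" for x
      by (intro ext window_pred_cong) auto
    moreover have "(\<integral>\<^sup>+x. ennreal (window_pred phat w i \<omega> x / p x) \<partial>density \<mu> p) \<le> 1"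
      using window_pred_density[OF phat w \<omega>, of i]
      by (intro nn_integral_density_ratio_le_one p) (auto simp: is_prob_density_def)
    ultimately show "(\<integral>\<^sup>+x. ennreal (window_pred phat w i (\<omega> (i := x)) ((\<omega> (i := x)) i) / p ((\<omega> (i := x)) i))
        \<partial>(if i < \<nu> then density \<mu> q else density \<mu> p)) \<le> 1"
      using i by simp
  qed simp
  also have "\<dots> = emeasure (law \<mu> q p \<nu>) E"
    using post.past_sets_L[OF E] by simp
  finally show ?thesis .
qed

text \<open>
  A window that opens after time \<open>m\<close> sees only the observations after \<open>m\<close>.
\<close>
lemma loss_restrict:
  assumes "1 \<le> i" "w < i" "m < i - w"
  shows "loss w i (restrict \<omega> {m<..}) = loss w i \<omega>"
    "window_pred phat w i (restrict \<omega> {m<..}) (restrict \<omega> {m<..} i) = window_pred phat w i \<omega> (\<omega> i)"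
proof -
  have "window_pred phat w i (restrict \<omega> {m<..}) = window_pred phat w i \<omega>"
    using assms by (intro ext window_pred_cong) auto
  then show "loss w i (restrict \<omega> {m<..}) = loss w i \<omega>"
    "window_pred phat w i (restrict \<omega> {m<..}) (restrict \<omega> {m<..} i) = window_pred phat w i \<omega> (\<omega> i)"
    using assms by (auto simp: loss_def)
qed

text \<open>
  Let the window of length \<open>w\<close> at time \<open>i\<close> hold post-change observations only.  The loss has a
  nonnegative mean on every event of the past, so its mean over \<open>C\<close> is at most the mean over the
  larger event \<open>B\<close>.  As \<open>B\<close> was decided before the window opened, it is independent of the loss.
\<close>
lemma expected_loss_le:
  assumes w: "1 \<le> w" and \<nu>: "1 \<le> \<nu>" and i: "\<nu> + w \<le> i"
    and KL: "ext_expectation (law \<mu> q p 1)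
        (\<lambda>\<omega>. log_ratio (p (\<omega> i)) (window_pred phat w i \<omega> (\<omega> i))) \<le> ereal c"
    and B: "B \<in> sets (past \<mu> (i - w - 1))" and C: "C \<in> sets (past \<mu> (i - 1))" "C \<subseteq> B"
  shows "AE \<omega> in law \<mu> q p \<nu>. 0 < window_pred phat w i \<omega> (\<omega> i)"
    "integrable (law \<mu> q p \<nu>) (\<lambda>\<omega>. indicator C \<omega> * loss w i \<omega>)"
    "(\<integral>\<omega>. indicator C \<omega> * loss w i \<omega> \<partial>law \<mu> q p \<nu>) \<le> measure (law \<mu> q p \<nu>) B * c"
proof -
  let ?M = "law \<mu> q p \<nu>" and ?M1 = "law \<mu> q p 1"
  define m where "m = i - w - 1"
  have i1: "1 \<le> i" "\<nu> \<le> i" "w < i" "m < i - w" "m < i" using \<nu> i by (auto simp: m_def)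
  let ?v = "\<lambda>\<omega>. window_pred phat w i \<omega> (\<omega> i)"
  let ?F = "PiM {m<..} (\<lambda>n. if n < \<nu> then density \<mu> q else density \<mu> p)"
  let ?F1 = "PiM {m<..} (\<lambda>n. if n < 1 then density \<mu> q else density \<mu> p)"
  interpret M: prob_space ?M by (rule post.prob_L)
  interpret M1: prob_space ?M1 by (rule post.prob_L)
  (* All coordinates after m have the post-change law, whether the change is at 1 or at \<nu>. *)
  have F_eq: "?F = ?F1" using \<nu> i by (intro PiM_cong) (auto simp: m_def)
  have v_nonneg: "0 \<le> ?v \<omega>" if "\<omega> \<in> obs_space \<mu>" for \<omega>
    using window_pred_density[OF phat w that, of i] coordinate_in_space[OF that i1(1)]
    by (auto simp: is_prob_density_def)
  have space_past: "obs_space \<mu> \<in> sets (past \<mu> n)" for n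
    using sets.top[of "past \<mu> n"] by simp
  have p_pos: "AE \<omega> in law \<mu> q p \<nu>. 0 < p (\<omega> i)" if "\<nu> \<le> i" "1 \<le> \<nu>" for \<nu>
    using AE_law_pos[OF that(2)] by eventually_elim (use that in auto)
  have inv1: "(\<integral>\<^sup>+\<omega>. ennreal (?v \<omega> / p (\<omega> i)) \<partial>?M1) \<le> 1"
  proof -
    have "(\<integral>\<^sup>+\<omega>. ennreal (?v \<omega> / p (\<omega> i)) \<partial>?M1)
        = (\<integral>\<^sup>+\<omega>. indicator (obs_space \<mu>) \<omega> * ennreal (?v \<omega> / p (\<omega> i)) \<partial>?M1)"
      by (intro nn_integral_cong) simp
    also have "\<dots> \<le> emeasure ?M1 (obs_space \<mu>)"
      by (rule nn_integral_inverse_ratio_le[OF w i1(1,1) space_past])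
    also have "\<dots> \<le> 1" by (rule M1.emeasure_le_1)
    finally show ?thesis .
  qed
  note meas1 = window_measurable_law[OF w i1(1), of 1]
  have KL': "ext_expectation ?M1 (\<lambda>\<omega>. log_ratio (p (\<omega> i)) (?v \<omega>)) < \<infinity>"
    using KL by (rule le_less_trans) simp
  have vn1: "\<And>\<omega>. \<omega> \<in> space ?M1 \<Longrightarrow> 0 \<le> ?v \<omega>" using v_nonneg by simp
  note E1 = ext_expectation_log_ratio[OF meas1(2,1) p_pos[OF i1(1) order_refl] vn1 inv1 KL']
  have int1: "integrable ?M1 (loss w i)" "(\<integral>\<omega>. loss w i \<omega> \<partial>?M1) \<le> c"
    using E1(2,3) KL by (auto simp: loss_def[abs_def])
  have coord: "(\<lambda>y. y j) \<in> measurable ?F \<mu>" if "m < j" for j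
  proof -
    have "(\<lambda>y. y j) \<in> measurable ?F (if j < \<nu> then density \<mu> q else density \<mu> p)"
      using that by (intro measurable_component_singleton) auto
    then show ?thesis by (cases "j < \<nu>") auto
  qed
  have v_F: "?v \<in> borel_measurable ?F"
    using i1 by (intro window_pred_measurable[OF phat w] coord) (auto simp: m_def)
  have loss_F: "loss w i \<in> borel_measurable ?F"
    unfolding loss_def[abs_def] using v_F measurable_compose[OF coord[OF i1(5)] measurable_densities(1)]
    by (intro borel_measurable_ln borel_measurable_divide) auto
  have res1: "(\<lambda>\<omega>. restrict \<omega> {m<..}) \<in> measurable ?M1 ?F"
    unfolding F_eq by (rule post.restrict_measurable) auto
  have dist1: "distr ?M1 ?F (\<lambda>\<omega>. restrict \<omega> {m<..}) = ?F"
    unfolding F_eq by (rule post.distr_restrict) auto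
  have intF: "integrable ?F (loss w i)"
  proof -
    have "integrable ?M1 (\<lambda>\<omega>. loss w i (restrict \<omega> {m<..}))"
      using int1(1) by (simp add: loss_restrict[OF i1(1,3,4)])
    then have "integrable (distr ?M1 ?F (\<lambda>\<omega>. restrict \<omega> {m<..})) (loss w i)"
      by (subst integrable_distr_eq[OF res1 loss_F])
    then show ?thesis unfolding dist1 .
  qed
  have meanF: "(\<integral>y. loss w i y \<partial>?F) \<le> c"
  proof -
    have "(\<integral>y. loss w i y \<partial>distr ?M1 ?F (\<lambda>\<omega>. restrict \<omega> {m<..})) = (\<integral>\<omega>. loss w i (restrict \<omega> {m<..}) \<partial>?M1)"
      by (rule integral_distr[OF res1 loss_F])
    then show ?thesis
      unfolding dist1 using int1(2) by (simp add: loss_restrict[OF i1(1,3,4)])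
  qed
  have B': "B \<in> sets (past \<mu> m)" using B by (simp add: m_def)
  have intB: "integrable ?M (\<lambda>\<omega>. indicator B \<omega> * loss w i \<omega>)"
    and meanB: "(\<integral>\<omega>. indicator B \<omega> * loss w i \<omega> \<partial>?M) = measure ?M B * (\<integral>y. loss w i y \<partial>?F)"
    using post.integral_past_event_future[OF B' intF] by (simp_all add: loss_restrict[OF i1(1,3,4)])
  show vpos: "AE \<omega> in ?M. 0 < ?v \<omega>"
  proof -
    have J: "{m<..} \<subseteq> {1..}" by auto
    have pr: "Measurable.pred ?F (\<lambda>y. 0 < ?v y)" using v_F by measurable
    have "AE \<omega> in ?M1. 0 < ?v (restrict \<omega> {m<..})"
      using E1(1) by (simp only: loss_restrict(2)[OF i1(1,3,4)])
    then have "AE y in ?F. 0 < ?v y"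
      using post.AE_restrict[where \<nu> = 1, OF J] pr unfolding F_eq by blast
    then have "AE \<omega> in ?M. 0 < ?v (restrict \<omega> {m<..})"
      using post.AE_restrict[where \<nu> = \<nu>, OF J] pr by blast
    then show ?thesis by (simp only: loss_restrict(2)[OF i1(1,3,4)])
  qed
  have BC: "B - C \<in> sets (past \<mu> (i - 1))"
  proof -
    have "B \<in> sets (past \<mu> (i - 1))" using B by (rule subsetD[OF sets_past_mono, rotated]) simp
    then show ?thesis using C by auto
  qed
  have C_M [measurable]: "C \<in> sets ?M" and BC_M [measurable]: "B - C \<in> sets ?M" and B_M [measurable]: "B \<in> sets ?M"
    using C BC B post.past_sets_L by blast+
  have loss_M [measurable]: "loss w i \<in> borel_measurable ?M"
    unfolding loss_def[abs_def] using window_measurable_law[OF w i1(1), of \<nu>] by measurable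
  show intC: "integrable ?M (\<lambda>\<omega>. indicator C \<omega> * loss w i \<omega>)"
    using C(2) by (intro Bochner_Integration.integrable_bound[OF intB]) (auto simp: indicator_def)
  have intBC: "integrable ?M (\<lambda>\<omega>. indicator (B - C) \<omega> * loss w i \<omega>)"
    by (intro Bochner_Integration.integrable_bound[OF intB]) (auto simp: indicator_def)
  (* ln t \<ge> 1 - 1 / t, with t the ratio of p to the window density *)
  let ?h = "\<lambda>\<omega>. indicator (B - C) \<omega> * (?v \<omega> / p (\<omega> i))"
  have h_nn: "0 \<le> ?h \<omega>" if "\<omega> \<in> obs_space \<mu>" for \<omega>
    using v_nonneg[OF that] density_nonneg(1)[OF coordinate_in_space[OF that i1(1)]] by simp
  have h_meas: "?h \<in> borel_measurable ?M"
    using window_measurable_law[OF w i1(1), of \<nu>] by measurable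
  have h_le: "(\<integral>\<^sup>+\<omega>. ennreal (?h \<omega>) \<partial>?M) \<le> ennreal (measure ?M (B - C))"
  proof -
    have "(\<integral>\<^sup>+\<omega>. ennreal (?h \<omega>) \<partial>?M) = (\<integral>\<^sup>+\<omega>. indicator (B - C) \<omega> * ennreal (?v \<omega> / p (\<omega> i)) \<partial>?M)"
      by (intro nn_integral_cong) (simp add: indicator_def)
    then show ?thesis
      using nn_integral_inverse_ratio_le[OF w i1(1,2) BC] by (simp add: M.emeasure_eq_measure)
  qed
  have h_int: "integrable ?M ?h" and h_mean: "(\<integral>\<omega>. ?h \<omega> \<partial>?M) \<le> measure ?M (B - C)"
    using h_nn by (intro integral_le_of_nn_integral_le[OF h_meas _ h_le]; simp)+
  have ind_int: "integrable ?M (indicat_real (B - C))"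
    using M.emeasure_finite by (intro integrable_real_indicator) (auto simp: less_top[symmetric])
  have "(\<integral>\<omega>. indicat_real (B - C) \<omega> - ?h \<omega> \<partial>?M) \<le> (\<integral>\<omega>. indicator (B - C) \<omega> * loss w i \<omega> \<partial>?M)"
  proof (rule integral_mono_AE[OF Bochner_Integration.integrable_diff[OF ind_int h_int] intBC])
    show "AE \<omega> in ?M. indicat_real (B - C) \<omega> - ?h \<omega> \<le> indicator (B - C) \<omega> * loss w i \<omega>"
      using vpos p_pos[OF i1(2) \<nu>]
    proof eventually_elim
      case (elim \<omega>)
      have "1 - ?v \<omega> / p (\<omega> i) \<le> loss w i \<omega>"
        using ln_le_minus_one[of "?v \<omega> / p (\<omega> i)"] elim by (simp add: loss_def ln_div)
      then show ?case by (simp add: indicator_def)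
    qed
  qed
  moreover have "(\<integral>\<omega>. indicat_real (B - C) \<omega> - ?h \<omega> \<partial>?M) = measure ?M (B - C) - (\<integral>\<omega>. ?h \<omega> \<partial>?M)"
    using BC_M sets.sets_into_space[OF BC_M]
    by (subst Bochner_Integration.integral_diff[OF ind_int h_int]) (simp add: Int_absorb2)
  ultimately have BC_nonneg: "0 \<le> (\<integral>\<omega>. indicator (B - C) \<omega> * loss w i \<omega> \<partial>?M)"
    using h_mean by linarith
  have "(\<integral>\<omega>. indicator B \<omega> * loss w i \<omega> \<partial>?M)
      = (\<integral>\<omega>. indicator C \<omega> * loss w i \<omega> + indicator (B - C) \<omega> * loss w i \<omega> \<partial>?M)"
    using C(2) by (intro Bochner_Integration.integral_cong refl) (auto simp: indicator_def)
  also have "\<dots> = (\<integral>\<omega>. indicator C \<omega> * loss w i \<omega> \<partial>?M) + (\<integral>\<omega>. indicator (B - C) \<omega> * loss w i \<omega> \<partial>?M)"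
    by (rule Bochner_Integration.integral_add[OF intC intBC])
  finally have "(\<integral>\<omega>. indicator C \<omega> * loss w i \<omega> \<partial>?M) \<le> measure ?M B * (\<integral>y. loss w i y \<partial>?F)"
    using BC_nonneg meanB by linarith
  also have "\<dots> \<le> measure ?M B * c" using meanF by (intro mult_left_mono) auto
  finally show "(\<integral>\<omega>. indicator C \<omega> * loss w i \<omega> \<partial>?M) \<le> measure ?M B * c" .
qed

subsection \<open>The overshoot\<close>

text \<open>
  By Markov's inequality, an increment that has reached \<open>t\<close> reaches \<open>t + 2 C\<close> with conditional
  probability at most one half.  Iterating this gives exponential tails, uniformly in the past.
\<close>
lemma overshoot_tail:
  assumes C: "0 < C" and n: "1 \<le> n" and A: "A \<in> sets (past \<mu> (n - 1))"
    and over: "mean_excess_le (law \<mu> q p \<nu>) (past \<mu> (n - 1)) (incr n) C"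
  shows "(\<integral>\<^sup>+\<omega>. indicator A \<omega> * e2ennreal (incr n \<omega> - ereal (2 * C * real j)) \<partial>law \<mu> q p \<nu>)
    \<le> ennreal (C * (1 / 2) ^ j) * emeasure (law \<mu> q p \<nu>) A"
proof -
  let ?M = "law \<mu> q p \<nu>"
  interpret M: prob_space ?M by (rule post.prob_L)
  define X where "X t = {\<omega> \<in> space ?M. ereal t \<le> incr n \<omega>}" for t
  have [measurable]: "incr n \<in> borel_measurable ?M"
    by (rule post.past_measurable_L[OF incr_measurable[OF n]])
  have [measurable]: "A \<in> sets ?M" using A by (rule post.past_sets_L)
  have [measurable]: "X t \<in> sets ?M" for t unfolding X_def by measurable
  have excess: "(\<integral>\<^sup>+\<omega>. indicator A \<omega> * e2ennreal (incr n \<omega> - ereal t) \<partial>?M) \<le> ennreal C * emeasure ?M (A \<inter> X t)"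
    if t: "0 \<le> t" for t
  proof -
    let ?f = "\<lambda>\<omega>. e2ennreal (incr n \<omega> - ereal t) * indicator (X t) \<omega>"
    let ?num = "nn_cond_exp ?M (past \<mu> (n - 1)) ?f"
    let ?den = "nn_cond_exp ?M (past \<mu> (n - 1)) (indicator (X t))"
    have le: "AE \<omega> in ?M. ?num \<omega> \<le> ennreal C * ?den \<omega>"
      using over[unfolded mean_excess_le_def, rule_format, OF t]
      unfolding nn_cond_exp_event_def X_def[symmetric]
    proof eventually_elim
      case (elim \<omega>)
      show ?case
      proof (cases "?den \<omega> = 0")
        (* the quotient is bounded by C, and x / 0 = \<infinity> unless x = 0 *)
        case True
        then have "?num \<omega> = 0"
          using elim by (cases "?num \<omega> = 0") (auto simp: ennreal_divide_zero top_unique)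
        then show ?thesis by simp
      next
        case False
        show ?thesis
        proof (cases "?den \<omega> = \<infinity>")
          case True
          then show ?thesis using C by (simp add: ennreal_mult_top)
        next
          case fin: False
          have "?num \<omega> = ?num \<omega> / ?den \<omega> * ?den \<omega>"
            using False fin by (simp add: ennreal_divide_times ennreal_divide_self less_top[symmetric] mult_divide_eq_ennreal)
          also have "\<dots> \<le> ennreal C * ?den \<omega>" using elim by (rule mult_right_mono) simp
          finally show ?thesis .
        qed
      qed
    qed
    have "(\<integral>\<^sup>+\<omega>. indicator A \<omega> * e2ennreal (incr n \<omega> - ereal t) \<partial>?M) = (\<integral>\<^sup>+\<omega>. indicator A \<omega> * ?f \<omega> \<partial>?M)"
    proof (intro nn_integral_cong)
      fix \<omega> assume "\<omega> \<in> space ?M"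
      then have "e2ennreal (incr n \<omega> - ereal t) = ?f \<omega>"
        by (cases "incr n \<omega>") (auto simp: X_def indicator_def ennreal_neg e2ennreal_neg)
      then show "indicator A \<omega> * e2ennreal (incr n \<omega> - ereal t) = indicator A \<omega> * ?f \<omega>" by (rule arg_cong)
    qed
    also have "\<dots> = (\<integral>\<^sup>+\<omega>. indicator A \<omega> * ?num \<omega> \<partial>?M)"
      by (rule post.nn_cond_exp_past_event[OF A, symmetric]) measurable
    also have "\<dots> \<le> (\<integral>\<^sup>+\<omega>. ennreal C * (indicator A \<omega> * ?den \<omega>) \<partial>?M)"
      using le by (intro nn_integral_mono_AE) (auto simp: indicator_def)
    also have "\<dots> = ennreal C * (\<integral>\<^sup>+\<omega>. indicator A \<omega> * ?den \<omega> \<partial>?M)"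
      by (rule nn_integral_cmult) measurable
    also have "(\<integral>\<^sup>+\<omega>. indicator A \<omega> * ?den \<omega> \<partial>?M) = (\<integral>\<^sup>+\<omega>. indicator A \<omega> * indicator (X t) \<omega> \<partial>?M)"
      by (rule post.nn_cond_exp_past_event[OF A]) measurable
    also have "\<dots> = (\<integral>\<^sup>+\<omega>. indicator (A \<inter> X t) \<omega> \<partial>?M)"
      by (simp add: indicator_inter_arith)
    also have "\<dots> = emeasure ?M (A \<inter> X t)" by (rule nn_integral_indicator) measurable
    finally show ?thesis .
  qed
  have tail: "emeasure ?M (A \<inter> X (2 * C * real j)) \<le> ennreal ((1 / 2) ^ j) * emeasure ?M A" for j
  proof (induction j)
    case 0
    show ?case by (auto intro!: emeasure_mono)
  next
    case (Suc j)
    let ?t = "2 * C * real j"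
    have "ennreal (2 * C) * emeasure ?M (A \<inter> X (2 * C * real (Suc j)))
        = (\<integral>\<^sup>+\<omega>. ennreal (2 * C) * indicator (A \<inter> X (2 * C * real (Suc j))) \<omega> \<partial>?M)"
      by (simp add: nn_integral_cmult_indicator)
    also have "\<dots> \<le> (\<integral>\<^sup>+\<omega>. indicator A \<omega> * e2ennreal (incr n \<omega> - ereal ?t) \<partial>?M)"
    proof (intro nn_integral_mono)
      fix \<omega>
      show "ennreal (2 * C) * indicator (A \<inter> X (2 * C * real (Suc j))) \<omega>
          \<le> indicator A \<omega> * e2ennreal (incr n \<omega> - ereal ?t)"
      proof (cases "\<omega> \<in> A \<inter> X (2 * C * real (Suc j))")
        case True
        then have "ereal (2 * C) \<le> incr n \<omega> - ereal ?t"
          by (cases "incr n \<omega>") (auto simp: X_def algebra_simps)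
        then have "e2ennreal (ereal (2 * C)) \<le> e2ennreal (incr n \<omega> - ereal ?t)" by (rule e2ennreal_mono)
        then show ?thesis using True by (simp add: e2ennreal_ereal)
      qed simp
    qed
    also have "\<dots> \<le> ennreal C * emeasure ?M (A \<inter> X ?t)" using C by (intro excess) auto
    also have "\<dots> \<le> ennreal C * (ennreal ((1 / 2) ^ j) * emeasure ?M A)"
      using Suc by (intro mult_left_mono) auto
    finally have "2 * C * M.prob (A \<inter> X (2 * C * real (Suc j))) \<le> C * ((1 / 2) ^ j * M.prob A)"
      using C by (simp add: M.emeasure_eq_measure ennreal_le_iff flip: ennreal_mult)
    then have "M.prob (A \<inter> X (2 * C * real (Suc j))) \<le> (1 / 2) ^ Suc j * M.prob A"
      using C by (simp add: field_simps)
    then show ?case by (simp add: M.emeasure_eq_measure ennreal_leI flip: ennreal_mult)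
  qed
  have "(\<integral>\<^sup>+\<omega>. indicator A \<omega> * e2ennreal (incr n \<omega> - ereal (2 * C * real j)) \<partial>?M)
      \<le> ennreal C * emeasure ?M (A \<inter> X (2 * C * real j))" using C by (intro excess) auto
  also have "\<dots> \<le> ennreal C * (ennreal ((1 / 2) ^ j) * emeasure ?M A)"
    using tail by (intro mult_left_mono) auto
  also have "\<dots> = ennreal (C * (1 / 2) ^ j) * emeasure ?M A"
    using C by (simp add: ennreal_mult mult.assoc)
  finally show ?thesis .
qed

end

context pm_cusum
begin

subsection \<open>The regret of the fixed-share mixture\<close>

lemma switching_cost_nonneg: "0 \<le> ln (card W / \<alpha>)"
proof -
  have "1 \<le> real (card W)" using card_W by simp
  then have "1 \<le> card W / \<alpha>" using \<alpha> by (simp add: field_simps)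
  then show ?thesis by simp
qed

text \<open>
  A step with window \<open>w\<close> raises the log-weight of \<open>w\<close> by at least the log-ratio of its density to the
  mixture, up to \<open>ln (1 - \<alpha>)\<close>.  This telescopes while the window is kept.  A change of window is paid
  for by the floor \<open>\<alpha> / card W\<close> under all weights; \<open>c\<close> counts the windows used so far.
\<close>
lemma fixed_share_regret:
  assumes \<omega>: "\<omega> \<in> obs_space \<mu>" and n0: "1 \<le> n0" "n0 \<le> M"
    and w: "\<And>i. w i \<in> W" and c: "1 \<le> c n0"
    and switch: "\<And>i. n0 \<le> i \<Longrightarrow> w (Suc i) = w i \<and> c (Suc i) = c i \<or> c i < (c (Suc i) :: nat)"
    and pos: "\<And>i. n0 \<le> i \<Longrightarrow> i \<le> M \<Longrightarrow> 0 < window_pred phat (w i) i \<omega> (\<omega> i)"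
  shows "(\<Sum>i\<in>{n0..M}. ln (window_pred phat (w i) i \<omega> (\<omega> i)) - ln (mix i \<omega> (\<omega> i)) + ln (1 - \<alpha>))
    \<le> ln (card W / \<alpha>) * c M + ln (weight \<omega> (Suc M) (w M))"
proof -
  define \<kappa> where "\<kappa> = ln (card W / \<alpha>)"
  have floor: "- \<kappa> \<le> ln (weight \<omega> n v)" if "v \<in> W" for n v
  proof -
    have "- \<kappa> = ln (\<alpha> / card W)" using \<alpha> card_W by (simp add: \<kappa>_def ln_div)
    also have "\<dots> \<le> ln (weight \<omega> n v)"
      using weight_ge[OF \<omega> that, of n] weight_pos[OF \<omega> that, of n] \<alpha> card_W by (subst ln_le_cancel_iff) auto
    finally show ?thesis .
  qed
  have ln_weight: "ln (weight \<omega> n v) \<le> 0" if "v \<in> W" for n v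
    using weight_le_one[OF \<omega> that, of n] weight_pos[OF \<omega> that, of n] by simp
  have gain: "ln (window_pred phat (w i) i \<omega> (\<omega> i)) - ln (mix i \<omega> (\<omega> i)) + ln (1 - \<alpha>)
      \<le> ln (weight \<omega> (Suc i) (w i)) - ln (weight \<omega> i (w i))"
    if i: "n0 \<le> i" and v: "0 < window_pred phat (w i) i \<omega> (\<omega> i)" for i
  proof -
    have i1: "1 \<le> i" using i n0 by simp
    have wt: "0 < weight \<omega> i (w i)" by (rule weight_pos[OF \<omega> w])
    have "0 < weight \<omega> i (w i) * window_pred phat (w i) i \<omega> (\<omega> i)" using wt v by simp
    also have "\<dots> \<le> mix i \<omega> (\<omega> i)" by (rule mix_ge[OF \<omega> w coordinate_in_space[OF \<omega> i1]])
    finally have m: "0 < mix i \<omega> (\<omega> i)" .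
    have "ln ((1 - \<alpha>) * (weight \<omega> i (w i) * window_pred phat (w i) i \<omega> (\<omega> i) / mix i \<omega> (\<omega> i)))
        \<le> ln (weight \<omega> (Suc i) (w i))"
      using weight_Suc_ge[OF \<omega> w i1 m] weight_pos[OF \<omega> w, of "Suc i"] wt v m \<alpha>
      by (subst ln_le_cancel_iff) auto
    then show ?thesis
      using wt v m \<alpha> by (simp add: ln_mult ln_div)
  qed
  have \<kappa>: "0 \<le> \<kappa>" using switching_cost_nonneg by (simp add: \<kappa>_def)
  show ?thesis
    using n0(2) pos unfolding \<kappa>_def[symmetric]
  proof (induction M rule: dec_induct)
    case base
    have "\<kappa> \<le> \<kappa> * c n0" using \<kappa> c mult_left_mono[of 1 "real (c n0)" \<kappa>] by simp
    then show ?case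
      using gain[OF order_refl base(1)] floor[OF w, of n0 n0] by (simp del: fixed_share.simps)
  next
    case (step M)
    have IH: "(\<Sum>i\<in>{n0..M}. ln (window_pred phat (w i) i \<omega> (\<omega> i)) - ln (mix i \<omega> (\<omega> i)) + ln (1 - \<alpha>))
        \<le> \<kappa> * c M + ln (weight \<omega> (Suc M) (w M))"
      by (rule step.IH) (use step.prems in auto)
    have new: "ln (window_pred phat (w (Suc M)) (Suc M) \<omega> (\<omega> (Suc M))) - ln (mix (Suc M) \<omega> (\<omega> (Suc M))) + ln (1 - \<alpha>)
        \<le> ln (weight \<omega> (Suc (Suc M)) (w (Suc M))) - ln (weight \<omega> (Suc M) (w (Suc M)))"
      using step.hyps step.prems by (intro gain) auto
    have "\<kappa> * c M + ln (weight \<omega> (Suc M) (w M)) - ln (weight \<omega> (Suc M) (w (Suc M))) \<le> \<kappa> * c (Suc M)"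
      using switch[OF step.hyps(1)]
    proof
      assume less: "c M < c (Suc M)"
      then have "\<kappa> * (real (c M) + 1) \<le> \<kappa> * real (c (Suc M))" using \<kappa> by (intro mult_left_mono) auto
      then show ?thesis
        using floor[OF w, of "Suc M" "Suc M"] ln_weight[OF w, of "Suc M" M] by (simp add: distrib_left del: fixed_share.simps)
    qed (simp del: fixed_share.simps)
    then show ?case
      using IH new step.hyps by (simp add: sum.cl_ivl_Suc del: fixed_share.simps)
  qed
qed

text \<open>
  Clipping the statistic at zero can only increase it, so restarting the sum at \<open>n0\<close> gives less.
\<close>
lemma sum_incr_le_stat:
  assumes "n0 \<le> Suc n" and "\<And>i. n0 \<le> i \<Longrightarrow> i \<le> n \<Longrightarrow> incr i \<omega> = ereal (r i)" and "1 \<le> n0"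
  shows "ereal (\<Sum>i\<in>{n0..n}. r i) \<le> max (stat n \<omega>) 0"
  using assms
proof (induction n)
  case 0
  then show ?case by simp
next
  case (Suc n)
  show ?case
  proof (cases "n0 = Suc (Suc n)")
    case True
    then show ?thesis by (simp add: zero_ereal_def[symmetric])
  next
    case False
    then have le: "n0 \<le> Suc n" using Suc.prems by simp
    have "ereal (\<Sum>i\<in>{n0..Suc n}. r i) = ereal (\<Sum>i\<in>{n0..n}. r i) + ereal (r (Suc n))"
      using le by (simp add: sum.cl_ivl_Suc)
    also have "\<dots> \<le> max (stat n \<omega>) 0 + ereal (r (Suc n))"
      using Suc.IH[OF le] Suc.prems by (intro add_right_mono) auto
    also have "\<dots> = stat (Suc n) \<omega>" using Suc.prems le by simp
    finally show ?thesis by (simp only: le_max_iff_disj simp_thms)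
  qed
qed

text \<open>Only the last increment can carry the statistic above the threshold.\<close>
lemma sum_incr_until_stop:
  assumes n0: "2 \<le> n0" "n0 \<le> M" and stop: "enat M \<le> stop b \<omega>" and b: "0 \<le> b"
    and r: "\<And>i. n0 \<le> i \<Longrightarrow> i \<le> M \<Longrightarrow> incr i \<omega> = ereal (r i)"
  shows "(\<Sum>i\<in>{n0..M}. r i) \<le> b + r M"
proof -
  have "ereal (\<Sum>i\<in>{n0..M - 1}. r i) \<le> max (stat (M - 1) \<omega>) 0"
    using n0 by (intro sum_incr_le_stat r) auto
  also have "\<dots> \<le> ereal b"
    using stop_ge_imp[OF stop, of "M - 1"] n0 b by auto
  finally have "(\<Sum>i\<in>{n0..M - 1}. r i) \<le> b" by simp
  moreover have "{n0..M} = insert M {n0..M - 1}" using n0 by auto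
  ultimately show ?thesis using n0 by simp
qed

end

subsection \<open>The delay bound\<close>

context pm_cusum_KL
begin

text \<open>
  The window in use \<open>j\<close> steps after the change is the largest power of two up to \<open>j\<close> that is
  available.  The first two steps, in which every window reaches back before the change, are
  given away.
\<close>
definition window_at :: "nat \<Rightarrow> nat \<Rightarrow> nat" where
  "window_at R j = 2 ^ min R (floor_log j)"

lemma window_at_le: "1 \<le> j \<Longrightarrow> window_at R j \<le> j"
proof -
  assume "1 \<le> j"
  then have "2 ^ floor_log j \<le> j" by (intro floor_log_exp2_le) auto
  moreover have "(2::nat) ^ min R (floor_log j) \<le> 2 ^ floor_log j" by (intro power_increasing) auto
  ultimately show ?thesis unfolding window_at_def by linarith
qed

lemma window_at_cases:
  assumes "1 \<le> j"
  shows "j \<le> 2 ^ R \<and> real j / 2 \<le> window_at R j \<or> 2 ^ R \<le> j \<and> window_at R j = 2 ^ R"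
proof (cases "R \<le> floor_log j")
  case True
  then have "(2::nat) ^ R \<le> 2 ^ floor_log j" by (intro power_increasing) auto
  also have "\<dots> \<le> j" using assms by (intro floor_log_exp2_le) auto
  finally show ?thesis using True by (simp add: window_at_def)
next
  case False
  have gt: "j < 2 * 2 ^ floor_log j" by (rule floor_log_exp2_gt)
  have "(2::nat) ^ Suc (floor_log j) \<le> 2 ^ R" using False by (intro power_increasing) auto
  then have "j \<le> 2 ^ R" using gt by simp
  moreover have "real j \<le> 2 * real (window_at R j)"
    using gt False by (simp add: window_at_def min_def flip: of_nat_power of_nat_mult)
  ultimately show ?thesis by simp
qed

text \<open>
  The pathwise inequality behind the delay bound: after the change the log-likelihood ratio
  collected until the stopping time is at most the threshold plus the overshoot, plus what the mixture
  loses against the chosen windows, plus what these lose against the true density.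
\<close>
lemma pathwise_bound:
  assumes \<omega>: "\<omega> \<in> obs_space \<mu>" and \<nu>: "1 \<le> \<nu>" and R: "1 \<le> R" and W_eq: "W = (\<lambda>r. 2 ^ r) ` {1..R}"
    and b: "0 \<le> b" and c: "0 \<le> c"
    and pq: "\<And>i. \<nu> \<le> i \<Longrightarrow> 0 < p (\<omega> i) \<and> 0 < q (\<omega> i)"
    and v: "\<And>j. 2 \<le> j \<Longrightarrow> 0 < window_pred phat (window_at R j) (\<nu> + j) \<omega> (\<omega> (\<nu> + j))"
  shows "(\<Sum>j\<in>{j\<in>{2..N}. enat (\<nu> + j) \<le> stop b \<omega>}.
      llr (\<omega> (\<nu> + j)) - loss (window_at R j) (\<nu> + j) \<omega> + ln (1 - \<alpha>)
        - enn2real (e2ennreal (incr (\<nu> + j) \<omega> - ereal c)))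
    \<le> b + c + ln (card W / \<alpha>) * R"
proof -
  define I where "I = {j\<in>{2..N}. enat (\<nu> + j) \<le> stop b \<omega>}"
  define \<kappa> where "\<kappa> = ln (card W / \<alpha>)"
  define ex where "ex i = enn2real (e2ennreal (incr i \<omega> - ereal c))" for i
  have \<kappa>: "0 \<le> \<kappa>" using switching_cost_nonneg by (simp add: \<kappa>_def)
  have fin: "finite I" by (simp add: I_def)
  show ?thesis
  proof (cases "I = {}")
    case True
    then show ?thesis using b c \<kappa> unfolding I_def[symmetric] \<kappa>_def[symmetric] by simp
  next
    case False
    define M where "M = Max I"
    have M: "M \<in> I" using False fin by (simp add: M_def)
    have I_eq: "I = {2..M}"
    proof
      show "I \<subseteq> {2..M}" using fin by (auto simp: M_def I_def)
      show "{2..M} \<subseteq> I"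
      proof
        fix j assume j: "j \<in> {2..M}"
        then have "enat (\<nu> + j) \<le> enat (\<nu> + M)" by simp
        also have "\<dots> \<le> stop b \<omega>" using M by (simp add: I_def)
        finally show "j \<in> I" using j M by (auto simp: I_def)
      qed
    qed
    have M2: "2 \<le> M" using M by (simp add: I_def)
    define w where "w i = (if \<nu> + 2 \<le> i then window_at R (i - \<nu>) else 2)" for i
    define cnt where "cnt i = min R (floor_log (i - \<nu>))" for i
    have fl2: "floor_log 2 = 1" by (simp add: floor_log_rec)
    have cnt1: "1 \<le> cnt i" if "\<nu> + 2 \<le> i" for i
      using floor_log_mono[THEN monoD, of 2 "i - \<nu>"] that R by (simp add: cnt_def fl2)
    have w_W: "w i \<in> W" for i
    proof (cases "\<nu> + 2 \<le> i")
      case True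
      then show ?thesis using cnt1[OF True] unfolding W_eq w_def window_at_def cnt_def by auto
    next
      case False
      then show ?thesis unfolding W_eq w_def using R by (auto intro!: image_eqI[of _ _ 1])
    qed
    define r where "r i = ln (mix i \<omega> (\<omega> i)) - ln (q (\<omega> i))" for i
    have mix_pos: "0 < mix i \<omega> (\<omega> i)" and v_pos: "0 < window_pred phat (w i) i \<omega> (\<omega> i)" if i: "\<nu> + 2 \<le> i" for i
    proof -
      have i1: "1 \<le> i" using i by simp
      show v': "0 < window_pred phat (w i) i \<omega> (\<omega> i)"
        using v[of "i - \<nu>"] i by (simp add: w_def)
      have "0 < weight \<omega> i (w i) * window_pred phat (w i) i \<omega> (\<omega> i)"
        using weight_pos[OF \<omega> w_W] v' by simp
      also have "\<dots> \<le> mix i \<omega> (\<omega> i)" by (rule mix_ge[OF \<omega> w_W coordinate_in_space[OF \<omega> i1]])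
      finally show "0 < mix i \<omega> (\<omega> i)" .
    qed
    have incr: "incr i \<omega> = ereal (r i)" if i: "\<nu> + 2 \<le> i" for i
      using mix_pos[OF i] pq[of i] i by (simp add: log_lik_def log_ratio_pos r_def ln_div)
    have ex_nonneg: "0 \<le> ex i" for i by (simp add: ex_def)
    have ex_ge: "r i - c \<le> ex i" if i: "\<nu> + 2 \<le> i" for i
      using incr[OF i] by (cases "0 \<le> r i - c") (auto simp: ex_def e2ennreal_ereal intro: order_trans[OF _ enn2real_nonneg])
    have "(\<Sum>i\<in>{\<nu> + 2..\<nu> + M}. ln (window_pred phat (w i) i \<omega> (\<omega> i)) - ln (mix i \<omega> (\<omega> i)) + ln (1 - \<alpha>))
        \<le> \<kappa> * cnt (\<nu> + M) + ln (weight \<omega> (Suc (\<nu> + M)) (w (\<nu> + M)))"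
      unfolding \<kappa>_def
    proof (rule fixed_share_regret[OF \<omega>])
      fix i assume i: "\<nu> + 2 \<le> i"
      have "cnt i \<le> cnt (Suc i)"
        unfolding cnt_def using floor_log_mono[THEN monoD, of "i - \<nu>" "Suc i - \<nu>"] by (simp add: min_le_iff_disj)
      then show "w (Suc i) = w i \<and> cnt (Suc i) = cnt i \<or> cnt i < cnt (Suc i)"
        using i by (auto simp: w_def window_at_def cnt_def)
    qed (use \<nu> M2 w_W cnt1 v_pos in auto)
    also have "\<dots> \<le> \<kappa> * R"
    proof -
      have "ln (weight \<omega> (Suc (\<nu> + M)) (w (\<nu> + M))) \<le> 0"
        using weight_le_one[OF \<omega> w_W] weight_pos[OF \<omega> w_W] by (simp del: fixed_share.simps)
      moreover have "\<kappa> * cnt (\<nu> + M) \<le> \<kappa> * R" using \<kappa> by (intro mult_left_mono) (auto simp: cnt_def)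
      ultimately show ?thesis by linarith
    qed
    finally have regret: "(\<Sum>i\<in>{\<nu> + 2..\<nu> + M}. ln (window_pred phat (w i) i \<omega> (\<omega> i)) - ln (mix i \<omega> (\<omega> i)) + ln (1 - \<alpha>)) \<le> \<kappa> * R" .
    have "(\<Sum>i\<in>{\<nu> + 2..\<nu> + M}. r i) \<le> b + r (\<nu> + M)"
      using \<nu> M2 M b incr by (intro sum_incr_until_stop) (auto simp: I_def)
    also have "r (\<nu> + M) \<le> c + ex (\<nu> + M)" using ex_ge[of "\<nu> + M"] M2 by simp
    also have "ex (\<nu> + M) \<le> (\<Sum>i\<in>{\<nu> + 2..\<nu> + M}. ex i)"
      using M2 ex_nonneg by (intro member_le_sum) auto
    finally have drift: "(\<Sum>i\<in>{\<nu> + 2..\<nu> + M}. r i) \<le> b + c + (\<Sum>i\<in>{\<nu> + 2..\<nu> + M}. ex i)" by simp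
    have "(\<Sum>j\<in>I. llr (\<omega> (\<nu> + j)) - loss (window_at R j) (\<nu> + j) \<omega> + ln (1 - \<alpha>) - ex (\<nu> + j))
        = (\<Sum>i\<in>{\<nu> + 2..\<nu> + M}. llr (\<omega> i) - loss (w i) i \<omega> + ln (1 - \<alpha>) - ex i)"
      unfolding I_eq
      by (rule sum.reindex_bij_witness[of _ "\<lambda>i. i - \<nu>" "\<lambda>j. \<nu> + j"]) (auto simp: w_def)
    also have "\<dots> = (\<Sum>i\<in>{\<nu> + 2..\<nu> + M}.
        (ln (window_pred phat (w i) i \<omega> (\<omega> i)) - ln (mix i \<omega> (\<omega> i)) + ln (1 - \<alpha>)) + r i - ex i)"
    proof (intro sum.cong refl)
      fix i assume i: "i \<in> {\<nu> + 2..\<nu> + M}"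
      then show "llr (\<omega> i) - loss (w i) i \<omega> + ln (1 - \<alpha>) - ex i
          = (ln (window_pred phat (w i) i \<omega> (\<omega> i)) - ln (mix i \<omega> (\<omega> i)) + ln (1 - \<alpha>)) + r i - ex i"
        using pq[of i] v_pos[of i] by (simp add: llr_def loss_def r_def ln_div)
    qed
    also have "\<dots> = (\<Sum>i\<in>{\<nu> + 2..\<nu> + M}. ln (window_pred phat (w i) i \<omega> (\<omega> i)) - ln (mix i \<omega> (\<omega> i)) + ln (1 - \<alpha>))
        + (\<Sum>i\<in>{\<nu> + 2..\<nu> + M}. r i) - (\<Sum>i\<in>{\<nu> + 2..\<nu> + M}. ex i)"
      by (simp add: sum.distrib sum_subtractf)
    also have "\<dots> \<le> b + c + \<kappa> * R" using regret drift by linarith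
    finally show ?thesis unfolding I_def \<kappa>_def ex_def .
  qed
qed

end

context pm_cusum_KL
begin

text \<open>
  The losses add up to a harmonic sum while the window grows.  Once it has its full length
  \<open>2 ^ R\<close>, the loss at step \<open>j\<close> is charged to the event of still running \<open>2 ^ R\<close> steps before.
\<close>
lemma sum_window_loss_le:
  fixes a :: "nat \<Rightarrow> real"
  assumes a: "\<And>j. 0 \<le> a j" "\<And>j. a j \<le> A" and C1: "0 \<le> C1" and \<beta>: "0 < \<beta>"
  shows "(\<Sum>j\<in>{2..N}. a (j - window_at R j) * (C1 / real (window_at R j) powr \<beta>))
    \<le> A * C1 * 2 powr \<beta> * (\<Sum>j\<in>{1..2 ^ R}. 1 / real j powr \<beta>)
      + C1 / (2 ^ R) powr \<beta> * (2 * A + (\<Sum>j\<in>{2..N}. a j))"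
proof -
  have A: "0 \<le> A" using a[of 0] by linarith
  let ?h = "\<lambda>j. A * C1 * 2 powr \<beta> * (1 / real j powr \<beta>)"
  let ?k = "\<lambda>j. C1 / (2 ^ R) powr \<beta> * a (j - 2 ^ R)"
  have "a (j - window_at R j) * (C1 / real (window_at R j) powr \<beta>)
      \<le> (if j \<le> 2 ^ R then ?h j else 0) + (if 2 ^ R \<le> j then ?k j else 0)" if j: "j \<in> {2..N}" for j
  proof -
    have j1: "1 \<le> j" using j by simp
    have h: "0 \<le> ?h j" and k: "0 \<le> ?k j" using A C1 a by simp_all
    from window_at_cases[OF j1, of R] show ?thesis
    proof
      assume *: "j \<le> 2 ^ R \<and> real j / 2 \<le> real (window_at R j)"
      have "(real j / 2) powr \<beta> \<le> real (window_at R j) powr \<beta>"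
        using * \<beta> by (intro powr_mono2) auto
      then have "C1 / real (window_at R j) powr \<beta> \<le> C1 / (real j / 2) powr \<beta>"
        using C1 j1 by (intro divide_left_mono mult_pos_pos) (auto simp: window_at_def)
      also have "\<dots> = C1 * 2 powr \<beta> * (1 / real j powr \<beta>)"
        by (simp add: powr_divide)
      finally have "a (j - window_at R j) * (C1 / real (window_at R j) powr \<beta>) \<le> A * (C1 * 2 powr \<beta> * (1 / real j powr \<beta>))"
        using a A C1 by (intro mult_mono) auto
      then show ?thesis using * k by (auto simp: mult.assoc)
    next
      assume *: "2 ^ R \<le> j \<and> window_at R j = 2 ^ R"
      then show ?thesis using h by (simp add: mult.commute)
    qed
  qed
  then have "(\<Sum>j\<in>{2..N}. a (j - window_at R j) * (C1 / real (window_at R j) powr \<beta>))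
      \<le> (\<Sum>j\<in>{2..N}. (if j \<le> 2 ^ R then ?h j else 0) + (if 2 ^ R \<le> j then ?k j else 0))"
    by (rule sum_mono)
  also have "\<dots> = (\<Sum>j\<in>{j\<in>{2..N}. j \<le> 2 ^ R}. ?h j) + (\<Sum>j\<in>{j\<in>{2..N}. 2 ^ R \<le> j}. ?k j)"
    by (simp only: sum.distrib sum.inter_filter finite_atLeastAtMost)
  also have "(\<Sum>j\<in>{j\<in>{2..N}. j \<le> 2 ^ R}. ?h j) \<le> (\<Sum>j\<in>{1..2 ^ R}. ?h j)"
    using A C1 by (intro sum_mono2) auto
  also have "(\<Sum>j\<in>{1..2 ^ R}. ?h j) = A * C1 * 2 powr \<beta> * (\<Sum>j\<in>{1..2 ^ R}. 1 / real j powr \<beta>)"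
    by (simp add: sum_distrib_left)
  also have "(\<Sum>j\<in>{j\<in>{2..N}. 2 ^ R \<le> j}. ?k j) \<le> C1 / (2 ^ R) powr \<beta> * (2 * A + (\<Sum>j\<in>{2..N}. a j))"
  proof -
    have "(\<Sum>j\<in>{j\<in>{2..N}. 2 ^ R \<le> j}. a (j - 2 ^ R)) = (\<Sum>j\<in>(\<lambda>j. j - 2 ^ R) ` {j\<in>{2..N}. 2 ^ R \<le> j}. a j)"
      by (subst sum.reindex) (auto intro!: inj_onI)
    also have "\<dots> \<le> (\<Sum>j\<in>{0, 1} \<union> {2..N}. a j)"
      using a by (intro sum_mono2) auto
    also have "\<dots> \<le> 2 * A + (\<Sum>j\<in>{2..N}. a j)"
      using a(2)[of 0] a(2)[of 1] by (subst sum.union_disjoint) auto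
    finally have "C1 / (2 ^ R) powr \<beta> * (\<Sum>j\<in>{j\<in>{2..N}. 2 ^ R \<le> j}. a (j - 2 ^ R)) \<le> C1 / (2 ^ R) powr \<beta> * (2 * A + (\<Sum>j\<in>{2..N}. a j))"
      using C1 by (intro mult_left_mono) auto
    then show ?thesis by (simp add: sum_distrib_left)
  qed
  finally show ?thesis by simp
qed

text \<open>
  The pathwise inequality is integrated over an event \<open>A\<close> of the time before the change.  Each term is
  weighted by the indicator of still running, an event of the past of its own step.  The costs
  that are proportional to the sum of the \<open>a j\<close>, the delay cut off at \<open>N\<close>, are moved to the left, which
  is possible because this sum is finite; there they lower \<open>D\<close>.
\<close>
lemma expected_delay_le:
  assumes \<nu>: "1 \<le> \<nu>" and A: "A \<in> sets (past \<mu> (\<nu> - 1))"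
    and R: "1 \<le> R" and W_eq: "W = (\<lambda>r. 2 ^ r) ` {1..R}" and b: "0 \<le> b"
    and C1: "0 \<le> C1" and \<beta>: "0 < \<beta>" and C: "0 < C"
    and KL: "\<And>w n. 1 \<le> w \<Longrightarrow> w < n \<Longrightarrow> ext_expectation (law \<mu> q p 1)
        (\<lambda>\<omega>. log_ratio (p (\<omega> n)) (window_pred phat w n \<omega> (\<omega> n))) \<le> ereal (C1 / real w powr \<beta>)"
    and over: "\<And>n. 1 \<le> n \<Longrightarrow> mean_excess_le (law \<mu> q p \<nu>) (past \<mu> (n - 1)) (incr n) C"
  defines "a \<equiv> \<lambda>j. measure (law \<mu> q p \<nu>) (A \<inter> {\<omega> \<in> obs_space \<mu>. enat (\<nu> + j) \<le> stop b \<omega>})"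
  shows "(\<Sum>j\<in>{2..N}. a j) * (D - C * (1 / 2) ^ J + ln (1 - \<alpha>) - C1 / (2 ^ R) powr \<beta>)
    \<le> measure (law \<mu> q p \<nu>) A * (b + 2 * C * J + ln (card W / \<alpha>) * R
        + C1 * 2 powr \<beta> * (\<Sum>j\<in>{1..2 ^ R}. 1 / real j powr \<beta>) + 2 * C1 / (2 ^ R) powr \<beta>)"
proof -
  let ?M = "law \<mu> q p \<nu>"
  interpret M: prob_space ?M by (rule post.prob_L)
  define c where "c = 2 * C * real J"
  define B where "B j = A \<inter> {\<omega> \<in> obs_space \<mu>. enat (\<nu> + j) \<le> stop b \<omega>}" for j
  have a_eq: "a j = M.prob (B j)" for j by (simp add: a_def B_def)
  have B_past: "B j \<in> sets (past \<mu> (\<nu> + j - 1))" for j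
  proof -
    have "A \<in> sets (past \<mu> (\<nu> + j - 1))"
      using A by (rule subsetD[OF sets_past_mono, rotated]) simp
    then show ?thesis
      unfolding B_def using \<nu> stopping_time_events(3)[OF stopping_time_stop, of "\<nu> + j" b] by auto
  qed
  have B_M: "B j \<in> sets ?M" for j using B_past by (rule post.past_sets_L)
  have A_M: "A \<in> sets ?M" using A by (rule post.past_sets_L)
  have B_mono: "B j \<subseteq> B k" if "k \<le> j" for j k
  proof -
    have "enat (\<nu> + k) \<le> enat (\<nu> + j)" using that by simp
    then show ?thesis unfolding B_def by (blast intro: order_trans)
  qed
  have a_nonneg: "0 \<le> a j" for j by (simp add: a_eq)
  have a_le: "a j \<le> M.prob A" for j
    unfolding a_eq using A_M by (intro M.finite_measure_mono) (auto simp: B_def)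
  let ?w = "\<lambda>j. window_at R j"
  have w1: "1 \<le> ?w j" for j by (simp add: window_at_def)
  define ex where "ex i \<omega> = enn2real (e2ennreal (incr i \<omega> - ereal c))" for i \<omega>
  have llr_int: "integrable ?M (\<lambda>\<omega>. indicator (B j) \<omega> * llr (\<omega> (\<nu> + j)))"
    and llr_mean: "(\<integral>\<omega>. indicator (B j) \<omega> * llr (\<omega> (\<nu> + j)) \<partial>?M) = a j * D" for j
    unfolding a_eq using \<nu> by (intro integral_llr_past_event B_past; simp)+
  have loss: "AE \<omega> in ?M. 0 < window_pred phat (?w j) (\<nu> + j) \<omega> (\<omega> (\<nu> + j))"
    "integrable ?M (\<lambda>\<omega>. indicator (B j) \<omega> * loss (?w j) (\<nu> + j) \<omega>)"
    "(\<integral>\<omega>. indicator (B j) \<omega> * loss (?w j) (\<nu> + j) \<omega> \<partial>?M) \<le> a (j - ?w j) * (C1 / real (?w j) powr \<beta>)"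
    if j: "1 \<le> j" for j
  proof -
    have le: "?w j \<le> j" by (rule window_at_le[OF j])
    have KLj: "ext_expectation (law \<mu> q p 1)
        (\<lambda>\<omega>. log_ratio (p (\<omega> (\<nu> + j))) (window_pred phat (?w j) (\<nu> + j) \<omega> (\<omega> (\<nu> + j)))) \<le> ereal (C1 / real (?w j) powr \<beta>)"
      using \<nu> le by (intro KL w1) auto
    have Bj: "B (j - ?w j) \<in> sets (past \<mu> (\<nu> + j - ?w j - 1))"
      using B_past[of "j - ?w j"] le by simp
    note * = expected_loss_le[OF w1 \<nu> _ KLj Bj B_past B_mono]
    show "AE \<omega> in ?M. 0 < window_pred phat (?w j) (\<nu> + j) \<omega> (\<omega> (\<nu> + j))"
      "integrable ?M (\<lambda>\<omega>. indicator (B j) \<omega> * loss (?w j) (\<nu> + j) \<omega>)"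
      "(\<integral>\<omega>. indicator (B j) \<omega> * loss (?w j) (\<nu> + j) \<omega> \<partial>?M) \<le> a (j - ?w j) * (C1 / real (?w j) powr \<beta>)"
      unfolding a_eq using le by (intro *; simp)+
  qed
  have ex: "integrable ?M (\<lambda>\<omega>. indicator (B j) \<omega> * ex (\<nu> + j) \<omega>)"
    "(\<integral>\<omega>. indicator (B j) \<omega> * ex (\<nu> + j) \<omega> \<partial>?M) \<le> C * (1 / 2) ^ J * a j" for j
  proof -
    let ?f = "\<lambda>\<omega>. indicator (B j) \<omega> * ex (\<nu> + j) \<omega>"
    have i: "1 \<le> \<nu> + j" using \<nu> by simp
    have [measurable]: "incr (\<nu> + j) \<in> borel_measurable ?M"
      by (rule post.past_measurable_L[OF incr_measurable[OF i]])
    have meas: "?f \<in> borel_measurable ?M"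
      unfolding ex_def using B_M by measurable
    have nn: "0 \<le> ?f \<omega>" for \<omega> by (simp add: ex_def)
    have "(\<integral>\<^sup>+\<omega>. ennreal (?f \<omega>) \<partial>?M) \<le> (\<integral>\<^sup>+\<omega>. indicator (B j) \<omega> * e2ennreal (incr (\<nu> + j) \<omega> - ereal c) \<partial>?M)"
      by (intro nn_integral_mono) (auto simp: indicator_def ex_def ennreal_enn2real_if)
    also have "\<dots> \<le> ennreal (C * (1 / 2) ^ J) * emeasure ?M (B j)"
      unfolding c_def by (intro overshoot_tail C i B_past over)
    also have "\<dots> = ennreal (C * (1 / 2) ^ J * a j)"
      using C by (simp add: M.emeasure_eq_measure a_eq ennreal_mult)
    finally have le: "(\<integral>\<^sup>+\<omega>. ennreal (?f \<omega>) \<partial>?M) \<le> ennreal (C * (1 / 2) ^ J * a j)" .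
    show "integrable ?M ?f" "(\<integral>\<omega>. ?f \<omega> \<partial>?M) \<le> C * (1 / 2) ^ J * a j"
      using nn C a_nonneg by (intro integral_le_of_nn_integral_le[OF meas _ le]; simp)+
  qed
  have ind_int: "integrable ?M (indicat_real (B j))" for j
    using B_M M.emeasure_finite by (intro integrable_real_indicator) (auto simp: less_top[symmetric])
  have ind_mean: "(\<integral>\<omega>. indicat_real (B j) \<omega> \<partial>?M) = a j" for j
    using sets.sets_into_space[OF B_M[of j]] by (simp add: a_eq Int_absorb2)
  define Z where "Z j \<omega> = indicator (B j) \<omega> * llr (\<omega> (\<nu> + j)) - indicator (B j) \<omega> * loss (?w j) (\<nu> + j) \<omega>
      + indicator (B j) \<omega> * ln (1 - \<alpha>) - indicator (B j) \<omega> * ex (\<nu> + j) \<omega>" for j \<omega>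
  have Z_int: "integrable ?M (Z j)" if "1 \<le> j" for j
    unfolding Z_def
    by (intro Bochner_Integration.integrable_diff Bochner_Integration.integrable_add llr_int loss(2)[OF that]
          ex(1) integrable_mult_left ind_int)
  have Z_mean: "a j * (D - C * (1 / 2) ^ J + ln (1 - \<alpha>)) - a (j - ?w j) * (C1 / real (?w j) powr \<beta>)
      \<le> (\<integral>\<omega>. Z j \<omega> \<partial>?M)" if "1 \<le> j" for j
  proof -
    have "(\<integral>\<omega>. Z j \<omega> \<partial>?M) = (\<integral>\<omega>. indicator (B j) \<omega> * llr (\<omega> (\<nu> + j)) \<partial>?M)
        - (\<integral>\<omega>. indicator (B j) \<omega> * loss (?w j) (\<nu> + j) \<omega> \<partial>?M) + a j * ln (1 - \<alpha>)
        - (\<integral>\<omega>. indicator (B j) \<omega> * ex (\<nu> + j) \<omega> \<partial>?M)"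
    proof -
      have const: "(\<integral>\<omega>. indicat_real (B j) \<omega> * ln (1 - \<alpha>) \<partial>?M) = a j * ln (1 - \<alpha>)"
        by (simp only: Bochner_Integration.integral_mult_left_zero ind_mean)
      show ?thesis
        unfolding Z_def const[symmetric] using llr_int[of j] loss(2)[OF that] ex(1)[of j] ind_int[of j]
      by (simp only: Bochner_Integration.integral_diff Bochner_Integration.integral_add
            Bochner_Integration.integrable_diff Bochner_Integration.integrable_add integrable_mult_left simp_thms)
    qed
    then show ?thesis
      using llr_mean[of j] loss(3)[OF that] ex(2)[of j] by (simp add: algebra_simps)
  qed
  define Y where "Y = b + c + ln (card W / \<alpha>) * R"
  have "AE \<omega> in ?M. \<forall>j\<ge>2. 0 < window_pred phat (?w j) (\<nu> + j) \<omega> (\<omega> (\<nu> + j))"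
  proof -
    have "AE \<omega> in ?M. 2 \<le> j \<longrightarrow> 0 < window_pred phat (?w j) (\<nu> + j) \<omega> (\<omega> (\<nu> + j))" for j
      using loss(1)[of j] by (cases "2 \<le> j") auto
    then show ?thesis by (simp add: AE_all_countable)
  qed
  then have "AE \<omega> in ?M. (\<Sum>j\<in>{2..N}. Z j \<omega>) \<le> indicator A \<omega> * Y"
    using AE_law_pos[OF \<nu>] AE_space[of ?M]
  proof eventually_elim
    case (elim \<omega>)
    then have \<omega>: "\<omega> \<in> obs_space \<mu>" by simp
    show ?case
    proof (cases "\<omega> \<in> A")
      case True
      have "(\<Sum>j\<in>{2..N}. Z j \<omega>) = (\<Sum>j\<in>{2..N}. if enat (\<nu> + j) \<le> stop b \<omega> then
          llr (\<omega> (\<nu> + j)) - loss (?w j) (\<nu> + j) \<omega> + ln (1 - \<alpha>) - ex (\<nu> + j) \<omega> else 0)"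
        using True \<omega> by (intro sum.cong refl) (auto simp: Z_def B_def)
      also have "\<dots> = (\<Sum>j\<in>{j\<in>{2..N}. enat (\<nu> + j) \<le> stop b \<omega>}.
          llr (\<omega> (\<nu> + j)) - loss (?w j) (\<nu> + j) \<omega> + ln (1 - \<alpha>) - ex (\<nu> + j) \<omega>)"
        by (rule sum.inter_filter[symmetric]) simp
      also have "\<dots> \<le> Y"
        unfolding ex_def Y_def using elim C by (intro pathwise_bound \<omega> \<nu> R W_eq b) (auto simp: c_def)
      finally show ?thesis using True by simp
    next
      case False
      then have "Z j \<omega> = 0" for j by (simp add: Z_def B_def)
      then show ?thesis using False by simp
    qed
  qed
  then have "(\<integral>\<omega>. (\<Sum>j\<in>{2..N}. Z j \<omega>) \<partial>?M) \<le> (\<integral>\<omega>. indicator A \<omega> * Y \<partial>?M)"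
    using A_M M.emeasure_finite
    by (intro integral_mono_AE Bochner_Integration.integrable_sum Z_int integrable_mult_left integrable_real_indicator)
       (auto simp: less_top[symmetric])
  also have "\<dots> = M.prob A * Y"
    using sets.sets_into_space[OF A_M] by (simp add: Int_absorb2)
  also have "(\<integral>\<omega>. (\<Sum>j\<in>{2..N}. Z j \<omega>) \<partial>?M) = (\<Sum>j\<in>{2..N}. \<integral>\<omega>. Z j \<omega> \<partial>?M)"
    by (intro Bochner_Integration.integral_sum Z_int) auto
  finally have up: "(\<Sum>j\<in>{2..N}. \<integral>\<omega>. Z j \<omega> \<partial>?M) \<le> M.prob A * Y" .
  have "(\<Sum>j\<in>{2..N}. a j) * (D - C * (1 / 2) ^ J + ln (1 - \<alpha>))
      - (\<Sum>j\<in>{2..N}. a (j - ?w j) * (C1 / real (?w j) powr \<beta>))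
      = (\<Sum>j\<in>{2..N}. a j * (D - C * (1 / 2) ^ J + ln (1 - \<alpha>)) - a (j - ?w j) * (C1 / real (?w j) powr \<beta>))"
    by (simp add: sum_subtractf sum_distrib_right)
  also have "\<dots> \<le> (\<Sum>j\<in>{2..N}. \<integral>\<omega>. Z j \<omega> \<partial>?M)"
    by (intro sum_mono Z_mean) auto
  also note up
  finally have "(\<Sum>j\<in>{2..N}. a j) * (D - C * (1 / 2) ^ J + ln (1 - \<alpha>))
      \<le> M.prob A * Y + (\<Sum>j\<in>{2..N}. a (j - ?w j) * (C1 / real (?w j) powr \<beta>))" by linarith
  also have "(\<Sum>j\<in>{2..N}. a (j - ?w j) * (C1 / real (?w j) powr \<beta>))
      \<le> M.prob A * C1 * 2 powr \<beta> * (\<Sum>j\<in>{1..2 ^ R}. 1 / real j powr \<beta>)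
        + C1 / (2 ^ R) powr \<beta> * (2 * M.prob A + (\<Sum>j\<in>{2..N}. a j))"
    by (rule sum_window_loss_le[OF a_nonneg a_le C1 \<beta>])
  finally show ?thesis
    unfolding Y_def c_def by (simp add: algebra_simps)
qed

text \<open>
  The mean delay over \<open>A\<close> is the sum of the probabilities of still running; the first two are bounded
  by that of \<open>A\<close>, and the others by the previous lemma, uniformly in the cut-off.
\<close>
theorem lorden_delay_upper_bound:
  assumes R: "1 \<le> R" and W_eq: "W = (\<lambda>r. 2 ^ r) ` {1..R}" and b: "0 \<le> b"
    and C1: "0 \<le> C1" and \<beta>: "0 < \<beta>" and C: "0 < C"
    and KL: "\<And>w n. 1 \<le> w \<Longrightarrow> w < n \<Longrightarrow> ext_expectation (law \<mu> q p 1)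
        (\<lambda>\<omega>. log_ratio (p (\<omega> n)) (window_pred phat w n \<omega> (\<omega> n))) \<le> ereal (C1 / real w powr \<beta>)"
    and over: "\<And>\<nu> n. 1 \<le> \<nu> \<Longrightarrow> 1 \<le> n \<Longrightarrow> mean_excess_le (law \<mu> q p \<nu>) (past \<mu> (n - 1)) (incr n) C"
    and pos: "0 < D - C * (1 / 2) ^ J + ln (1 - \<alpha>) - C1 / (2 ^ R) powr \<beta>"
  shows "lorden_delay \<mu> q p (stop b) \<le> ennreal (2 + (b + 2 * C * J + ln (card W / \<alpha>) * R
        + C1 * 2 powr \<beta> * (\<Sum>j\<in>{1..2 ^ R}. 1 / real j powr \<beta>) + 2 * C1 / (2 ^ R) powr \<beta>)
      / (D - C * (1 / 2) ^ J + ln (1 - \<alpha>) - C1 / (2 ^ R) powr \<beta>))"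
    (is "_ \<le> ennreal (2 + ?E / ?d)")
proof -
  have "(\<integral>\<^sup>+\<omega>. indicator A \<omega> * ennreal_of_enat (stop b \<omega> + 1 - enat \<nu>) \<partial>law \<mu> q p \<nu>)
      \<le> ennreal (2 + ?E / ?d) * emeasure (law \<mu> q p \<nu>) A"
    if \<nu>: "1 \<le> \<nu>" and A: "A \<in> sets (past \<mu> (\<nu> - 1))" for \<nu> A
  proof -
    let ?M = "law \<mu> q p \<nu>"
    interpret M: prob_space ?M by (rule post.prob_L)
    have st: "stopping_time (obs_filtration \<mu>) (stop b)" by (rule stopping_time_stop)
    have Tm [measurable]: "stop b \<in> measurable ?M (count_space UNIV)"
      using st post.sets_L by (rule measurable_stopping_time_count_space)
    have A_M [measurable]: "A \<in> sets ?M" using A by (rule post.past_sets_L)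
    define B where "B j = A \<inter> {\<omega> \<in> obs_space \<mu>. enat (\<nu> + j) \<le> stop b \<omega>}" for j
    define a where "a j = M.prob (B j)" for j
    have a_le: "a j \<le> M.prob A" for j
      unfolding a_def using A_M by (intro M.finite_measure_mono) (auto simp: B_def)
    let ?F = "\<lambda>\<omega>. if \<omega> \<in> A then stop b \<omega> + 1 - enat \<nu> else 0"
    have Fm: "?F \<in> measurable ?M (count_space UNIV)" by measurable
    have "(\<integral>\<^sup>+\<omega>. indicator A \<omega> * ennreal_of_enat (stop b \<omega> + 1 - enat \<nu>) \<partial>?M) = (\<integral>\<^sup>+\<omega>. ennreal_of_enat (?F \<omega>) \<partial>?M)"
      by (intro nn_integral_cong) (simp add: indicator_def)
    also have "\<dots> = (\<Sum>t. emeasure ?M {\<omega> \<in> space ?M. enat t < ?F \<omega>})"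
      by (rule nn_integral_enat_function[OF Fm])
    also have "\<dots> = (\<Sum>t. ennreal (a t))"
    proof (intro suminf_cong)
      fix t
      have "{\<omega> \<in> space ?M. enat t < ?F \<omega>} = B t"
      proof (intro set_eqI iffI)
        have iff: "enat t < stop b \<omega> + 1 - enat \<nu> \<longleftrightarrow> enat (\<nu> + t) \<le> stop b \<omega>" for \<omega>
          by (cases "stop b \<omega>") (auto simp: one_enat_def)
        show "\<omega> \<in> B t" if "\<omega> \<in> {\<omega> \<in> space ?M. enat t < ?F \<omega>}" for \<omega>
          using that iff by (auto simp: B_def split: if_splits)
        show "\<omega> \<in> {\<omega> \<in> space ?M. enat t < ?F \<omega>}" if "\<omega> \<in> B t" for \<omega>
          using that iff by (auto simp: B_def)
      qed
      then show "emeasure ?M {\<omega> \<in> space ?M. enat t < ?F \<omega>} = ennreal (a t)"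
        by (simp only: a_def M.emeasure_eq_measure)
    qed
    also have "\<dots> \<le> ennreal ((2 + ?E / ?d) * M.prob A)"
      unfolding suminf_eq_SUP
    proof (intro SUP_least)
      fix n
      have U: "(\<Sum>j\<in>{2..n}. a j) \<le> ?E / ?d * M.prob A"
      proof -
        have "(\<Sum>j\<in>{2..n}. a j) * ?d \<le> M.prob A * ?E"
          unfolding a_def B_def
          by (rule expected_delay_le[OF \<nu> A R W_eq b C1 \<beta> C KL over[OF \<nu>]])
        then show ?thesis using pos by (simp add: pos_le_divide_eq mult.commute)
      qed
      have "(\<Sum>j<n. a j) \<le> (\<Sum>j\<in>{0, 1} \<union> {2..n}. a j)"
        by (intro sum_mono2) (auto simp: a_def)
      also have "\<dots> \<le> 2 * M.prob A + (\<Sum>j\<in>{2..n}. a j)"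
        using a_le[of 0] a_le[of 1] by (subst sum.union_disjoint) auto
      also have "\<dots> \<le> (2 + ?E / ?d) * M.prob A" using U by (simp add: distrib_right)
      finally show "(\<Sum>j<n. ennreal (a j)) \<le> ennreal ((2 + ?E / ?d) * M.prob A)"
        by (simp add: sum_ennreal a_def ennreal_leI)
    qed
    also have "\<dots> = ennreal (2 + ?E / ?d) * emeasure ?M A"
      by (simp only: M.emeasure_eq_measure ennreal_mult''[OF measure_nonneg])
    finally show ?thesis .
  qed
  moreover have "(\<lambda>\<omega>. ennreal_of_enat (stop b \<omega> + 1 - enat \<nu>)) \<in> borel_measurable (law \<mu> q p \<nu>)" for \<nu>
  proof -
    have [measurable]: "stop b \<in> measurable (law \<mu> q p \<nu>) (count_space UNIV)"
      using stopping_time_stop post.sets_L by (rule measurable_stopping_time_count_space)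
    show ?thesis by measurable
  qed
  ultimately show ?thesis
    unfolding lorden_delay_def by (intro SUP_least post.esssup_nn_cond_exp_le) auto
qed

end

section \<open>Asymptotics\<close>

text \<open>
  Integral comparison bound for the sum of \<open>1 / j powr \<beta>\<close> over \<open>1 \<le> j \<le> x\<close>.
\<close>
definition power_sum_bound :: "real \<Rightarrow> real \<Rightarrow> real" where
  "power_sum_bound \<beta> x = 1 + (if \<beta> = 1 then ln x else x powr (1 - \<beta>) / (1 - \<beta>))"

lemma power_sum_le:
  assumes \<beta>: "0 < \<beta>" "\<beta> \<le> 1" and m: "1 \<le> m"
  shows "(\<Sum>j\<in>{1..m}. 1 / real j powr \<beta>) \<le> power_sum_bound \<beta> m"
  using m
proof (induction m rule: dec_induct)
  case base
  then show ?case using \<beta> by (simp add: power_sum_bound_def)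
next
  case (step m)
  let ?x = "real m / real (Suc m)"
  have x: "0 < ?x" using step by simp
  have "1 / real (Suc m) powr \<beta> \<le> power_sum_bound \<beta> (Suc m) - power_sum_bound \<beta> m"
  proof (cases "\<beta> = 1")
    case True
    have "ln ?x \<le> ?x - 1" using x by (rule ln_le_minus_one)
    also have "\<dots> = - (1 / real (Suc m))" by (simp add: field_simps)
    finally show ?thesis using step True by (simp add: power_sum_bound_def ln_div)
  next
    case False
    define s where "s = 1 - \<beta>"
    have s: "0 < s" "s < 1" using False \<beta> by (auto simp: s_def)
    (* Bernoulli's inequality for a real exponent *)
    have "y powr s \<le> 1 - s * (1 - y)" if "0 < y" for y :: real
      using convex_onD[OF exp_convex, of s 0 "ln y"] s that by (simp add: powr_def algebra_simps)
    from this[OF x] have "real (Suc m) powr s * ?x powr s \<le> real (Suc m) powr s * (1 - s / real (Suc m))"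
      by (intro mult_left_mono) (auto simp: field_simps)
    also have "real (Suc m) powr s * ?x powr s = real m powr s"
      using step by (subst powr_mult[symmetric]) auto
    also have "real (Suc m) powr s * (1 - s / real (Suc m)) = real (Suc m) powr s - s * (1 / real (Suc m) powr \<beta>)"
    proof -
      have "X powr s * (1 - s / X) = X powr s - s * (1 / X powr \<beta>)" if "0 < X" for X :: real
      proof -
        have "X powr s / X = 1 / X powr \<beta>" using that by (simp add: s_def powr_diff)
        then show ?thesis by (simp add: right_diff_distrib) (metis mult.commute times_divide_eq_right mult.right_neutral)
      qed
      then show ?thesis by simp
    qed
    finally have "1 / real (Suc m) powr \<beta> \<le> (real (Suc m) powr s - real m powr s) / s"
      using s by (simp add: pos_le_divide_eq mult.commute)
    then show ?thesis using False by (simp add: power_sum_bound_def s_def diff_divide_distrib)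
  qed
  then show ?case using step by simp
qed

lemma power_sum_bound_mono:
  assumes "\<beta> \<le> 1" "0 < x" "x \<le> y"
  shows "power_sum_bound \<beta> x \<le> power_sum_bound \<beta> y"
proof (cases "\<beta> = 1")
  case False
  have "x powr (1 - \<beta>) \<le> y powr (1 - \<beta>)" using assms by (intro powr_mono2) auto
  then show ?thesis using assms False by (simp add: power_sum_bound_def divide_right_mono)
qed (use assms in \<open>simp add: power_sum_bound_def\<close>)

lemma dyadic_windows_size:
  assumes b: "1 < b"
  obtains R where "1 \<le> R" "dyadic_windows b = (\<lambda>r. 2 ^ r) ` {1..R}" "b \<le> 2 ^ R" "2 ^ R \<le> 2 * b"
    "real R \<le> log 2 b + 1"
proof
  let ?R = "nat \<lceil>log 2 b\<rceil>"
  have l: "0 < log 2 b" using b by simp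
  then show "1 \<le> ?R" by linarith
  show "dyadic_windows b = (\<lambda>r. 2 ^ r) ` {1..?R}" by (simp add: dyadic_windows_def)
  have R: "log 2 b \<le> real ?R" "real ?R \<le> log 2 b + 1" using l by linarith+
  then show "real ?R \<le> log 2 b + 1" by simp
  have pow: "2 powr real ?R = (2 :: real) ^ ?R" by (simp add: powr_realpow)
  have "b = 2 powr log 2 b" using b by simp
  also have "\<dots> \<le> 2 powr real ?R" using R by (intro powr_mono) auto
  finally show "b \<le> 2 ^ ?R" using pow by simp
  have "2 powr real ?R \<le> 2 powr (log 2 b + 1)" using R by (intro powr_mono) auto
  also have "\<dots> = 2 * b" using b by (simp add: powr_add)
  finally show "2 ^ ?R \<le> 2 * b" using pow by simp
qed

context change_point_KL
begin

text \<open>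
  The step count \<open>J\<close> of the overshoot bound is taken equal to the number \<open>R\<close> of windows, so that
  its tail \<open>(1 / 2) ^ R\<close> is at most \<open>1 / b\<close>.
\<close>
lemma pm_cusum_delay_le:
  fixes b \<beta> C1 C :: real
  assumes phat: "is_predictor \<mu> phat" and \<beta>: "0 < \<beta>" "\<beta> \<le> 1" and C1: "0 \<le> C1" and C: "0 < C"
    and KL: "\<And>w n. 1 \<le> w \<Longrightarrow> w < n \<Longrightarrow> ext_expectation (law \<mu> q p 1)
        (\<lambda>\<omega>. log_ratio (p (\<omega> n)) (window_pred phat w n \<omega> (\<omega> n))) \<le> ereal (C1 / real w powr \<beta>)"
    and over: "\<And>\<nu> n. 1 \<le> \<nu> \<Longrightarrow> 1 \<le> n \<Longrightarrow>
      mean_excess_le (law \<mu> q p \<nu>) (past \<mu> (n - 1)) (log_lik q (dyadic_windows b) (1 / b) phat n) C"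
    and b: "2 \<le> b" "(C + 2 + C1) * b powr (- \<beta>) \<le> D / 2"
  shows "lorden_delay \<mu> q p (pm_cusum_time q (dyadic_windows b) (1 / b) phat b)
    \<le> ennreal (b / D + 2
        + 2 / D * (2 * C * (log 2 b + 1) + ln ((log 2 b + 1) * b) * (log 2 b + 1)
            + 2 * C1 * power_sum_bound \<beta> (2 * b) + 2 * C1)
        + 2 * (C + 2 + C1) / D\<^sup>2 * b powr (1 - \<beta>))"
proof -
  have b1: "1 < b" using b by simp
  from dyadic_windows_size[OF b1] obtain R where R: "1 \<le> R"
    and windows: "dyadic_windows b = (\<lambda>r. 2 ^ r) ` {1..R}" and R_ge: "b \<le> 2 ^ R" and R_le: "2 ^ R \<le> 2 * b"
    and R_log: "real R \<le> log 2 b + 1" by blast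
  interpret pm_cusum_KL \<mu> q p phat "dyadic_windows b" "1 / b"
    by unfold_locales (use phat b1 R in \<open>auto simp: windows\<close>)
  define x where "x = C * (1 / 2) ^ R - ln (1 - 1 / b) + C1 / (2 ^ R) powr \<beta>"
  define E0 where "E0 = 2 * C * R + ln (card (dyadic_windows b) / (1 / b)) * R
      + C1 * 2 powr \<beta> * (\<Sum>j\<in>{1..2 ^ R}. 1 / real j powr \<beta>) + 2 * C1 / (2 ^ R) powr \<beta>"
  define K where "K = C + 2 + C1"
  have inv_b: "1 / b \<le> b powr (- \<beta>)"
  proof -
    have "1 / b = b powr (- 1)" using b1 by (simp add: powr_minus_divide)
    also have "\<dots> \<le> b powr (- \<beta>)" using b1 \<beta> by (intro powr_mono) auto
    finally show ?thesis .
  qed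
  have half: "(1 / 2 :: real) ^ R \<le> 1 / b"
    using R_ge b1 by (simp add: power_one_over frac_le)
  have ln_b: "- ln (1 - 1 / b) \<le> 2 * (1 / b)"
  proof -
    have "- (1 / b) - 2 * (1 / b)\<^sup>2 \<le> ln (1 - 1 / b)"
      using b by (intro ln_one_minus_pos_lower_bound) (auto simp: field_simps)
    moreover have "2 * (1 / b)\<^sup>2 \<le> 1 / b"
      using b by (simp add: power2_eq_square field_simps)
    ultimately show ?thesis by simp
  qed
  have powr_R: "b powr \<beta> \<le> (2 ^ R) powr \<beta>" using R_ge b1 \<beta> by (intro powr_mono2) auto
  have C1_b: "C1 / (2 ^ R) powr \<beta> \<le> C1 * b powr (- \<beta>)"
  proof -
    have "C1 / (2 ^ R) powr \<beta> \<le> C1 / b powr \<beta>"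
      using powr_R C1 b1 by (intro divide_left_mono mult_pos_pos) auto
    then show ?thesis by (simp add: powr_minus_divide)
  qed
  have x_le: "x \<le> K * b powr (- \<beta>)"
  proof -
    have "C * (1 / 2) ^ R \<le> C * b powr (- \<beta>)"
      using half inv_b C by (intro mult_left_mono) auto
    then show ?thesis using ln_b inv_b C1_b by (simp add: x_def K_def distrib_right)
  qed
  have x_nonneg: "0 \<le> x"
  proof -
    have "ln (1 - 1 / b) \<le> - (1 / b)"
      using ln_le_minus_one[of "1 - 1 / b"] b1 by simp
    then have "ln (1 - 1 / b) \<le> 0" using b1 by (simp add: order_trans)
    moreover have "0 \<le> C * (1 / 2) ^ R" "0 \<le> C1 / (2 ^ R) powr \<beta>" using C C1 by simp_all
    ultimately show ?thesis unfolding x_def by linarith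
  qed
  have x_half: "x \<le> D / 2" using x_le b(2) by (simp add: K_def)
  have card_le: "card (dyadic_windows b) \<le> R"
    unfolding windows using card_image_le[of "{1..R}" "\<lambda>r. (2::nat) ^ r"] by simp
  have "1 \<le> real (card (dyadic_windows b))" using card_W by simp
  then have card_b: "1 \<le> card (dyadic_windows b) * b" using b1 mult_mono[of 1 "real (card (dyadic_windows b))" 1 b] by simp
  have E0_nonneg: "0 \<le> E0"
    unfolding E0_def using C C1 card_b by (intro add_nonneg_nonneg mult_nonneg_nonneg sum_nonneg) auto
  have E0_le: "E0 \<le> 2 * C * (log 2 b + 1) + ln ((log 2 b + 1) * b) * (log 2 b + 1)
      + 2 * C1 * power_sum_bound \<beta> (2 * b) + 2 * C1"
    unfolding E0_def
  proof (intro add_mono)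
    show "2 * C * R \<le> 2 * C * (log 2 b + 1)" using C R_log by (intro mult_left_mono) auto
    have "ln (card (dyadic_windows b) * b) \<le> ln ((log 2 b + 1) * b)"
    proof (subst ln_le_cancel_iff)
      show le: "card (dyadic_windows b) * b \<le> (log 2 b + 1) * b"
        using card_le R_log b1 by (intro mult_right_mono) auto
      show "0 < card (dyadic_windows b) * b" using card_b by simp
      then show "0 < (log 2 b + 1) * b" using le by simp
    qed
    moreover have "0 \<le> ln ((log 2 b + 1) * b)" using calculation ln_ge_zero[OF card_b] by linarith
    ultimately show "ln (card (dyadic_windows b) / (1 / b)) * R \<le> ln ((log 2 b + 1) * b) * (log 2 b + 1)"
      using R_log by (intro mult_mono) auto
    have "(\<Sum>j\<in>{1..2 ^ R}. 1 / real j powr \<beta>) \<le> power_sum_bound \<beta> (real (2 ^ R))"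
      using power_sum_le[OF \<beta>, of "2 ^ R"] by simp
    also have "\<dots> \<le> power_sum_bound \<beta> (2 * b)"
      using R_le \<beta> by (intro power_sum_bound_mono) auto
    finally have H: "(\<Sum>j\<in>{1..2 ^ R}. 1 / real j powr \<beta>) \<le> power_sum_bound \<beta> (2 * b)" .
    have "2 powr \<beta> \<le> (2 powr 1 :: real)" using \<beta> by (intro powr_mono) auto
    show "C1 * 2 powr \<beta> * (\<Sum>j\<in>{1..2 ^ R}. 1 / real j powr \<beta>) \<le> 2 * C1 * power_sum_bound \<beta> (2 * b)"
    proof (rule mult_mono[OF _ H])
      show "C1 * 2 powr \<beta> \<le> 2 * C1"
        using mult_left_mono[of "2 powr \<beta>" 2 C1] C1 \<open>2 powr \<beta> \<le> 2 powr 1\<close> by simp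
    qed (use C1 in \<open>auto intro!: sum_nonneg\<close>)
    have "1 \<le> (2 ^ R :: real) powr \<beta>" using \<beta> by (intro ge_one_powr_ge_zero) auto
    then show "2 * C1 / (2 ^ R) powr \<beta> \<le> 2 * C1"
      using C1 by (simp add: pos_divide_le_eq mult_le_cancel_left1)
  qed
  have pos: "0 < D - x" using x_half D_pos by simp
  have "lorden_delay \<mu> q p (stop b) \<le> ennreal (2 + (b + E0) / (D - x))"
    using lorden_delay_upper_bound[OF R windows _ C1 \<beta>(1) C KL over, of b R] b1 pos
    by (simp add: E0_def x_def algebra_simps)
  also have "2 + (b + E0) / (D - x) \<le> 2 + (b / D + 2 * K / D\<^sup>2 * b powr (1 - \<beta>) + 2 / D * E0)"
  proof -
    have inv: "1 / (D - x) \<le> 2 / D" using x_half D_pos by (simp add: field_simps)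
    have "b / (D - x) = b / D + b * x / D * (1 / (D - x))"
      using pos D_pos by (simp add: field_simps)
    also have "b * x / D * (1 / (D - x)) \<le> b * (K * b powr (- \<beta>)) / D * (2 / D)"
      using x_le x_nonneg b1 D_pos pos inv by (intro mult_mono divide_right_mono mult_left_mono) auto
    also have "\<dots> = 2 * K / D\<^sup>2 * (b * b powr (- \<beta>))" by (simp add: power2_eq_square)
    also have "b * b powr (- \<beta>) = b powr (1 - \<beta>)"
      using b1 powr_add[of b 1 "- \<beta>"] by simp
    finally have "b / (D - x) \<le> b / D + 2 * K / D\<^sup>2 * b powr (1 - \<beta>)" by simp
    moreover have "E0 / (D - x) \<le> 2 / D * E0"
      using mult_right_mono[OF inv E0_nonneg] by simp
    ultimately show ?thesis by (simp add: add_divide_distrib)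
  qed
  also have "\<dots> \<le> b / D + 2
        + 2 / D * (2 * C * (log 2 b + 1) + ln ((log 2 b + 1) * b) * (log 2 b + 1)
            + 2 * C1 * power_sum_bound \<beta> (2 * b) + 2 * C1)
        + 2 * K / D\<^sup>2 * b powr (1 - \<beta>)"
    using mult_left_mono[OF E0_le, of "2 / D"] D_pos by simp
  finally show ?thesis unfolding K_def by (simp add: ennreal_leI)
qed

text \<open>
  The window length \<open>m\<close> is of order \<open>b\<^sup>2\<close>: long enough that a delay of order \<open>b\<close> rarely
  exceeds it, and short enough to cost only \<open>ln m = O(ln b)\<close>.
\<close>
lemma stopping_class_delay_ge:
  assumes T: "T \<in> stopping_class \<mu> q \<gamma>" and b: "b = ln \<gamma>" "1 \<le> b" "2 * (b\<^sup>2 + 1) \<le> \<gamma>"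
  shows "ennreal (b / D - (ln (2 * (b\<^sup>2 + 1)) + 1 / D + 1) / D) \<le> lorden_delay \<mu> q p T"
proof (cases "lorden_delay \<mu> q p T")
  case (real d)
  define m where "m = nat \<lceil>b\<^sup>2\<rceil>"
  have b2: "1 \<le> b\<^sup>2" using b(2) by simp
  have m: "b\<^sup>2 \<le> real m" "real m \<le> b\<^sup>2 + 1" "1 \<le> m" unfolding m_def using b2 by linarith+
  have \<gamma>: "0 < \<gamma>" using b m by (smt (verit) zero_le_power2)
  have low: "0 \<le> (ln (2 * (b\<^sup>2 + 1)) + 1 / D + 1) / D"
    using b2 D_pos by (intro divide_nonneg_pos add_nonneg_nonneg) auto
  have "b / D - (ln (2 * (b\<^sup>2 + 1)) + 1 / D + 1) / D \<le> d"
  proof (cases "b / D \<le> d")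
    case True
    then show ?thesis using low by simp
  next
    case False
    have main: "(1 - d / m) * ln (\<gamma> / (2 * real m)) - 1 \<le> D * d"
      using m b real by (intro lorden_delay_lower_bound[OF T]) auto
    let ?l = "ln (\<gamma> / (2 * real m))"
    have l: "?l = b - ln (2 * real m)" using \<gamma> m b by (simp add: ln_div)
    have "0 \<le> ?l" using m b \<gamma> by (intro ln_ge_zero) (simp add: field_simps)
    have l_le: "?l \<le> b" unfolding l using m by simp
    have "d / m * ?l \<le> d / m * b" using l_le real by (intro mult_left_mono) auto
    also have "\<dots> \<le> (b / D) / b\<^sup>2 * b"
      using False b m real b2 D_pos by (intro mult_right_mono frac_le) auto
    also have "\<dots> = 1 / D" using b by (simp add: power2_eq_square)
    finally have "?l - 1 / D - 1 \<le> D * d" using main by (simp add: left_diff_distrib)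
    moreover have "ln (2 * real m) \<le> ln (2 * (b\<^sup>2 + 1))" using m by simp
    ultimately have "b - ln (2 * (b\<^sup>2 + 1)) - 1 / D - 1 \<le> D * d" unfolding l by linarith
    then show ?thesis using D_pos by (simp add: field_simps)
  qed
  then show ?thesis using real by (simp add: ennreal_leI)
qed simp

end

text \<open>
  One error function serves both ranges of \<open>\<beta>\<close>: its second term is constant for \<open>\<beta> = 1\<close>, and for
  \<open>\<beta> < 1\<close> it dominates the first.
\<close>
lemma bigo_error_terms:
  fixes \<beta> :: real
  assumes "0 < \<beta>" "\<beta> \<le> 1"
  defines "err \<equiv> \<lambda>b::real. (ln b)\<^sup>2 + b powr (1 - \<beta>)"
  shows "(\<lambda>b. c) \<in> O[at_top](err)" "(\<lambda>b. log 2 b + 1) \<in> O[at_top](err)"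
    "(\<lambda>b. ln ((log 2 b + 1) * b) * (log 2 b + 1)) \<in> O[at_top](err)"
    "(\<lambda>b. b powr (1 - \<beta>)) \<in> O[at_top](err)" "(\<lambda>b. ln (2 * (b\<^sup>2 + 1))) \<in> O[at_top](err)"
    "(\<lambda>b. power_sum_bound \<beta> (2 * b)) \<in> O[at_top](err)" "err \<in> o[at_top](\<lambda>b. b)"
proof -
  have sq: "f \<in> O[at_top](err)" if "f \<in> O[at_top](\<lambda>b. (ln b)\<^sup>2)" for f :: "real \<Rightarrow> real"
    using that by (rule landau_o.big_trans) (auto intro!: bigoI[of _ 1] always_eventually simp: err_def)
  have pw: "f \<in> O[at_top](err)" if "f \<in> O[at_top](\<lambda>b. b powr (1 - \<beta>))" for f :: "real \<Rightarrow> real"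
    using that by (rule landau_o.big_trans) (auto intro!: bigoI[of _ 1] always_eventually simp: err_def)
  show const: "(\<lambda>b. c) \<in> O[at_top](err)" for c by (rule sq) real_asymp
  show "(\<lambda>b. log 2 b + 1) \<in> O[at_top](err)" by (rule sq) real_asymp
  show "(\<lambda>b. ln ((log 2 b + 1) * b) * (log 2 b + 1)) \<in> O[at_top](err)" by (rule sq) real_asymp
  show "(\<lambda>b. b powr (1 - \<beta>)) \<in> O[at_top](err)" by (rule pw) simp
  show "(\<lambda>b. ln (2 * (b\<^sup>2 + 1))) \<in> O[at_top](err)" by (rule sq) real_asymp
  show "(\<lambda>b. power_sum_bound \<beta> (2 * b)) \<in> O[at_top](err)"
  proof (cases "\<beta> = 1")
    case True
    have "(\<lambda>b::real. 1 + ln (2 * b)) \<in> O[at_top](\<lambda>b. (ln b)\<^sup>2)" by real_asymp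
    then show ?thesis using sq True by (simp add: power_sum_bound_def)
  next
    case False
    have "(\<lambda>b::real. (2 * b) powr (1 - \<beta>) / (1 - \<beta>)) \<in> O[at_top](\<lambda>b. b powr (1 - \<beta>))"
      using assms False by real_asymp
    then have "(\<lambda>b. (2 * b) powr (1 - \<beta>) / (1 - \<beta>)) \<in> O[at_top](err)" by (rule pw)
    then show ?thesis using False const[of 1] by (simp add: power_sum_bound_def sum_in_bigo)
  qed
  have "(\<lambda>b::real. (ln b)\<^sup>2) \<in> o[at_top](\<lambda>b. b)" by real_asymp
  moreover have "(\<lambda>b::real. b powr (1 - \<beta>)) \<in> o[at_top](\<lambda>b. b)" using assms by real_asymp
  ultimately show "err \<in> o[at_top](\<lambda>b. b)" unfolding err_def by (rule sum_in_smallo)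
qed

theorem theorem3p2:
  fixes \<mu> :: "'a measure"
    and q :: "'a \<Rightarrow> real"
    and fam :: "('a \<Rightarrow> real) set"
    and phat :: "nat \<Rightarrow> 'a list \<Rightarrow> 'a \<Rightarrow> real"
    and \<beta> C\<^sub>1 :: real
  assumes q: "is_prob_density \<mu> q"
    and fam: "\<And>p. p \<in> fam \<Longrightarrow> is_prob_density \<mu> p"
    and phat: "is_predictor \<mu> phat"
    and beta: "0 < \<beta>" "\<beta> \<le> 1"
    and KL_loss: "\<And>p w n. p \<in> fam \<Longrightarrow> 1 \<le> w \<Longrightarrow> w < n \<Longrightarrow>
      ext_expectation (law \<mu> q p 1) (\<lambda>\<omega>. log_ratio (p (\<omega> n)) (window_pred phat w n \<omega> (\<omega> n)))
        \<le> ereal (C\<^sub>1 / real w powr \<beta>)"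
    and overshoot: "\<And>p. p \<in> fam \<Longrightarrow> \<exists>C\<^sub>2::real. \<forall>b>1. \<forall>\<nu>\<ge>1. \<forall>n\<ge>1. \<forall>t\<ge>0.
      AE \<omega> in law \<mu> q p \<nu>.
        nn_cond_exp_event (law \<mu> q p \<nu>) (obs_filtration \<mu> (enat (n - 1)))
          {\<omega> \<in> space (law \<mu> q p \<nu>). ereal t \<le> log_lik q (dyadic_windows b) (1 / b) phat n \<omega>}
          (\<lambda>\<omega>. e2ennreal (log_lik q (dyadic_windows b) (1 / b) phat n \<omega> - ereal t)) \<omega>
        \<le> ennreal C\<^sub>2"
  defines "T \<equiv> \<lambda>b. pm_cusum_time q (dyadic_windows b) (1 / b) phat b"
  shows "\<forall>p\<in>fam. 0 < KL_div \<mu> p q \<and> KL_div \<mu> p q < \<infinity> \<longrightarrow>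
      (\<forall>\<^sub>F \<gamma> in at_top. lorden_delay \<mu> q p (T (ln \<gamma>)) < \<infinity>) \<and>
      (\<beta> = 1 \<longrightarrow>
        (\<lambda>\<gamma>. enn2real (lorden_delay \<mu> q p (T (ln \<gamma>))) - ln \<gamma> / real_of_ereal (KL_div \<mu> p q))
          \<in> O[at_top](\<lambda>\<gamma>. (ln (ln \<gamma>))\<^sup>2)) \<and>
      (\<beta> < 1 \<longrightarrow>
        (\<lambda>\<gamma>. enn2real (lorden_delay \<mu> q p (T (ln \<gamma>))) - ln \<gamma> / real_of_ereal (KL_div \<mu> p q))
          \<in> O[at_top](\<lambda>\<gamma>. ln \<gamma> powr (1 - \<beta>))) \<and>
      (\<lambda>\<gamma>. enn2real (lorden_delay \<mu> q p (T (ln \<gamma>))))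
        \<sim>[at_top] (\<lambda>\<gamma>. enn2real (INF S\<in>stopping_class \<mu> q \<gamma>. lorden_delay \<mu> q p S))"
  (is "\<forall>p\<in>fam. ?H p \<longrightarrow> ?goal p")
proof (intro ballI impI)
  fix p assume p_fam: "p \<in> fam" and KL: "0 < KL_div \<mu> p q \<and> KL_div \<mu> p q < \<infinity>"
  interpret change_point_KL \<mu> q p
    by unfold_locales (use q fam[OF p_fam] KL in auto)
  define C1 where "C1 = max C\<^sub>1 0"
  from overshoot[OF p_fam] obtain C\<^sub>2 where C2: "\<And>b \<nu> n. 1 < b \<Longrightarrow> 1 \<le> \<nu> \<Longrightarrow> 1 \<le> n \<Longrightarrow>
      mean_excess_le (law \<mu> q p \<nu>) (past \<mu> (n - 1)) (log_lik q (dyadic_windows b) (1 / b) phat n) C\<^sub>2"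
    unfolding mean_excess_le_def by blast
  define C where "C = max C\<^sub>2 1"
  have C: "0 < C" "C\<^sub>2 \<le> C" and C1: "0 \<le> C1" "C\<^sub>1 \<le> C1" by (auto simp: C_def C1_def)
  have over: "mean_excess_le (law \<mu> q p \<nu>) (past \<mu> (n - 1)) (log_lik q (dyadic_windows b) (1 / b) phat n) C"
    if "1 < b" "1 \<le> \<nu>" "1 \<le> n" for b \<nu> n
    using C2[OF that] C(2) by (rule mean_excess_le_mono)
  have KL1: "ext_expectation (law \<mu> q p 1)
        (\<lambda>\<omega>. log_ratio (p (\<omega> n)) (window_pred phat w n \<omega> (\<omega> n))) \<le> ereal (C1 / real w powr \<beta>)"
    if "1 \<le> w" "w < n" for w n
  proof -
    have "C\<^sub>1 / real w powr \<beta> \<le> C1 / real w powr \<beta>" using C1 by (intro divide_right_mono) auto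
    then show ?thesis using KL_loss[OF p_fam that] by (meson ereal_less_eq(3) order_trans)
  qed
  define V where "V b = lorden_delay \<mu> q p (T b)" for b
  define I where "I \<gamma> = (INF S\<in>stopping_class \<mu> q \<gamma>. lorden_delay \<mu> q p S)" for \<gamma>
  define up where "up b = 2
        + 2 / D * (2 * C * (log 2 b + 1) + ln ((log 2 b + 1) * b) * (log 2 b + 1)
            + 2 * C1 * power_sum_bound \<beta> (2 * b) + 2 * C1)
        + 2 * (C + 2 + C1) / D\<^sup>2 * b powr (1 - \<beta>)" for b
  define low where "low b = (ln (2 * (b\<^sup>2 + 1)) + 1 / D + 1) / D" for b :: real
  define err where "err b = (ln b)\<^sup>2 + b powr (1 - \<beta>)" for b :: real
  note error_terms = bigo_error_terms[OF beta, folded err_def]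
  have scale: "(\<lambda>b. c * f b) \<in> O[at_top](err)" if "f \<in> O[at_top](err)" for c :: real and f
    using that by simp
  have up: "up \<in> O[at_top](err)"
    unfolding up_def[abs_def] by (intro sum_in_bigo scale error_terms)
  have "(\<lambda>b. 1 / D * (ln (2 * (b\<^sup>2 + 1)) + 1 / D + 1)) \<in> O[at_top](err)"
    by (intro sum_in_bigo scale error_terms)
  then have low: "low \<in> O[at_top](err)" by (simp add: low_def[abs_def])
  have ev_b: "\<forall>\<^sub>F b in at_top. 2 \<le> b \<and> (C + 2 + C1) * b powr (- \<beta>) \<le> D / 2 \<and> 2 * (b\<^sup>2 + 1) \<le> exp b"
  proof (intro eventually_conj)
    have "((\<lambda>b. (C + 2 + C1) * b powr (- \<beta>)) \<longlongrightarrow> 0) at_top" using beta by real_asymp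
    then have "\<forall>\<^sub>F b in at_top. (C + 2 + C1) * b powr (- \<beta>) < D / 2"
      using D_pos by (intro order_tendstoD(2)) auto
    then show "\<forall>\<^sub>F b in at_top. (C + 2 + C1) * b powr (- \<beta>) \<le> D / 2"
      by eventually_elim simp
    show "\<forall>\<^sub>F b in at_top. 2 * (b\<^sup>2 + 1) \<le> exp (b :: real)" by real_asymp
  qed (rule eventually_ge_at_top)
  have ln_top: "filterlim ln at_top (at_top :: real filter)" by real_asymp
  have bounds: "\<forall>\<^sub>F \<gamma> in at_top. V (ln \<gamma>) \<le> ennreal (ln \<gamma> / D + up (ln \<gamma>))
      \<and> ennreal (ln \<gamma> / D - low (ln \<gamma>)) \<le> I \<gamma> \<and> I \<gamma> \<le> V (ln \<gamma>) \<and> 1 \<le> ln \<gamma>"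
    using eventually_compose_filterlim[OF ev_b ln_top] eventually_gt_at_top[of 0]
  proof eventually_elim
    case (elim \<gamma>)
    let ?b = "ln \<gamma>"
    have b: "2 \<le> ?b" "(C + 2 + C1) * ?b powr (- \<beta>) \<le> D / 2" "2 * (?b\<^sup>2 + 1) \<le> \<gamma>"
      using elim by auto
    have "V ?b \<le> ennreal (?b / D + up ?b)"
      unfolding V_def T_def up_def
      using pm_cusum_delay_le[OF phat beta C1(1) C(1) KL1 over b(1,2)] b(1) by (simp add: add.assoc)
    moreover have "ennreal (?b / D - low ?b) \<le> I \<gamma>"
      unfolding I_def low_def
    proof (rule INF_greatest)
      fix S assume S: "S \<in> stopping_class \<mu> q \<gamma>"
      show "ennreal (?b / D - (ln (2 * (?b\<^sup>2 + 1)) + 1 / D + 1) / D) \<le> lorden_delay \<mu> q p S"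
        by (rule stopping_class_delay_ge[OF S refl]) (use b in linarith)+
    qed
    moreover have "I \<gamma> \<le> V ?b"
    proof -
      have b1: "1 < ?b" using b(1) by linarith
      obtain R where R: "1 \<le> R" "dyadic_windows ?b = (\<lambda>r. 2 ^ r) ` {1..R}"
        by (rule dyadic_windows_size[OF b1])
      interpret pm_cusum \<mu> q p phat "dyadic_windows ?b" "1 / ?b"
        by unfold_locales (use phat b1 R in auto)
      show ?thesis
        unfolding I_def V_def T_def using elim(2) by (intro INF_lower stop_in_stopping_class)
    qed
    ultimately show ?case using b by simp
  qed
  (* As y is nonnegative, the clipping of negative numbers by ennreal does no harm. *)
  have est: "\<bar>enn2real x - y\<bar> \<le> \<bar>u\<bar> + \<bar>l\<bar>"
    if "x \<le> ennreal (y + u)" "ennreal (y - l) \<le> x" "0 \<le> y" for x y u l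
  proof -
    have "x < top" using that(1) ennreal_less_top by (rule le_less_trans)
    then obtain r where r: "x = ennreal r" "0 \<le> r" by (cases x) auto
    have "r \<le> max (y + u) 0" using that(1) r by (auto simp: ennreal_le_iff2 max_def)
    moreover have "y - l \<le> r" using that(2) r by (simp add: ennreal_le_iff)
    ultimately show ?thesis using r that(3) by (auto simp: max_def abs_if split: if_splits)
  qed
  have finite: "\<forall>\<^sub>F \<gamma> in at_top. V (ln \<gamma>) < \<infinity>"
    using bounds by eventually_elim (auto intro: le_less_trans)
  have V_bigo: "(\<lambda>\<gamma>. enn2real (V (ln \<gamma>)) - ln \<gamma> / D) \<in> O[at_top](\<lambda>\<gamma>. err (ln \<gamma>))"
    and I_bigo: "(\<lambda>\<gamma>. enn2real (I \<gamma>) - ln \<gamma> / D) \<in> O[at_top](\<lambda>\<gamma>. err (ln \<gamma>))"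
  proof -
    have "(\<lambda>b. \<bar>up b\<bar> + \<bar>low b\<bar>) \<in> O[at_top](err)"
      using up low by (intro sum_in_bigo) auto
    then have e: "(\<lambda>\<gamma>. \<bar>up (ln \<gamma>)\<bar> + \<bar>low (ln \<gamma>)\<bar>) \<in> O[at_top](\<lambda>\<gamma>. err (ln \<gamma>))"
      by (rule landau_o.big.compose[OF _ ln_top])
    have "\<forall>\<^sub>F \<gamma> in at_top. norm (enn2real (V (ln \<gamma>)) - ln \<gamma> / D) \<le> 1 * norm (\<bar>up (ln \<gamma>)\<bar> + \<bar>low (ln \<gamma>)\<bar>)"
      using bounds
    proof eventually_elim
      case (elim \<gamma>)
      then have "\<bar>enn2real (V (ln \<gamma>)) - ln \<gamma> / D\<bar> \<le> \<bar>up (ln \<gamma>)\<bar> + \<bar>low (ln \<gamma>)\<bar>"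
        using D_pos by (intro est) (auto intro: order_trans)
      then show ?case by simp
    qed
    then show "(\<lambda>\<gamma>. enn2real (V (ln \<gamma>)) - ln \<gamma> / D) \<in> O[at_top](\<lambda>\<gamma>. err (ln \<gamma>))"
      by (rule landau_o.big_trans[OF bigoI e])
    have "\<forall>\<^sub>F \<gamma> in at_top. norm (enn2real (I \<gamma>) - ln \<gamma> / D) \<le> 1 * norm (\<bar>up (ln \<gamma>)\<bar> + \<bar>low (ln \<gamma>)\<bar>)"
      using bounds
    proof eventually_elim
      case (elim \<gamma>)
      then have "\<bar>enn2real (I \<gamma>) - ln \<gamma> / D\<bar> \<le> \<bar>up (ln \<gamma>)\<bar> + \<bar>low (ln \<gamma>)\<bar>"
        using D_pos by (intro est) (auto intro: order_trans)
      then show ?case by simp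
    qed
    then show "(\<lambda>\<gamma>. enn2real (I \<gamma>) - ln \<gamma> / D) \<in> O[at_top](\<lambda>\<gamma>. err (ln \<gamma>))"
      by (rule landau_o.big_trans[OF bigoI e])
  qed
  have equiv: "f \<sim>[at_top] (\<lambda>\<gamma>. ln \<gamma> / D)"
    if "(\<lambda>\<gamma>. f \<gamma> - ln \<gamma> / D) \<in> O[at_top](\<lambda>\<gamma>. err (ln \<gamma>))" for f :: "real \<Rightarrow> real"
  proof (rule smallo_imp_asymp_equiv)
    have "(\<lambda>\<gamma>. err (ln \<gamma>)) \<in> o[at_top](\<lambda>\<gamma>. ln \<gamma>)"
      by (rule landau_o.small.compose[OF error_terms(7) ln_top])
    then have "(\<lambda>\<gamma>. err (ln \<gamma>)) \<in> o[at_top](\<lambda>\<gamma>. ln \<gamma> / D)" using D_pos by simp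
    with that show "(\<lambda>\<gamma>. f \<gamma> - ln \<gamma> / D) \<in> o[at_top](\<lambda>\<gamma>. ln \<gamma> / D)"
      by (rule landau_o.big_small_trans)
  qed
  have "(\<lambda>\<gamma>. enn2real (V (ln \<gamma>))) \<sim>[at_top] (\<lambda>\<gamma>. enn2real (I \<gamma>))"
    using equiv[OF V_bigo] equiv[OF I_bigo] by (metis asymp_equiv_sym asymp_equiv_trans)
  moreover have "(\<lambda>\<gamma>. enn2real (V (ln \<gamma>)) - ln \<gamma> / D) \<in> O[at_top](\<lambda>\<gamma>. (ln (ln \<gamma>))\<^sup>2)" if "\<beta> = 1"
  proof -
    have "(\<lambda>b::real. (ln b)\<^sup>2 + b powr (1 - 1)) \<in> O[at_top](\<lambda>b. (ln b)\<^sup>2)" by real_asymp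
    then have "err \<in> O[at_top](\<lambda>b. (ln b)\<^sup>2)" using that by (simp add: err_def[abs_def])
    from landau_o.big_trans[OF V_bigo landau_o.big.compose[OF this ln_top]] show ?thesis .
  qed
  moreover have "(\<lambda>\<gamma>. enn2real (V (ln \<gamma>)) - ln \<gamma> / D) \<in> O[at_top](\<lambda>\<gamma>. ln \<gamma> powr (1 - \<beta>))" if "\<beta> < 1"
  proof -
    have "err \<in> O[at_top](\<lambda>b. b powr (1 - \<beta>))" unfolding err_def[abs_def] using that by real_asymp
    from landau_o.big_trans[OF V_bigo landau_o.big.compose[OF this ln_top]] show ?thesis .
  qed
  ultimately show "?goal p"
    using finite unfolding V_def I_def D_def by blast
qed

end
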